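(* Let $\alpha_1,\alpha_2\ge 0$ with $(\alpha_1,\alpha_2)\ne(0,0)$, and consider the bi-Heisenberg group with parameters $\alpha_1,\alpha_2$, i.e. the sub-Riemannian structure on $\mathbb{R}^5$ (coordinates $(x_1,y_1,x_2,y_2,z)$) for which $$X_1=\partial_{x_1}-\tfrac{\alpha_1}{2}y_1\partial_z,\quad Y_1=\partial_{y_1}+\tfrac{\alpha_1}{2}x_1\partial_z,\quad X_2=\partial_{x_2}-\tfrac{\alpha_2}{2}y_2\partial_z,\quad Y_2=\partial_{y_2}+\tfrac{\alpha_2}{2}x_2\partial_z$$ is an orthonormal frame. The cut locus $\mathrm{Cut}_0$ starting from the origin is characterized as follows: (i) if $0<\alpha_2=\alpha_1$, then $$\mathrm{Cut}_0=\{(0,0,0,0,z) : z\in\mathbb{R}\setminus\{0\}\};$$ (ii) if $0<\alpha_2<\alpha_1$, then $$\mathrm{Cut}_0=\{(0,0,x_2,y_2,z) : |z|\ge (x_2^2+y_2^2)\,K(\alpha_1,\alpha_2),\ (x_2,y_2,z)\in\mathbb{R}^3\setminus\{0\}\},$$ where $$K(\alpha_1,\alpha_2):=\frac{\alpha_2^2}{8}\left(\frac{2\pi}{\alpha_1}-\frac{1}{\alpha_2}\sin\left(2\pi\frac{\alpha_2}{\alpha_1}\right)\right)\sin^{-2}\left(\pi\frac{\alpha_2}{\alpha_1}\right);$$ (iii) if $0=\alpha_2<\alpha_1$, then $$\mathrm{Cut}_0=\{(0,0,x_2,y_2,z) : (x_2,y_2,z)\in\mathbb{R}^3,\ z\ne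 0\}.$$ Moreover, in case (i) every point of the cut locus is reached by a family of optimal geodesics (from the origin) parametrized by $S^3$; in cases (ii) and (iii) every point of the cut locus is reached by a family of optimal geodesics parametrized by $S^1$. As a consequence, all cut points are also conjugate points.
   Context: The sub-Riemannian structure is given by the distribution $\mathcal{D}_q=\mathrm{span}\{X_1(q),Y_1(q),X_2(q),Y_2(q)\}$ with the inner product $g_q$ on $\mathcal{D}_q$ making $X_1,Y_1,X_2,Y_2$ orthonormal. A Lipschitz curve $\gamma:[0,T]\to\mathbb{R}^5$ is horizontal if $\dot\gamma(t)\in\mathcal{D}_{\gamma(t)}$ for a.e. $t$; its length is $\ell(\gamma)=\int_0^T|\dot\gamma(t)|_g\,dt$, and the sub-Riemannian distance $d(q_0,q_1)$ is the infimum of lengths of horizontal curves joining $q_0$ to $q_1$. A geodesic is a horizontal curve with $|\dot\gamma|_g$ constant that is locally length minimizing (every time $t$ has a neighbourhood $[t-\varepsilon,t+\varepsilon]$ on which the curve is a length minimizer); it is parametrized by arclength if $|\dot\gamma|_g=1$. Geodesics are defined for all $t\ge0$ since the space is complete. A geodesic is optimal on $[0,t]$ if its restriction to $[0,t]$ is a length minimizer between its endpoints. Cut locus: for an arclength geodesic $\gamma$ from the origin, $t_{\mathrm{cut}}(\gamma)=\sup\{t>0 : \gamma|_{[0,t]}\text{ is optimal}\}$, and $\mathrm{Cut}_0=\{\gamma(t_{\mathrm{cut}}(\gamma)) : \gamma\text{ arclength geodesic from }0\}$ (over those $\gamma$ with $t_{\mathrm{cut}}(\gamma)<\infty$). Conjugate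 points: let $H(q,p)=\frac12\sum_{i=1}^2\left(\langle p,X_i(q)\rangle^2+\langle p,Y_i(q)\rangle^2\right)$, let $\vec H$ be its Hamiltonian vector field on $T^*\mathbb{R}^5$, let $\pi:T^*\mathbb{R}^5\to\mathbb{R}^5$ be the projection, and let $\Lambda_0=\{p_0\in T_0^*\mathbb{R}^5 : H(0,p_0)=1/2\}$. The exponential map is $\exp_0:\Lambda_0\times\mathbb{R}^+\to\mathbb{R}^5$, $\exp_0(p_0,t)=\pi(e^{t\vec H}(0,p_0))$. For an arclength geodesic $\gamma(t)=\exp_0(p_0,t)$ which is not abnormal, the first conjugate time is $t_{\mathrm{con}}(\gamma)=\min\{t>0 : (p_0,t)\text{ is a critical point of }\exp_0\}$, and the (first) conjugate points from $0$ are the points $\gamma(t_{\mathrm{con}}(\gamma))$. Here a horizontal curve $q(\cdot)$ with controls $u_j$, $\dot q=\sum_j u_jF_j(q)$ with $(F_j)=(X_1,Y_1,X_2,Y_2)$, is abnormal if there is a nowhere zero Lipschitz covector curve $p(t)\in T^*_{q(t)}\mathbb{R}^5$ such that $(q,p)$ solves the Hamiltonian equations of $\mathcal{H}(t,q,p)=\sum_j u_j(t)\langle p,F_j(q)\rangle$ and $\langle p(t),F_j(q(t))\rangle=0$ for all $j$.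
   Formalization: In case (ii), at boundary points |z| = (x2²+y2²)K the optimal geodesic is unique, so the S^1-family there is constant; the family is asserted to be injective (a genuine circle) only where |z| > (x2²+y2²)K. *)

theory Defs
  imports "HOL-Analysis.Analysis"
begin

text \<open>
  Sub-Riemannian structures on \<open>\<real>\<^sup>n\<close> given by a global orthonormal frame \<open>F\<close>: \<open>F q $ j\<close> is the
  value at \<open>q\<close> of the \<open>j\<close>-th vector field.  The fields are meant to be smooth and pointwise
  linearly independent, and the Hamiltonian flow below is meant to be complete; otherwise the
  definite descriptions carry no information.
\<close>

type_synonym ('n, 'm) frame = "real^'n \<Rightarrow> real^'n^'m"

definition distribution :: "('n::finite, 'm::finite) frame \<Rightarrow> real^'n \<Rightarrow> (real^'n) set" where
  "distribution F q = span (range (\<lambda>j. F q $ j))"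

definition frame_coords ::
  "('n::finite, 'm::finite) frame \<Rightarrow> real^'n \<Rightarrow> real^'n \<Rightarrow> real^'m" where
  "frame_coords F q v = (THE u. v = (\<Sum>j\<in>UNIV. u $ j *\<^sub>R F q $ j))"

definition sr_inner ::
  "('n::finite, 'm::finite) frame \<Rightarrow> real^'n \<Rightarrow> real^'n \<Rightarrow> real^'n \<Rightarrow> real" where
  "sr_inner F q v w = frame_coords F q v \<bullet> frame_coords F q w"

definition sr_norm :: "('n::finite, 'm::finite) frame \<Rightarrow> real^'n \<Rightarrow> real^'n \<Rightarrow> real" where
  "sr_norm F q v = sqrt (sr_inner F q v v)"

text \<open>Curves are total functions; only their values on the interval in question matter.\<close>

definition horizontal ::
  "('n::finite, 'm::finite) frame \<Rightarrow> real \<Rightarrow> real \<Rightarrow> (real \<Rightarrow> real^'n) \<Rightarrow> bool" where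
  "horizontal F a b \<gamma> \<longleftrightarrow>
     (\<exists>L. L-lipschitz_on {a..b} \<gamma>) \<and>
     (AE t in lebesgue_on {a..b}.
        \<exists>v\<in>distribution F (\<gamma> t). (\<gamma> has_vector_derivative v) (at t))"

definition sr_speed ::
  "('n::finite, 'm::finite) frame \<Rightarrow> (real \<Rightarrow> real^'n) \<Rightarrow> real \<Rightarrow> real" where
  "sr_speed F \<gamma> t = sr_norm F (\<gamma> t) (vector_derivative \<gamma> (at t))"

definition sr_length ::
  "('n::finite, 'm::finite) frame \<Rightarrow> real \<Rightarrow> real \<Rightarrow> (real \<Rightarrow> real^'n) \<Rightarrow> real" where
  "sr_length F a b \<gamma> = integral {a..b} (sr_speed F \<gamma>)"

definition sr_dist :: "('n::finite, 'm::finite) frame \<Rightarrow> real^'n \<Rightarrow> real^'n \<Rightarrow> real" where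
  "sr_dist F q0 q1 =
     Inf {sr_length F 0 T \<gamma> | T \<gamma>. 0 \<le> T \<and> horizontal F 0 T \<gamma> \<and> \<gamma> 0 = q0 \<and> \<gamma> T = q1}"

definition length_minimizer ::
  "('n::finite, 'm::finite) frame \<Rightarrow> real \<Rightarrow> real \<Rightarrow> (real \<Rightarrow> real^'n) \<Rightarrow> bool" where
  "length_minimizer F a b \<gamma> \<longleftrightarrow>
     horizontal F a b \<gamma> \<and> sr_length F a b \<gamma> = sr_dist F (\<gamma> a) (\<gamma> b)"

text \<open>Geodesics are defined on \<open>[0,\<infinity>)\<close>, so at \<open>t < \<epsilon>\<close> the neighbourhood of \<open>t\<close> is cut off at \<open>0\<close>.\<close>

definition geodesic :: "('n::finite, 'm::finite) frame \<Rightarrow> (real \<Rightarrow> real^'n) \<Rightarrow> bool" where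
  "geodesic F \<gamma> \<longleftrightarrow>
     (\<forall>T\<ge>0. horizontal F 0 T \<gamma>) \<and>
     (\<exists>c. AE t in lebesgue_on {0..}. sr_speed F \<gamma> t = c) \<and>
     (\<forall>t\<ge>0. \<exists>\<epsilon>>0. length_minimizer F (max 0 (t - \<epsilon>)) (t + \<epsilon>) \<gamma>)"

definition arclength_geodesic ::
  "('n::finite, 'm::finite) frame \<Rightarrow> real^'n \<Rightarrow> (real \<Rightarrow> real^'n) \<Rightarrow> bool" where
  "arclength_geodesic F q0 \<gamma> \<longleftrightarrow>
     geodesic F \<gamma> \<and> \<gamma> 0 = q0 \<and> (AE t in lebesgue_on {0..}. sr_speed F \<gamma> t = 1)"

definition cut_time :: "('n::finite, 'm::finite) frame \<Rightarrow> (real \<Rightarrow> real^'n) \<Rightarrow> ereal" where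
  "cut_time F \<gamma> = Sup (ereal ` {t. 0 < t \<and> length_minimizer F 0 t \<gamma>})"

definition cut_locus :: "('n::finite, 'm::finite) frame \<Rightarrow> real^'n \<Rightarrow> (real^'n) set" where
  "cut_locus F q0 =
     {\<gamma> (real_of_ereal (cut_time F \<gamma>)) | \<gamma>. arclength_geodesic F q0 \<gamma> \<and> cut_time F \<gamma> < \<infinity>}"

text \<open>The cotangent bundle of \<open>\<real>\<^sup>n\<close> is \<open>\<real>\<^sup>n \<times> \<real>\<^sup>n\<close>, with the inner product as duality pairing.\<close>

definition hamiltonian_field ::
  "((real^'n) \<times> (real^'n) \<Rightarrow> real) \<Rightarrow> (real^'n) \<times> (real^'n) \<Rightarrow> (real^'n::finite) \<times> (real^'n)" where
  "hamiltonian_field h = (\<lambda>(q, p).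
     (\<chi> i. deriv (\<lambda>s. h (q, p + s *\<^sub>R axis i 1)) 0,
      \<chi> i. - deriv (\<lambda>s. h (q + s *\<^sub>R axis i 1, p)) 0))"

definition hamiltonian_flow ::
  "((real^'n) \<times> (real^'n) \<Rightarrow> real) \<Rightarrow> (real^'n) \<times> (real^'n) \<Rightarrow> real
     \<Rightarrow> (real^'n::finite) \<times> (real^'n)" where
  "hamiltonian_flow h x =
     (THE c. c 0 = x \<and> (\<forall>t. (c has_vector_derivative hamiltonian_field h (c t)) (at t)))"

definition sr_hamiltonian ::
  "('n::finite, 'm::finite) frame \<Rightarrow> (real^'n) \<times> (real^'n) \<Rightarrow> real" where
  "sr_hamiltonian F = (\<lambda>(q, p). 1/2 * (\<Sum>j\<in>UNIV. (p \<bullet> F q $ j)\<^sup>2))"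

definition unit_covectors :: "('n::finite, 'm::finite) frame \<Rightarrow> real^'n \<Rightarrow> (real^'n) set" where
  "unit_covectors F q0 = {p. sr_hamiltonian F (q0, p) = 1/2}"

definition sr_exp ::
  "('n::finite, 'm::finite) frame \<Rightarrow> real^'n \<Rightarrow> real^'n \<Rightarrow> real \<Rightarrow> real^'n" where
  "sr_exp F q0 p t = fst (hamiltonian_flow (sr_hamiltonian F) (q0, p) t)"

text \<open>
  The Hamiltonian is quadratic in \<open>p\<close>, so \<open>1/2\<close> is a regular value of it on the fibre over \<open>q0\<close>,
  and the tangent space of \<open>unit_covectors F q0\<close> at \<open>p0\<close> is the kernel of its differential.
\<close>

definition unit_covectors_tangent ::
  "('n::finite, 'm::finite) frame \<Rightarrow> real^'n \<Rightarrow> real^'n \<Rightarrow> (real^'n) set" where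
  "unit_covectors_tangent F q0 p0 =
     {\<xi>. frechet_derivative (\<lambda>p. sr_hamiltonian F (q0, p)) (at p0) \<xi> = 0}"

text \<open>
  \<open>(p0, t)\<close> is a critical point of the exponential map restricted to
  \<open>unit_covectors F q0 \<times> {0<..}\<close>: the differential of the restriction is not onto.
\<close>

definition exp_critical ::
  "('n::finite, 'm::finite) frame \<Rightarrow> real^'n \<Rightarrow> real^'n \<Rightarrow> real \<Rightarrow> bool" where
  "exp_critical F q0 p0 t \<longleftrightarrow>
     frechet_derivative (\<lambda>(p, s). sr_exp F q0 p s) (at (p0, t))
       ` (unit_covectors_tangent F q0 p0 \<times> UNIV) \<noteq> UNIV"

definition abnormal :: "('n::finite, 'm::finite) frame \<Rightarrow> (real \<Rightarrow> real^'n) \<Rightarrow> bool" where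
  "abnormal F \<gamma> \<longleftrightarrow> (\<exists>(u :: real \<Rightarrow> real^'m) (p :: real \<Rightarrow> real^'n).
     (\<forall>T\<ge>0. \<exists>L. L-lipschitz_on {0..T} p) \<and>
     (\<forall>t\<ge>0. p t \<noteq> 0) \<and>
     (AE t in lebesgue_on {0..}.
        ((\<lambda>s. (\<gamma> s, p s)) has_vector_derivative
           hamiltonian_field (\<lambda>(q, r). \<Sum>j\<in>UNIV. u t $ j * (r \<bullet> F q $ j)) (\<gamma> t, p t)) (at t)) \<and>
     (\<forall>t\<ge>0. \<forall>j. p t \<bullet> F (\<gamma> t) $ j = 0))"

definition first_conjugate_time ::
  "('n::finite, 'm::finite) frame \<Rightarrow> real^'n \<Rightarrow> real^'n \<Rightarrow> real \<Rightarrow> bool" where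
  "first_conjugate_time F q0 p0 t \<longleftrightarrow>
     0 < t \<and> exp_critical F q0 p0 t \<and> (\<forall>s. 0 < s \<and> s < t \<longrightarrow> \<not> exp_critical F q0 p0 s)"

definition conjugate_locus :: "('n::finite, 'm::finite) frame \<Rightarrow> real^'n \<Rightarrow> (real^'n) set" where
  "conjugate_locus F q0 =
     {\<gamma> t | \<gamma> p0 t. arclength_geodesic F q0 \<gamma> \<and> p0 \<in> unit_covectors F q0 \<and>
        (\<forall>s\<ge>0. \<gamma> s = sr_exp F q0 p0 s) \<and> \<not> abnormal F \<gamma> \<and> first_conjugate_time F q0 p0 t}"

text \<open>An arclength geodesic that is optimal up to \<open>q\<close> has length \<open>sr_dist F q0 q\<close>, hence reaches
  \<open>q\<close> at exactly that time.\<close>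

definition optimal_geodesics ::
  "('n::finite, 'm::finite) frame \<Rightarrow> real^'n \<Rightarrow> real^'n \<Rightarrow> (real \<Rightarrow> real^'n) set" where
  "optimal_geodesics F q0 q =
     {\<gamma>. arclength_geodesic F q0 \<gamma> \<and> \<gamma> (sr_dist F q0 q) = q \<and>
         length_minimizer F 0 (sr_dist F q0 q) \<gamma>}"

text \<open>
  \<open>\<Gamma>\<close> is a continuous family, indexed by the space \<open>S\<close>, of optimal geodesics from \<open>q0\<close> to \<open>q\<close>,
  exhausting all of them.  Geodesics are identified when they agree up to the time they reach
  \<open>q\<close>.  Injectivity is the separate predicate below; for compact \<open>S\<close> an injective family is a
  homeomorphism onto the space of optimal geodesics.
\<close>

definition optimal_family ::
  "('n::finite, 'm::finite) frame \<Rightarrow> real^'n \<Rightarrow> real^'n \<Rightarrow> 's::topological_space set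
     \<Rightarrow> ('s \<Rightarrow> real \<Rightarrow> real^'n) \<Rightarrow> bool" where
  "optimal_family F q0 q S \<Gamma> \<longleftrightarrow>
     continuous_on (S \<times> {0..sr_dist F q0 q}) (\<lambda>(s, t). \<Gamma> s t) \<and>
     (\<forall>s\<in>S. \<Gamma> s \<in> optimal_geodesics F q0 q) \<and>
     (\<forall>\<gamma>\<in>optimal_geodesics F q0 q. \<exists>s\<in>S. \<forall>t\<in>{0..sr_dist F q0 q}. \<gamma> t = \<Gamma> s t)"

definition injective_family ::
  "('n::finite, 'm::finite) frame \<Rightarrow> real^'n \<Rightarrow> real^'n \<Rightarrow> 's set
     \<Rightarrow> ('s \<Rightarrow> real \<Rightarrow> real^'n) \<Rightarrow> bool" where
  "injective_family F q0 q S \<Gamma> \<longleftrightarrow>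
     (\<forall>s\<in>S. \<forall>s'\<in>S. (\<forall>t\<in>{0..sr_dist F q0 q}. \<Gamma> s t = \<Gamma> s' t) \<longrightarrow> s = s')"

text \<open>The coordinates \<open>(x\<^sub>1, y\<^sub>1, x\<^sub>2, y\<^sub>2, z)\<close> of \<open>\<real>\<^sup>5\<close> are the components \<open>1, \<dots>, 5\<close>, and
  \<open>axis i 1\<close> is the corresponding coordinate field.\<close>

definition bi_heisenberg :: "real \<Rightarrow> real \<Rightarrow> (5, 4) frame" where
  "bi_heisenberg \<alpha>1 \<alpha>2 q = vector
     [axis 1 1 - (\<alpha>1 / 2 * q $ 2) *\<^sub>R axis 5 1,
      axis 2 1 + (\<alpha>1 / 2 * q $ 1) *\<^sub>R axis 5 1,
      axis 3 1 - (\<alpha>2 / 2 * q $ 4) *\<^sub>R axis 5 1,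
      axis 4 1 + (\<alpha>2 / 2 * q $ 3) *\<^sub>R axis 5 1]"

text \<open>
  For \<open>0 < \<alpha>2 < \<alpha>1\<close>, equality \<open>\<bar>z\<bar> = (x\<^sub>2\<^sup>2 + y\<^sub>2\<^sup>2) K\<close> holds exactly at the cut points of geodesics that
  stay in \<open>x\<^sub>1 = y\<^sub>1 = 0\<close>.  The circle of geodesics, which comes from rotating the \<open>(x\<^sub>1, y\<^sub>1)\<close>-plane,
  degenerates there to a single geodesic, so injectivity can only be asked for off this boundary.
\<close>

definition bi_heisenberg_K :: "real \<Rightarrow> real \<Rightarrow> real" where
  "bi_heisenberg_K \<alpha>1 \<alpha>2 =
     \<alpha>2\<^sup>2 / 8 * (2 * pi / \<alpha>1 - 1 / \<alpha>2 * sin (2 * pi * (\<alpha>2 / \<alpha>1))) / (sin (pi * (\<alpha>2 / \<alpha>1)))\<^sup>2"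

end

theory Submission
  imports Defs "HOL-Real_Asymp.Real_Asymp"
begin

text \<open>
  Everything rests on a sharp lower bound for the energy of a horizontal curve. In each plane
  \<open>(x\<^sub>j, y\<^sub>j)\<close> the length constraint and the area constraint are combined with a Lagrange multiplier
  \<open>w\<close>; in coordinates rotating with angular velocity \<open>k\<^sub>j = \<alpha>\<^sub>j w / 2\<close> the resulting functional becomes
  \<open>\<integral> \<bar>\<xi>'\<bar>\<^sup>2 - k\<^sub>j\<^sup>2 \<bar>\<xi>\<bar>\<^sup>2\<close>, which by Wirtinger's inequality is minimal at its extremals as long as
  \<open>\<bar>k\<^sub>j\<bar> T \<le> \<pi>\<close>. Hence an extremal of length \<open>T\<close> is a minimizer as soon as
  \<open>max \<alpha>\<^sub>1 \<alpha>\<^sub>2 \<bar>w\<bar> T \<le> 2 \<pi>\<close>, and the equality case of Wirtinger's inequality shows that all other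
  minimizers with the same end points are extremals with the same \<open>w\<close>. Since every point is reached
  by an extremal of this kind, all minimizers are known without appeal to the maximum principle, the
  cut time is \<open>2 \<pi> / (max \<alpha>\<^sub>1 \<alpha>\<^sub>2 \<bar>w\<bar>)\<close>, and cut points are read off the explicit extremals. At that
  time the component of the extremal in a plane with maximal \<open>\<alpha>\<^sub>j\<close> closes up whatever its initial
  velocity, so the exponential map is critical there; before that time its differential is injective.
\<close>

section \<open>Lipschitz functions with almost everywhere derivatives\<close>

text \<open>The speed of a competing curve is merely measurable and may vanish, so the curve is not
  reparametrized by arclength. Time is measured by a clock \<open>\<theta>\<close> with rate
  \<open>g\<close> instead, the energy is weighted by \<open>1 / g\<close>, and Wirtinger's
  inequality is proved with this weight. Letting \<open>g\<close> approach the speed turns a bound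
  on clock time times energy into a bound on the squared length. At the critical frequency
  Wirtinger's inequality has nontrivial equality cases: the amplitude in a plane of maximal
  \<open>\<alpha>\<close> is not determined by the end point. This freedom is the source of the
  spheres of optimal geodesics, \<open>S^3\<close> if both planes are critical and
  \<open>S^1\<close> if only one is. A geodesic minimizes only locally. Left translations carry the
  results at the origin to its later arcs, and overlapping arcs are glued by uniqueness of the
  extremal through an arc. Uniqueness of the multiplier fails exactly for \<open>straight\<close>
  extremals, which move only in a plane with \<open>\<alpha> = 0\<close>. They are lines and
  minimize forever, so they are excluded wherever a finite cut time is at stake.\<close>

lemma AE_lebesgue_on_iff:
  fixes S :: "'a::euclidean_space set"
  assumes "S \<in> sets lebesgue"
  shows "(AE t in lebesgue_on S. P t) \<longleftrightarrow> (\<exists>N. negligible N \<and> (\<forall>t\<in>S - N. P t))"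
proof -
  have "(AE t in lebesgue_on S. P t) \<longleftrightarrow> (AE t in lebesgue. t \<in> S \<longrightarrow> P t)"
    using assms by (simp add: AE_restrict_space_iff)
  also have "\<dots> \<longleftrightarrow> (\<exists>N. negligible N \<and> (\<forall>t\<in>S - N. P t))"
    unfolding eventually_ae_filter_negligible by blast
  finally show ?thesis .
qed

text \<open>Boundedness is part of the notion because it is stable under products, whereas
  integrability alone is not; on a compact interval it still yields integrability.\<close>

definition bounded_measurable :: "real \<Rightarrow> real \<Rightarrow> (real \<Rightarrow> real) \<Rightarrow> bool" where
  "bounded_measurable a b f \<longleftrightarrow> f \<in> borel_measurable (lebesgue_on {a..b}) \<and> bounded (f ` {a..b})"

lemma bounded_measurable_integrable:
  assumes "bounded_measurable a b f"
  shows "f integrable_on {a..b}"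
proof -
  obtain M where M: "\<And>t. t \<in> {a..b} \<Longrightarrow> norm (f t) \<le> M"
    using assms unfolding bounded_measurable_def bounded_iff by (metis imageI)
  have "(\<lambda>t. M) integrable_on {a..b}"
    by (rule integrable_const_ivl)
  then show ?thesis
    using measurable_bounded_by_integrable_imp_integrable[of f "{a..b}" "\<lambda>t. M"] M assms
    unfolding bounded_measurable_def by auto
qed

lemma bounded_measurable_subinterval:
  assumes "bounded_measurable a b f" "a \<le> c" "d \<le> b"
  shows "bounded_measurable c d f"
proof -
  have sub: "{c..d} \<subseteq> {a..b}"
    using assms by auto
  have "f \<in> borel_measurable (lebesgue_on {c..d})"
    using assms(1) sub unfolding bounded_measurable_def
    by (auto intro: measurable_restrict_mono)
  moreover have "bounded (f ` {c..d})"
    using assms(1) sub unfolding bounded_measurable_def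
    by (meson bounded_subset image_mono)
  ultimately show ?thesis
    unfolding bounded_measurable_def by auto
qed

lemma bounded_measurable_continuous:
  assumes "continuous_on {a..b} f"
  shows "bounded_measurable a b f"
  using assms unfolding bounded_measurable_def
  by (auto intro!: compact_imp_bounded compact_continuous_image continuous_imp_measurable_on_sets_lebesgue)

lemma bounded_measurable_add:
  assumes "bounded_measurable a b f" "bounded_measurable a b g"
  shows "bounded_measurable a b (\<lambda>t. f t + g t)"
  using assms unfolding bounded_measurable_def
  by (auto intro: bounded_plus_comp)

lemma bounded_measurable_minus:
  assumes "bounded_measurable a b f"
  shows "bounded_measurable a b (\<lambda>t. - f t)"
  using assms unfolding bounded_measurable_def
  by (auto simp: bounded_iff)

lemma bounded_measurable_diff:
  assumes "bounded_measurable a b f" "bounded_measurable a b g"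
  shows "bounded_measurable a b (\<lambda>t. f t - g t)"
  using bounded_measurable_add[OF assms(1) bounded_measurable_minus[OF assms(2)]] by simp

lemma bounded_measurable_mult:
  assumes "bounded_measurable a b f" "bounded_measurable a b g"
  shows "bounded_measurable a b (\<lambda>t. f t * g t)"
proof -
  obtain M K where "\<And>t. t \<in> {a..b} \<Longrightarrow> \<bar>f t\<bar> \<le> M" "\<And>t. t \<in> {a..b} \<Longrightarrow> \<bar>g t\<bar> \<le> K"
    using assms unfolding bounded_measurable_def bounded_iff by force
  then have "\<bar>f t * g t\<bar> \<le> M * K" if "t \<in> {a..b}" for t
    using mult_mono[of "\<bar>f t\<bar>" M "\<bar>g t\<bar>" K] that abs_ge_zero[of "f t"]
    by (force simp: abs_mult intro: order_trans[OF abs_ge_zero])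
  then show ?thesis
    using assms unfolding bounded_measurable_def bounded_iff by force
qed

lemma bounded_measurable_const [simp]: "bounded_measurable a b (\<lambda>t. c)"
  by (intro bounded_measurable_continuous continuous_intros)

lemma bounded_measurable_power:
  assumes "bounded_measurable a b f"
  shows "bounded_measurable a b (\<lambda>t. f t ^ n)"
  by (induction n) (auto intro: bounded_measurable_mult assms)

lemma bounded_measurable_inverse:
  assumes "bounded_measurable a b f" "0 < \<delta>" "\<And>t. t \<in> {a..b} \<Longrightarrow> \<delta> \<le> f t"
  shows "bounded_measurable a b (\<lambda>t. inverse (f t))"
proof -
  have "\<bar>inverse (f t)\<bar> \<le> inverse \<delta>" if "t \<in> {a..b}" for t
    using assms(2) assms(3)[OF that] by (simp add: le_imp_inverse_le)
  then show ?thesis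
    using assms(1) unfolding bounded_measurable_def bounded_iff
    by (auto intro!: exI[of _ "inverse \<delta>"])
qed

lemma bounded_measurable_divide:
  assumes "bounded_measurable a b g" "bounded_measurable a b f" "0 < \<delta>"
    "\<And>t. t \<in> {a..b} \<Longrightarrow> \<delta> \<le> f t"
  shows "bounded_measurable a b (\<lambda>t. g t / f t)"
  unfolding divide_inverse
  by (rule bounded_measurable_mult[OF assms(1) bounded_measurable_inverse[OF assms(2-)]])

lemmas bounded_measurable_intros =
  bounded_measurable_add bounded_measurable_minus bounded_measurable_diff bounded_measurable_mult
  bounded_measurable_const bounded_measurable_power

lemma integrable_split:
  fixes f :: "real \<Rightarrow> real"
  assumes "f integrable_on {a..b}" "a \<le> c" "c \<le> d" "d \<le> b"
  shows "integral {c..d} f = integral {a..d} f - integral {a..c} f"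
proof -
  have "f integrable_on {a..d}"
    using assms integrable_on_subinterval[OF assms(1), of a d] by auto
  then show ?thesis
    using Henstock_Kurzweil_Integration.integral_combine[of a c d f] assms by auto
qed

text \<open>The derivative is an argument of its own, fixed only up to a null set but bounded on the
  whole interval. Product and chain rules then become pointwise formulas for it.\<close>

definition lip_deriv :: "real \<Rightarrow> real \<Rightarrow> (real \<Rightarrow> real) \<Rightarrow> (real \<Rightarrow> real) \<Rightarrow> bool" where
  "lip_deriv a b f f' \<longleftrightarrow> (\<exists>L. L-lipschitz_on {a..b} f) \<and> bounded_measurable a b f' \<and>
     (\<exists>N. negligible N \<and> (\<forall>t\<in>{a..b} - N. (f has_real_derivative f' t) (at t)))"

text \<open>The difference quotients of \<open>f\<close> are bounded by the Lipschitz constant, so dominated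
  convergence applies to them.\<close>

lemma lipschitz_deriv:
  fixes f f' :: "real \<Rightarrow> real"
  assumes ab: "a \<le> b" and L: "L-lipschitz_on {a..b} f" and N: "negligible N"
    and D: "\<And>t. t \<in> {a..b} - N \<Longrightarrow> (f has_real_derivative f' t) (at t)"
  shows "\<exists>g. lip_deriv a b f g \<and> (\<forall>t\<in>{a<..<b} - N. g t = f' t) \<and> (\<forall>t\<in>{a..b}. \<bar>g t\<bar> \<le> L) \<and>
    (g has_integral f b - f a) {a..b}"
proof -
  \<comment> \<open>Clamping the argument extends \<open>f\<close> to a Lipschitz function on the
    line, so that difference quotients make sense up to \<open>b\<close>.\<close>
  define cl where "cl t = max a (min b t)" for t
  have clin: "cl t \<in> {a..b}" for t
    using ab by (auto simp: cl_def)
  have clid: "cl t = t" if "t \<in> {a..b}" for t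
    using that by (auto simp: cl_def)
  have cld: "\<bar>cl s - cl t\<bar> \<le> \<bar>s - t\<bar>" for s t
    by (auto simp: cl_def)
  define F where "F t = f (cl t)" for t
  have L0: "0 \<le> L"
    using L lipschitz_on_nonneg by blast
  have FL: "\<bar>F s - F t\<bar> \<le> L * \<bar>s - t\<bar>" for s t
  proof -
    have "\<bar>F s - F t\<bar> \<le> L * \<bar>cl s - cl t\<bar>"
      using lipschitz_onD[OF L clin clin] unfolding F_def dist_real_def .
    also have "\<dots> \<le> L * \<bar>s - t\<bar>"
      using cld L0 by (intro mult_left_mono) auto
    finally show ?thesis .
  qed
  have FLip: "L-lipschitz_on UNIV F"
    by (rule lipschitz_onI) (auto simp: dist_real_def FL L0)
  then have Fc: "continuous_on UNIV F"
    by (rule lipschitz_on_continuous_on)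
  \<comment> \<open>The integral of a difference quotient of \<open>F\<close> is a difference of two
    difference quotients of its primitive \<open>\<Phi>\<close>, and these tend to
    \<open>F b\<close> and \<open>F a\<close>. Starting at \<open>a-1\<close> makes
    \<open>\<Phi>\<close> differentiable at \<open>a\<close> from both sides.\<close>
  define \<Phi> where "\<Phi> t = integral {a-1..t} F" for t
  have \<Phi>: "(\<Phi> has_real_derivative F t) (at t)" if "t \<in> {a-1<..<b+2}" for t
  proof -
    have "(\<Phi> has_real_derivative F t) (at t within {a-1..b+2})"
      unfolding \<Phi>_def by (rule integral_has_real_derivative)
        (use that Fc continuous_on_subset in auto)
    then show ?thesis
      using that by (metis at_within_interior interior_atLeastAtMost_real)
  qed
  define h :: "nat \<Rightarrow> real" where "h n = 1 / (real n + 1)" for n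
  have h: "0 < h n" "h n \<le> 1" for n
    by (auto simp: h_def)
  have h_lim: "filterlim h (at 0) sequentially"
  proof -
    have "h \<longlonglongrightarrow> 0"
      unfolding h_def by real_asymp
    then show ?thesis
      unfolding filterlim_at using h(1) by (auto simp: less_imp_neq[symmetric])
  qed
  define N' where "N' = N \<union> {a, b}"
  have N': "negligible N'"
    unfolding N'_def using N by (auto intro: negligible_Un)
  define Q where "Q n t = (F (t + h n) - F t) / h n" for n t
  define Q' where "Q' n t = (if t \<in> N' then 0 else Q n t)" for n t
  define g where "g t = (if t \<in> N' then 0 else f' t)" for t
  have Qint: "(Q n has_integral ((\<Phi> (b + h n) - \<Phi> b) / h n - (\<Phi> (a + h n) - \<Phi> a) / h n)) {a..b}" for n
  proof -
    have "(Q n has_integral ((\<Phi> (b + h n) - \<Phi> b) / h n) - ((\<Phi> (a + h n) - \<Phi> a) / h n)) {a..b}"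
    proof (rule fundamental_theorem_of_calculus[OF ab])
      fix t assume t: "t \<in> {a..b}"
      have 1: "((\<lambda>t. \<Phi> (t + h n)) has_real_derivative F (t + h n)) (at t)"
        using \<Phi>[of "t + h n"] t h[of n] by (simp add: DERIV_shift)
      have 2: "(\<Phi> has_real_derivative F t) (at t)"
        using \<Phi>[of t] t by simp
      have "((\<lambda>t. (\<Phi> (t + h n) - \<Phi> t) / h n) has_real_derivative Q n t) (at t)"
        unfolding Q_def by (rule DERIV_cdivide[OF DERIV_diff[OF 1 2]])
      then show "((\<lambda>t. (\<Phi> (t + h n) - \<Phi> t) / h n) has_vector_derivative Q n t) (at t within {a..b})"
        by (simp add: has_real_derivative_iff_has_vector_derivative has_vector_derivative_at_within)
    qed
    then show ?thesis .
  qed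
  have Q'int: "(Q' n has_integral ((\<Phi> (b + h n) - \<Phi> b) / h n - (\<Phi> (a + h n) - \<Phi> a) / h n)) {a..b}" for n
    by (rule has_integral_spike[OF N' _ Qint]) (simp add: Q'_def)
  have lim\<Phi>: "(\<lambda>n. (\<Phi> (t + h n) - \<Phi> t) / h n) \<longlonglongrightarrow> F t" if "t \<in> {a..b}" for t
  proof -
    have "((\<lambda>h. (\<Phi> (t + h) - \<Phi> t) / h) \<longlongrightarrow> F t) (at 0)"
      using \<Phi>[of t] that by (simp add: DERIV_def)
    then show ?thesis
      by (rule filterlim_compose[OF _ h_lim])
  qed
  have Q'lim: "(\<lambda>n. Q' n t) \<longlonglongrightarrow> g t" if "t \<in> {a..b}" for t
  proof (cases "t \<in> N'")
    case True
    then show ?thesis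
      by (simp add: Q'_def g_def)
  next
    case False
    then have t: "a < t" "t < b" "t \<notin> N"
      using that by (auto simp: N'_def)
    then have "(f has_real_derivative f' t) (at t)"
      using D by auto
    moreover have "\<forall>\<^sub>F s in nhds t. f s = F s"
      using eventually_nhds_in_open[of "{a<..<b}" t] t
      by (auto elim!: eventually_mono simp: F_def clid)
    ultimately have "(F has_real_derivative f' t) (at t)"
      using DERIV_cong_ev[of t t f F "f' t" "f' t"] by auto
    then have "((\<lambda>h. (F (t + h) - F t) / h) \<longlongrightarrow> f' t) (at 0)"
      by (simp add: DERIV_def)
    then have "(\<lambda>n. Q n t) \<longlonglongrightarrow> f' t"
      unfolding Q_def by (rule filterlim_compose[OF _ h_lim])
    then show ?thesis
      using False by (simp add: Q'_def g_def)
  qed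
  have Qb: "\<bar>Q' n t\<bar> \<le> L" for n t
    using FL[of "t + h n" t] h[of n] L0 by (auto simp: Q'_def Q_def divide_simps mult.commute)
  have gb: "\<bar>g t\<bar> \<le> L" if "t \<in> {a..b}" for t
    using Q'lim[OF that, THEN tendsto_rabs] by (rule LIMSEQ_le_const2) (auto simp: Qb)
  have I: "(g has_integral F b - F a) {a..b}"
  proof (rule has_integral_dominated_convergence[OF Q'int, of "\<lambda>t. L"])
    show "(\<lambda>n. (\<Phi> (b + h n) - \<Phi> b) / h n - (\<Phi> (a + h n) - \<Phi> a) / h n) \<longlonglongrightarrow> F b - F a"
      using ab by (intro tendsto_diff lim\<Phi>) auto
  qed (use Qb Q'lim in auto)
  have "g absolutely_integrable_on {a..b}"
    by (rule absolutely_integrable_integrable_bound[of _ _ "\<lambda>t. L"]) (use gb I in auto)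
  then have "g \<in> borel_measurable (lebesgue_on {a..b})"
    by (rule absolutely_integrable_imp_borel_measurable) auto
  then have bm: "bounded_measurable a b g"
    using gb unfolding bounded_measurable_def bounded_iff by force
  have "\<forall>t\<in>{a..b} - N'. (f has_real_derivative g t) (at t)"
    using D by (auto simp: N'_def g_def)
  then have "lip_deriv a b f g"
    unfolding lip_deriv_def using L bm N' by blast
  moreover have "\<forall>t\<in>{a<..<b} - N. g t = f' t"
    by (auto simp: g_def N'_def)
  moreover have "(g has_integral f b - f a) {a..b}"
    using I ab by (simp add: F_def clid)
  ultimately show ?thesis
    using gb by blast
qed

lemma lip_deriv_has_integral:
  assumes "lip_deriv a b f f'" "a \<le> b"
  shows "(f' has_integral f b - f a) {a..b}"
proof -
  obtain L N where *: "L-lipschitz_on {a..b} f" "negligible N"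
    "\<And>t. t \<in> {a..b} - N \<Longrightarrow> (f has_real_derivative f' t) (at t)"
    using assms unfolding lip_deriv_def by blast
  obtain g where g: "\<forall>t\<in>{a<..<b} - N. g t = f' t" "(g has_integral f b - f a) {a..b}"
    using lipschitz_deriv[OF assms(2) *] by blast
  show ?thesis
    by (rule has_integral_spike[OF _ _ g(2), of "N \<union> {a,b}"]) (use g *(2) in \<open>auto intro: negligible_Un\<close>)
qed

lemma lip_deriv_integral:
  assumes "lip_deriv a b f f'" "a \<le> b"
  shows "integral {a..b} f' = f b - f a"
  using lip_deriv_has_integral[OF assms] by blast

lemma lip_deriv_subinterval:
  assumes "lip_deriv a b f f'" "a \<le> c" "d \<le> b"
  shows "lip_deriv c d f f'"
proof -
  have "{c..d} \<subseteq> {a..b}"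
    using assms by auto
  then show ?thesis
    using assms bounded_measurable_subinterval[of a b f' c d] unfolding lip_deriv_def
    by (meson Diff_iff lipschitz_on_subset subsetD)
qed

lemma lip_deriv_continuous:
  assumes "lip_deriv a b f f'"
  shows "continuous_on {a..b} f"
  using assms unfolding lip_deriv_def by (auto intro: lipschitz_on_continuous_on)

lemma lip_deriv_bounded_measurable:
  assumes "lip_deriv a b f f'"
  shows "bounded_measurable a b f" "bounded_measurable a b f'"
  using assms bounded_measurable_continuous[OF lip_deriv_continuous[OF assms]]
  unfolding lip_deriv_def by auto

section \<open>Calculus rules for Lipschitz functions\<close>

lemma lip_deriv_add:
  assumes "lip_deriv a b f f'" "lip_deriv a b g g'"
  shows "lip_deriv a b (\<lambda>t. f t + g t) (\<lambda>t. f' t + g' t)"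
proof -
  obtain L M where "L-lipschitz_on {a..b} f" "M-lipschitz_on {a..b} g"
    using assms unfolding lip_deriv_def by blast
  then have "(L + M)-lipschitz_on {a..b} (\<lambda>t. f t + g t)"
    by (rule lipschitz_on_add)
  moreover obtain N1 N2 where N: "negligible N1" "negligible N2"
    "\<forall>t\<in>{a..b} - N1. (f has_real_derivative f' t) (at t)"
    "\<forall>t\<in>{a..b} - N2. (g has_real_derivative g' t) (at t)"
    using assms unfolding lip_deriv_def by blast
  then have "\<forall>t\<in>{a..b} - (N1 \<union> N2). ((\<lambda>t. f t + g t) has_real_derivative f' t + g' t) (at t)"
    by (auto intro!: DERIV_add)
  moreover have "negligible (N1 \<union> N2)"
    using N by (auto intro: negligible_Un)
  ultimately show ?thesis
    using assms unfolding lip_deriv_def by (blast intro: bounded_measurable_add)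
qed

lemma lip_deriv_mult:
  assumes "lip_deriv a b f f'" "lip_deriv a b g g'"
  shows "lip_deriv a b (\<lambda>t. f t * g t) (\<lambda>t. f' t * g t + f t * g' t)"
proof -
  obtain L M where LM: "L-lipschitz_on {a..b} f" "M-lipschitz_on {a..b} g"
    using assms unfolding lip_deriv_def by blast
  note bm = lip_deriv_bounded_measurable[OF assms(1)] lip_deriv_bounded_measurable[OF assms(2)]
  obtain A B where AB: "\<And>t. t \<in> {a..b} \<Longrightarrow> \<bar>f t\<bar> \<le> A" "\<And>t. t \<in> {a..b} \<Longrightarrow> \<bar>g t\<bar> \<le> B"
    using bm(1,3) unfolding bounded_measurable_def bounded_iff by force
  have "(\<bar>A\<bar> * M + \<bar>B\<bar> * L)-lipschitz_on {a..b} (\<lambda>t. f t * g t)"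
  proof (rule lipschitz_onI)
    show "0 \<le> \<bar>A\<bar> * M + \<bar>B\<bar> * L"
      using LM lipschitz_on_nonneg by (intro add_nonneg_nonneg mult_nonneg_nonneg) auto
    fix s t assume st: "s \<in> {a..b}" "t \<in> {a..b}"
    have "\<bar>f s * g s - f t * g t\<bar> = \<bar>f s * (g s - g t) + g t * (f s - f t)\<bar>"
      by (simp add: algebra_simps)
    also have "\<dots> \<le> \<bar>f s\<bar> * \<bar>g s - g t\<bar> + \<bar>g t\<bar> * \<bar>f s - f t\<bar>"
      by (metis abs_mult abs_triangle_ineq)
    also have "\<dots> \<le> \<bar>A\<bar> * (M * \<bar>s - t\<bar>) + \<bar>B\<bar> * (L * \<bar>s - t\<bar>)"
      using AB(1)[OF st(1)] AB(2)[OF st(2)] lipschitz_onD[OF LM(1) st] lipschitz_onD[OF LM(2) st]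
      by (intro add_mono mult_mono) (auto simp: dist_real_def)
    finally show "dist (f s * g s) (f t * g t) \<le> (\<bar>A\<bar> * M + \<bar>B\<bar> * L) * dist s t"
      by (simp add: dist_real_def algebra_simps)
  qed
  moreover obtain N1 N2 where N: "negligible N1" "negligible N2"
    "\<forall>t\<in>{a..b} - N1. (f has_real_derivative f' t) (at t)"
    "\<forall>t\<in>{a..b} - N2. (g has_real_derivative g' t) (at t)"
    using assms unfolding lip_deriv_def by blast
  then have "\<forall>t\<in>{a..b} - (N1 \<union> N2). ((\<lambda>t. f t * g t) has_real_derivative f' t * g t + f t * g' t) (at t)"
    by (auto intro!: derivative_eq_intros)
  moreover have "negligible (N1 \<union> N2)"
    using N by (auto intro: negligible_Un)
  moreover have "bounded_measurable a b (\<lambda>t. f' t * g t + f t * g' t)"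
    by (intro bounded_measurable_intros bm)
  ultimately show ?thesis
    unfolding lip_deriv_def by blast
qed

lemma lip_deriv_const: "lip_deriv a b (\<lambda>t. c) (\<lambda>t. 0)"
proof -
  have "0-lipschitz_on {a..b} (\<lambda>t. c)"
    by (rule lipschitz_onI) auto
  then show ?thesis
    unfolding lip_deriv_def by (auto intro!: exI[of _ "{}"])
qed

lemma lip_deriv_cmult:
  assumes "lip_deriv a b f f'"
  shows "lip_deriv a b (\<lambda>t. c * f t) (\<lambda>t. c * f' t)"
  using lip_deriv_mult[OF lip_deriv_const assms, of c] by simp

lemma lip_deriv_diff:
  assumes "lip_deriv a b f f'" "lip_deriv a b g g'"
  shows "lip_deriv a b (\<lambda>t. f t - g t) (\<lambda>t. f' t - g' t)"
  using lip_deriv_add[OF assms(1) lip_deriv_cmult[OF assms(2), of "-1"]] by simp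

text \<open>The outer function has to be C1: the preimage of a null set under \<open>f\<close> need
  not be a null set, so an almost everywhere derivative of \<open>\<psi>\<close> would not give a
  chain rule.\<close>

lemma lip_deriv_compose:
  assumes f: "lip_deriv a b f f'" and sub: "f ` {a..b} \<subseteq> {c..d}" and ab: "a \<le> b"
    and D: "\<And>s. s \<in> {c..d} \<Longrightarrow> (\<psi> has_real_derivative \<psi>' s) (at s)"
    and cont: "continuous_on {c..d} \<psi>'"
  shows "lip_deriv a b (\<lambda>t. \<psi> (f t)) (\<lambda>t. \<psi>' (f t) * f' t)"
proof -
  obtain L where L: "L-lipschitz_on {a..b} f"
    using f unfolding lip_deriv_def by blast
  have "bounded (\<psi>' ` {c..d})"
    using cont compact_continuous_image compact_imp_bounded by blast
  then obtain M where M: "\<And>s. s \<in> {c..d} \<Longrightarrow> \<bar>\<psi>' s\<bar> \<le> M"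
    unfolding bounded_iff by force
  have "c \<le> d"
    using sub ab by fastforce
  then have M0: "0 \<le> M"
    using M[of c] by auto
  have "M-lipschitz_on {c..d} \<psi>"
  proof (rule bounded_derivative_imp_lipschitz)
    show "(\<psi> has_derivative (*) (\<psi>' s)) (at s within {c..d})" if "s \<in> {c..d}" for s
      using D[OF that] has_field_derivative_def has_derivative_at_withinI by blast
    show "onorm ((*) (\<psi>' s)) \<le> M" if "s \<in> {c..d}" for s
      using M[OF that] by (intro onorm_le) (auto simp: abs_mult intro: mult_right_mono)
  qed (use M0 in auto)
  then have "M-lipschitz_on (f ` {a..b}) \<psi>"
    using sub lipschitz_on_subset by blast
  from lipschitz_on_compose[OF L this]
  have "(M * L)-lipschitz_on {a..b} (\<lambda>t. \<psi> (f t))"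
    unfolding o_def .
  moreover have "bounded_measurable a b (\<lambda>t. \<psi>' (f t) * f' t)"
  proof (rule bounded_measurable_mult)
    show "bounded_measurable a b (\<lambda>t. \<psi>' (f t))"
      by (rule bounded_measurable_continuous) (rule continuous_on_compose2[OF cont lip_deriv_continuous[OF f] sub])
    show "bounded_measurable a b f'"
      using f unfolding lip_deriv_def by auto
  qed
  moreover obtain N where "negligible N" "\<forall>t\<in>{a..b} - N. (f has_real_derivative f' t) (at t)"
    using f unfolding lip_deriv_def by blast
  moreover have "((\<lambda>t. \<psi> (f t)) has_real_derivative \<psi>' (f t) * f' t) (at t)"
    if "t \<in> {a..b} - N" for t
    using that sub calculation(4) by (intro DERIV_chain2[OF D]) (auto simp: image_subset_iff)
  ultimately show ?thesis
    unfolding lip_deriv_def by blast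
qed

lemma lip_deriv_C1:
  assumes D: "\<And>s. s \<in> {a..b} \<Longrightarrow> (\<psi> has_real_derivative \<psi>' s) (at s)"
    and cont: "continuous_on {a..b} \<psi>'" and ab: "a \<le> b"
  shows "lip_deriv a b \<psi> \<psi>'"
proof -
  have "1-lipschitz_on {a..b} (\<lambda>t. t)"
    by (rule lipschitz_onI) auto
  then have "lip_deriv a b (\<lambda>t. t) (\<lambda>t. 1)"
    unfolding lip_deriv_def by (auto intro!: exI[of _ "{}"])
  from lip_deriv_compose[OF this _ ab D cont] show ?thesis
    by simp
qed

section \<open>A weighted Wirtinger inequality\<close>

lemma lip_deriv_increment_ge:
  assumes "lip_deriv a b \<theta> g" "\<And>t. t \<in> {a..b} \<Longrightarrow> \<delta> \<le> g t" "a \<le> s" "s \<le> t" "t \<le> b"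
  shows "\<delta> * (t - s) \<le> \<theta> t - \<theta> s"
proof -
  have "(g has_integral \<theta> t - \<theta> s) {s..t}"
    using lip_deriv_has_integral[OF lip_deriv_subinterval[OF assms(1)], of s t] assms by auto
  moreover have "((\<lambda>_. \<delta>) has_integral \<delta> * (t - s)) {s..t}"
    using has_integral_const_real[of \<delta> s t] \<open>s \<le> t\<close> by (simp add: mult.commute)
  ultimately show ?thesis
    using has_integral_le[of "\<lambda>_. \<delta>" "\<delta> * (t - s)" "{s..t}" g] assms by auto
qed

text \<open>With \<open>P = \<mu> cot (\<mu> \<theta>)\<close> one has
  \<open>x'\<^sup>2 / g - \<mu>\<^sup>2 g x\<^sup>2 = (x' - P g x)\<^sup>2 / g + (P x\<^sup>2)'\<close> in the interior of the interval, and \<open>P x\<^sup>2\<close>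
  vanishes at both end points.\<close>

lemma weighted_wirtinger:
  assumes T: "0 < T" and \<theta>: "lip_deriv 0 T \<theta> g" and \<delta>: "0 < \<delta>"
    and g: "\<And>t. t \<in> {0..T} \<Longrightarrow> \<delta> \<le> g t" and \<theta>0: "\<theta> 0 = 0"
    and x: "lip_deriv 0 T x x'" and x0: "x 0 = 0" and xT: "x T = 0"
  defines "\<mu> \<equiv> pi / \<theta> T"
  defines "W \<equiv> \<lambda>t. (x' t)\<^sup>2 / g t - \<mu>\<^sup>2 * (g t * (x t)\<^sup>2)"
  shows weighted_wirtinger_nonneg: "0 \<le> integral {0..T} W"
    and weighted_wirtinger_eq:
      "integral {0..T} W = 0 \<Longrightarrow> \<exists>C. \<forall>t\<in>{0..T}. x t = C * sin (\<mu> * \<theta> t)"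
proof -
  define S where "S = \<theta> T"
  have inc: "\<delta> * (t - s) \<le> \<theta> t - \<theta> s" if "0 \<le> s" "s \<le> t" "t \<le> T" for s t
    using lip_deriv_increment_ge[OF \<theta> g] that by auto
  have S: "0 < S"
    using inc[of 0 T] T \<delta> \<theta>0 by (simp add: S_def) (smt (verit) mult_pos_pos)
  have \<mu>: "0 < \<mu>" "\<mu> * S = pi"
    using S by (auto simp: \<mu>_def S_def)
  have \<theta>in: "0 < \<theta> t" "\<theta> t < S" if "0 < t" "t < T" for t
    using inc[of 0 t] inc[of t T] that \<theta>0 mult_pos_pos[OF \<delta>, of t] mult_pos_pos[OF \<delta>, of "T - t"]
    by (auto simp: S_def)
  have \<theta>ne: "\<theta> t \<noteq> 0" "\<theta> t \<noteq> S" if "0 < t" "t < T" for t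
    using \<theta>in[OF that] by auto
  have sinpos: "0 < sin (\<mu> * v)" if "0 < v" "v < S" for v
    using that \<mu> by (intro sin_gt_zero) (auto simp flip: \<mu>(2))
  define P where "P t = \<mu> * cos (\<mu> * \<theta> t) / sin (\<mu> * \<theta> t)" for t
  define R where "R t = (x' t - P t * g t * x t)\<^sup>2 / g t" for t
  define J where "J s = integral {0..s} W" for s
  note xb = lip_deriv_bounded_measurable[OF x] and gb = lip_deriv_bounded_measurable(2)[OF \<theta>]
  have Wb: "bounded_measurable 0 T W"
    unfolding W_def by (intro bounded_measurable_intros bounded_measurable_divide[OF _ _ \<delta> g] xb gb)
  note Wi = bounded_measurable_integrable[OF Wb]
  have gpos: "0 < g t" if "t \<in> {0..T}" for t
    using g[OF that] \<delta> by auto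
  have \<theta>mono: "\<theta> s \<le> \<theta> t" if "0 \<le> s" "s \<le> t" "t \<le> T" for s t
    using inc[OF that] \<delta> that by (smt (verit) mult_nonneg_nonneg)
  have \<theta>img: "\<theta> ` {s..t} \<subseteq> {\<theta> s..\<theta> t}" if "0 < s" "s \<le> t" "t < T" for s t
    using that \<theta>mono by auto
  have sub: "lip_deriv s t x x'" "lip_deriv s t \<theta> g" if "0 < s" "s \<le> t" "t < T" for s t
    using lip_deriv_subinterval[OF x, of s t] lip_deriv_subinterval[OF \<theta>, of s t] that by auto
  \<comment> \<open>\<open>P\<close> blows up at both ends, where
    \<open>sin (\<mu> * \<theta> t)\<close> vanishes. All identities are therefore proved on inner
    intervals \<open>{s..t}\<close> first, and the ends are reached by limits.\<close>
  have Pd: "lip_deriv s t P (\<lambda>t. - \<mu>\<^sup>2 / (sin (\<mu> * \<theta> t))\<^sup>2 * g t)" if st: "0 < s" "s \<le> t" "t < T" for s t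
    unfolding P_def
  proof (rule lip_deriv_compose[OF sub(2)[OF st] \<theta>img[OF st] st(2)])
    fix v assume v: "v \<in> {\<theta> s..\<theta> t}"
    then have sp: "sin (\<mu> * v) \<noteq> 0"
      using \<theta>in[of s] \<theta>in[of t] st sinpos[of v] by auto
    have "((\<lambda>v. cot (\<mu> * v)) has_real_derivative - inverse ((sin (\<mu> * v))\<^sup>2) * \<mu>) (at v)"
      by (rule DERIV_chain2[where f = cot and g = "\<lambda>v. \<mu> * v", OF DERIV_cot[OF sp]])
        (auto intro!: derivative_eq_intros)
    from DERIV_cmult[OF this, of \<mu>]
    show "((\<lambda>v. \<mu> * cos (\<mu> * v) / sin (\<mu> * v)) has_real_derivative - \<mu>\<^sup>2 / (sin (\<mu> * v))\<^sup>2) (at v)"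
      by (simp add: cot_def divide_inverse power2_eq_square mult_ac)
  next
    show "continuous_on {\<theta> s..\<theta> t} (\<lambda>v. - \<mu>\<^sup>2 / (sin (\<mu> * v))\<^sup>2)"
    proof (intro continuous_intros ballI)
      fix v assume "v \<in> {\<theta> s..\<theta> t}"
      then show "(sin (\<mu> * v))\<^sup>2 \<noteq> 0"
        using \<theta>in[of s] \<theta>in[of t] st sinpos[of v] by auto
    qed
  qed
  have Rb: "bounded_measurable s t R" if st: "0 < s" "s \<le> t" "t < T" for s t
    unfolding R_def
  proof (rule bounded_measurable_divide[OF _ _ \<delta>])
    show "bounded_measurable s t (\<lambda>t. (x' t - P t * g t * x t)\<^sup>2)"
      by (intro bounded_measurable_intros lip_deriv_bounded_measurable[OF sub(1)[OF st]]
          lip_deriv_bounded_measurable[OF sub(2)[OF st]] lip_deriv_bounded_measurable[OF Pd[OF st]])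
    show "bounded_measurable s t g"
      using lip_deriv_bounded_measurable[OF sub(2)[OF st]] by simp
    show "\<delta> \<le> g u" if "u \<in> {s..t}" for u
      using g[of u] that st by auto
  qed
  have key: "integral {s..t} W = integral {s..t} R + (P t * (x t)\<^sup>2 - P s * (x s)\<^sup>2)"
    if st: "0 < s" "s \<le> t" "t < T" for s t
  proof -
    define D where "D = (\<lambda>t. (- \<mu>\<^sup>2 / (sin (\<mu> * \<theta> t))\<^sup>2 * g t) * (x t * x t) + P t * (x' t * x t + x t * x' t))"
    have "lip_deriv s t (\<lambda>t. P t * (x t * x t)) D"
      unfolding D_def by (intro lip_deriv_mult Pd sub st)
    then have D: "(D has_integral P t * (x t)\<^sup>2 - P s * (x s)\<^sup>2) {s..t}"
      using lip_deriv_has_integral st(2) unfolding power2_eq_square by blast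
    have "((\<lambda>u. R u + D u) has_integral (integral {s..t} R + (P t * (x t)\<^sup>2 - P s * (x s)\<^sup>2))) {s..t}"
      by (intro has_integral_add D integrable_integral bounded_measurable_integrable Rb st)
    moreover have "R u + D u = W u" if u: "u \<in> {s..t}" for u
    proof -
      have gu: "g u \<noteq> 0"
        using gpos[of u] u st by auto
      have su: "sin (\<mu> * \<theta> u) \<noteq> 0"
        using sinpos[OF \<theta>in, of u] u st by auto
      have "(P u)\<^sup>2 - \<mu>\<^sup>2 / (sin (\<mu> * \<theta> u))\<^sup>2 = - \<mu>\<^sup>2"
        using su by (simp add: P_def power_divide power_mult_distrib cos_squared_eq field_simps)
      moreover have "R u + D u = (x' u)\<^sup>2 / g u + ((P u)\<^sup>2 - \<mu>\<^sup>2 / (sin (\<mu> * \<theta> u))\<^sup>2) * (g u * (x u)\<^sup>2)"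
        unfolding R_def D_def using gu by (simp add: field_simps power2_eq_square)
      ultimately show ?thesis
        by (simp add: W_def)
    qed
    ultimately have "(W has_integral (integral {s..t} R + (P t * (x t)\<^sup>2 - P s * (x s)\<^sup>2))) {s..t}"
      by (rule has_integral_eq[rotated]) auto
    then show ?thesis
      by blast
  qed
  have JW: "integral {s..t} W = J t - J s" if "0 < s" "s \<le> t" "t < T" for s t
    unfolding J_def using integrable_split[OF Wi, of s t] that by auto
  have R0: "0 \<le> integral {s..t} R" if st: "0 < s" "s \<le> t" "t < T" for s t
    by (rule Henstock_Kurzweil_Integration.integral_nonneg[OF bounded_measurable_integrable[OF Rb[OF st]]])
      (use st gpos in \<open>auto simp: R_def less_imp_le\<close>)
  have Jc: "continuous_on {0..T} J"
    unfolding J_def by (rule indefinite_integral_continuous_1[OF Wi])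
  have J0: "J 0 = 0"
    by (simp add: J_def)
  have Jl: "(J \<longlongrightarrow> J T) (at_left T)" "(J \<longlongrightarrow> 0) (at_right 0)"
    using continuous_on_Icc_at_leftD[OF Jc] continuous_on_Icc_at_rightD[OF Jc] T J0 by auto
  have \<theta>l: "(\<theta> \<longlongrightarrow> S) (at_left T)" "(\<theta> \<longlongrightarrow> 0) (at_right 0)"
    using continuous_on_Icc_at_leftD[OF lip_deriv_continuous[OF \<theta>]]
      continuous_on_Icc_at_rightD[OF lip_deriv_continuous[OF \<theta>]] T \<theta>0 by (auto simp: S_def)
  have ev: "\<forall>\<^sub>F t in at_right 0. 0 < t \<and> t < T" "\<forall>\<^sub>F t in at_left T. 0 < t \<and> t < T"
    using T eventually_at_right_real[of 0 T] eventually_at_left_real[of 0 T] by auto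
  obtain L where L: "L-lipschitz_on {0..T} x"
    using x unfolding lip_deriv_def by blast
  have L0: "0 \<le> L"
    using L lipschitz_on_nonneg by blast
  have lim0: "((\<lambda>v. \<mu> * cos (\<mu> * v) / sin (\<mu> * v) * v\<^sup>2) \<longlongrightarrow> 0) (at_right 0)"
    using \<mu>(1) by real_asymp
  \<comment> \<open>As \<open>x\<close> vanishes at both ends and \<open>\<theta>\<close> grows at
    rate at least \<open>\<delta>\<close>, \<open>\<bar>x\<bar>\<close> is at most a multiple of the
    distance of \<open>\<theta>\<close> to either end value. The square of this beats the simple
    pole of \<open>P\<close>.\<close>
  have xle: "\<bar>x t\<bar> \<le> L / \<delta> * \<theta> t" "\<bar>x t\<bar> \<le> L / \<delta> * (S - \<theta> t)" if "0 < t" "t < T" for t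
  proof -
    have "\<bar>x t\<bar> \<le> L * t"
      using lipschitz_onD[OF L, of t 0] that x0 by (auto simp: dist_real_def)
    also have "\<dots> \<le> L * (\<theta> t / \<delta>)"
      using inc[of 0 t] that \<theta>0 \<delta> L0 by (intro mult_left_mono) (auto simp: field_simps)
    finally show "\<bar>x t\<bar> \<le> L / \<delta> * \<theta> t"
      by simp
    have "\<bar>x t\<bar> \<le> L * (T - t)"
      using lipschitz_onD[OF L, of t T] that xT by (auto simp: dist_real_def)
    also have "\<dots> \<le> L * ((S - \<theta> t) / \<delta>)"
      using inc[of t T] that \<delta> L0 by (intro mult_left_mono) (auto simp: field_simps S_def)
    finally show "\<bar>x t\<bar> \<le> L / \<delta> * (S - \<theta> t)"
      by simp
  qed
  have sq: "\<bar>a * b\<^sup>2\<bar> \<le> \<bar>a * c\<^sup>2\<bar> * K\<^sup>2" if "\<bar>b\<bar> \<le> K * c" for a b c K :: real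
  proof -
    have "b\<^sup>2 \<le> (K * c)\<^sup>2"
      using that by (metis abs_ge_zero power2_abs power_mono)
    then have "\<bar>a\<bar> * b\<^sup>2 \<le> \<bar>a\<bar> * (K * c)\<^sup>2"
      by (intro mult_left_mono) auto
    then show ?thesis
      by (simp add: abs_mult power_mult_distrib mult_ac)
  qed
  have Pl0: "((\<lambda>t. P t * (x t)\<^sup>2) \<longlongrightarrow> 0) (at_right 0)"
  proof (rule Lim_null_comparison)
    show "\<forall>\<^sub>F t in at_right 0. norm (P t * (x t)\<^sup>2)
        \<le> \<bar>\<mu> * cos (\<mu> * \<theta> t) / sin (\<mu> * \<theta> t) * (\<theta> t)\<^sup>2\<bar> * (L / \<delta>)\<^sup>2"
      using ev(1)
    proof (rule eventually_mono)
      fix t assume "0 < t \<and> t < T"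
      then show "norm (P t * (x t)\<^sup>2)
        \<le> \<bar>\<mu> * cos (\<mu> * \<theta> t) / sin (\<mu> * \<theta> t) * (\<theta> t)\<^sup>2\<bar> * (L / \<delta>)\<^sup>2"
        unfolding P_def real_norm_def by (intro sq xle(1)) auto
    qed
    have "filterlim \<theta> (at_right 0) (at_right 0)"
      unfolding filterlim_at
      by (intro conjI \<theta>l(2) eventually_mono[OF ev(1)])
        (use \<theta>in \<theta>ne in auto)
    from tendsto_mult_left_zero[OF tendsto_rabs_zero[OF filterlim_compose[OF lim0 this]]]
    show "((\<lambda>t. \<bar>\<mu> * cos (\<mu> * \<theta> t) / sin (\<mu> * \<theta> t) * (\<theta> t)\<^sup>2\<bar> * (L / \<delta>)\<^sup>2) \<longlongrightarrow> 0) (at_right 0)" .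
  qed
  have PlT: "((\<lambda>t. P t * (x t)\<^sup>2) \<longlongrightarrow> 0) (at_left T)"
  proof (rule Lim_null_comparison)
    \<comment> \<open>The reflection of \<open>\<theta>\<close> about \<open>S / 2\<close> changes
      the sign of the cotangent, which reduces the right end to the same limit
      \<open>lim0\<close>.\<close>
    have P': "P t = - (\<mu> * cos (\<mu> * (S - \<theta> t)) / sin (\<mu> * (S - \<theta> t)))" for t
    proof -
      have "\<mu> * (S - \<theta> t) = pi - \<mu> * \<theta> t"
        using \<mu>(2) by (simp add: algebra_simps)
      then show ?thesis
        by (simp add: P_def)
    qed
    have "norm (P t * (x t)\<^sup>2)
        \<le> \<bar>\<mu> * cos (\<mu> * (S - \<theta> t)) / sin (\<mu> * (S - \<theta> t)) * (S - \<theta> t)\<^sup>2\<bar> * (L / \<delta>)\<^sup>2" if "0 < t" "t < T" for t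
      unfolding P' real_norm_def mult_minus_left abs_minus_cancel by (intro sq xle(2) that)
    then show "\<forall>\<^sub>F t in at_left T. norm (P t * (x t)\<^sup>2)
        \<le> \<bar>\<mu> * cos (\<mu> * (S - \<theta> t)) / sin (\<mu> * (S - \<theta> t)) * (S - \<theta> t)\<^sup>2\<bar> * (L / \<delta>)\<^sup>2"
      using ev(2) by (auto elim!: eventually_mono)
    have "((\<lambda>t. S - \<theta> t) \<longlongrightarrow> 0) (at_left T)"
      using tendsto_diff[OF tendsto_const \<theta>l(1), of S] by simp
    then have "filterlim (\<lambda>t. S - \<theta> t) (at_right 0) (at_left T)"
      unfolding filterlim_at
      by (intro conjI eventually_mono[OF ev(2)])
        (use \<theta>in \<theta>ne in auto)
    from tendsto_mult_left_zero[OF tendsto_rabs_zero[OF filterlim_compose[OF lim0 this]]]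
    show "((\<lambda>t. \<bar>\<mu> * cos (\<mu> * (S - \<theta> t)) / sin (\<mu> * (S - \<theta> t)) * (S - \<theta> t)\<^sup>2\<bar> * (L / \<delta>)\<^sup>2) \<longlongrightarrow> 0) (at_left T)" .
  qed
  \<comment> \<open>Enlarging an interval only increases the integral of the nonnegative
    \<open>R\<close>. With the inner interval fixed, the outer one is expanded to all of
    \<open>{0..T}\<close>, where the boundary terms disappear.\<close>
  have lower: "integral {s0..t0} R \<le> J T" if st: "0 < s0" "s0 \<le> t0" "t0 < T" for s0 t0
  proof -
    have 1: "integral {s0..t0} R \<le> J t - J s - P t * (x t)\<^sup>2 + P s * (x s)\<^sup>2"
      if s: "0 < s" "s \<le> s0" and t: "t0 \<le> t" "t < T" for s t
    proof -
      have "integral {s0..t0} R \<le> integral {s..t} R"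
      proof (rule integral_subset_le)
        show "R integrable_on {s0..t0}" "R integrable_on {s..t}"
          using s t st by (auto intro!: bounded_measurable_integrable Rb)
        show "\<forall>u\<in>{s..t}. 0 \<le> R u"
          unfolding R_def
        proof
          fix u assume "u \<in> {s..t}"
          then have "0 < g u"
            using gpos[of u] s t by auto
          then show "0 \<le> (x' u - P u * g u * x u)\<^sup>2 / g u"
            by simp
        qed
      qed (use s t in auto)
      then show ?thesis
        using key[of s t] JW[of s t] s t st by linarith
    qed
    have 2: "integral {s0..t0} R \<le> J T - J s - 0 + P s * (x s)\<^sup>2" if s: "0 < s" "s \<le> s0" for s
    proof (rule tendsto_lowerbound)
      show "((\<lambda>t. J t - J s - P t * (x t)\<^sup>2 + P s * (x s)\<^sup>2) \<longlongrightarrow> J T - J s - 0 + P s * (x s)\<^sup>2) (at_left T)"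
        by (intro tendsto_intros Jl PlT)
      have "\<forall>\<^sub>F t in at_left T. t0 < t \<and> t < T"
        using eventually_at_left_real[of t0 T] st by auto
      then show "\<forall>\<^sub>F t in at_left T. integral {s0..t0} R \<le> J t - J s - P t * (x t)\<^sup>2 + P s * (x s)\<^sup>2"
        by (rule eventually_mono) (use 1[OF s] in auto)
    qed auto
    have "integral {s0..t0} R \<le> J T - 0 - 0 + 0"
    proof (rule tendsto_lowerbound)
      show "((\<lambda>s. J T - J s - 0 + P s * (x s)\<^sup>2) \<longlongrightarrow> J T - 0 - 0 + 0) (at_right 0)"
        by (intro tendsto_intros Jl Pl0)
      have "\<forall>\<^sub>F s in at_right 0. 0 < s \<and> s < s0"
        using eventually_at_right_real[of 0 s0] st by auto
      then show "\<forall>\<^sub>F s in at_right 0. integral {s0..t0} R \<le> J T - J s - 0 + P s * (x s)\<^sup>2"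
        by (rule eventually_mono) (use 2 in auto)
    qed auto
    then show ?thesis
      by simp
  qed
  show "0 \<le> integral {0..T} W"
    using lower[of "T/2" "T/2"] R0[of "T/2" "T/2"] T by (simp add: J_def)
  assume "integral {0..T} W = 0"
  then have JT: "J T = 0"
    by (simp add: J_def)
  \<comment> \<open>If the total is 0, then \<open>R\<close> integrates to 0 on every inner
    interval. This says \<open>x' = P g x\<close> in the mean, which is the vanishing of the
    derivative of the quotient \<open>Y\<close>.\<close>
  define Y where "Y t = 1 / sin (\<mu> * \<theta> t) * x t" for t
  have Yc: "Y t = Y s" if st: "0 < s" "s \<le> t" "t < T" for s t
  proof -
    have RI: "integral {s..t} R = 0"
      using R0[OF st] lower[OF st] JT by auto
    define q where "q u = - \<mu> * cos (\<mu> * \<theta> u) / (sin (\<mu> * \<theta> u))\<^sup>2 * g u" for u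
    have Sd: "lip_deriv s t (\<lambda>u. 1 / sin (\<mu> * \<theta> u)) q"
      unfolding q_def
    proof (rule lip_deriv_compose[OF sub(2)[OF st] \<theta>img[OF st] st(2)])
      fix v assume v: "v \<in> {\<theta> s..\<theta> t}"
      then have sp: "sin (\<mu> * v) \<noteq> 0"
        using \<theta>in[of s] \<theta>in[of t] st sinpos[of v] by auto
      show "((\<lambda>v. 1 / sin (\<mu> * v)) has_real_derivative - \<mu> * cos (\<mu> * v) / (sin (\<mu> * v))\<^sup>2) (at v)"
        using sp by (auto intro!: derivative_eq_intros simp: field_simps power2_eq_square)
    next
      show "continuous_on {\<theta> s..\<theta> t} (\<lambda>v. - \<mu> * cos (\<mu> * v) / (sin (\<mu> * v))\<^sup>2)"
      proof (intro continuous_intros ballI)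
        fix v assume "v \<in> {\<theta> s..\<theta> t}"
        then show "(sin (\<mu> * v))\<^sup>2 \<noteq> 0"
          using \<theta>in[of s] \<theta>in[of t] st sinpos[of v] by auto
      qed
    qed
    define d where "d u = q u * x u + 1 / sin (\<mu> * \<theta> u) * x' u" for u
    have "lip_deriv s t Y d"
      unfolding Y_def d_def by (intro lip_deriv_mult Sd sub st)
    then have di: "(d has_integral Y t - Y s) {s..t}"
      using lip_deriv_has_integral st(2) by blast
    define w where "w u = g u * (1 / sin (\<mu> * \<theta> u))\<^sup>2" for u
    have wi: "w integrable_on {s..t}"
      unfolding w_def
      by (intro bounded_measurable_integrable bounded_measurable_intros
          lip_deriv_bounded_measurable[OF sub(2)[OF st]] lip_deriv_bounded_measurable[OF Sd])
    have Ri: "R integrable_on {s..t}"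
      by (intro bounded_measurable_integrable Rb st)
    define K where "K = integral {s..t} w"
    \<comment> \<open>Young's inequality with a free weight \<open>l\<close>: the \<open>R\<close>
      part integrates to 0, so the increment of \<open>Y\<close> is at most \<open>l / 2 * K\<close>
      for every positive \<open>l\<close> and must vanish.\<close>
    have b: "\<bar>d u\<bar> \<le> inverse (2 * l) * R u + l / 2 * w u" if u: "u \<in> {s..t}" and l: "0 < l" for u l
    proof -
      have gu: "0 < g u"
        using gpos[of u] u st by auto
      have su: "0 < sin (\<mu> * \<theta> u)"
        using sinpos[OF \<theta>in, of u] u st by auto
      define r where "r = x' u - P u * g u * x u"
      define \<sigma> where "\<sigma> = 1 / sin (\<mu> * \<theta> u)"
      have d: "d u = \<sigma> * r"
        using su by (simp add: d_def q_def r_def P_def \<sigma>_def field_simps power2_eq_square)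
      have "0 \<le> (r / g u - l * \<sigma>)\<^sup>2 * (g u / (2 * l))" "0 \<le> (r / g u + l * \<sigma>)\<^sup>2 * (g u / (2 * l))"
        using gu l by auto
      moreover have "(r / g u - l * \<sigma>)\<^sup>2 * (g u / (2 * l)) = inverse (2 * l) * (r\<^sup>2 / g u) + l / 2 * (g u * \<sigma>\<^sup>2) - \<sigma> * r"
        "(r / g u + l * \<sigma>)\<^sup>2 * (g u / (2 * l)) = inverse (2 * l) * (r\<^sup>2 / g u) + l / 2 * (g u * \<sigma>\<^sup>2) + \<sigma> * r"
        using gu l by (simp_all add: field_simps power2_eq_square)
      ultimately show ?thesis
        unfolding d R_def w_def r_def[symmetric] \<sigma>_def[symmetric] by linarith
    qed
    have "\<bar>Y t - Y s\<bar> \<le> l / 2 * K" if l: "0 < l" for l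
    proof -
      have I: "((\<lambda>u. inverse (2 * l) * R u + l / 2 * w u) has_integral inverse (2 * l) * 0 + l / 2 * K) {s..t}"
        unfolding K_def using Ri wi RI
        by (intro has_integral_add has_integral_mult_right) (auto simp: has_integral_integral)
      have "Y t - Y s \<le> inverse (2 * l) * 0 + l / 2 * K"
        by (rule has_integral_le[OF di I]) (use b[OF _ l] in force)
      moreover have "- (Y t - Y s) \<le> inverse (2 * l) * 0 + l / 2 * K"
        by (rule has_integral_le[OF has_integral_neg[OF di] I]) (use b[OF _ l] in force)
      ultimately show ?thesis
        by linarith
    qed
    then have *: "2 * \<bar>Y t - Y s\<bar> \<le> l * K" if "0 < l" for l
      using that by force
    have "\<bar>Y t - Y s\<bar> \<le> 0"
    proof (rule ccontr)
      assume "\<not> \<bar>Y t - Y s\<bar> \<le> 0"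
      then have pos: "0 < \<bar>Y t - Y s\<bar>"
        by simp
      define e where "e = \<bar>Y t - Y s\<bar>"
      have e: "0 < e" "2 * e \<le> l * K" if "0 < l" for l
        using pos *[OF that] by (simp_all only: e_def)
      have K: "0 < K"
        using e[of 1] by simp
      then show False
        using e(2)[of "e / K"] e(1)[of 1] by simp
    qed
    then show ?thesis
      by simp
  qed
  have "x t = Y (T/2) * sin (\<mu> * \<theta> t)" if t: "t \<in> {0..T}" for t
  proof -
    consider "t = 0" | "t = T" | "0 < t" "t < T"
      using t by force
    then show ?thesis
    proof cases
      case 1
      then show ?thesis by (simp add: x0 \<theta>0)
    next
      case 2
      then show ?thesis using \<mu>(2) by (simp add: xT S_def)
    next
      case 3
      then have "Y t = Y (T/2)"
        using Yc[of t "T/2"] Yc[of "T/2" t] by force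
      then show ?thesis
        using sinpos[OF \<theta>in[OF 3]] by (simp add: Y_def field_simps)
    qed
  qed
  then show "\<exists>C. \<forall>t\<in>{0..T}. x t = C * sin (\<mu> * \<theta> t)"
    by blast
qed

section \<open>Lower bounds for the energy\<close>

text \<open>The solution of \<open>f'' + k^2 f = 0\<close> with \<open>f 0 = 0\<close> and
  \<open>f' 0 = 1\<close>. The case \<open>k = 0\<close> is the continuous limit, so that straight
  and circular motion share their formulas.\<close>

definition sn :: "real \<Rightarrow> real \<Rightarrow> real" where
  "sn k t = (if k = 0 then t else sin (k * t) / k)"

text \<open>The primitive of \<open>k * (sn k t)^2\<close> that vanishes at 0. It is twice the
  signed area swept by a plane extremal of unit initial speed, and \<open>\<alpha> / 2\<close> times
  it is the height gained.\<close>

definition sn_area :: "real \<Rightarrow> real \<Rightarrow> real" where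
  "sn_area k t = (if k = 0 then 0 else (t - sn k t * cos (k * t)) / (2 * k))"

lemma sn_0 [simp]: "sn k 0 = 0"
  by (simp add: sn_def)

lemma sn_area_0 [simp]: "sn_area k 0 = 0"
  by (simp add: sn_area_def)

lemma k_times_sn: "k * sn k t = sin (k * t)"
  by (simp add: sn_def)

lemma sn_area_eq: "2 * k * sn_area k t = t - sn k t * cos (k * t)"
  by (simp add: sn_area_def sn_def)

lemma sn_deriv: "(sn k has_real_derivative cos (k * t)) (at t)"
proof (cases "k = 0")
  case True
  then have "sn k = (\<lambda>t. t)"
    by (auto simp: sn_def)
  then show ?thesis
    using True by simp
next
  case False
  then have "sn k = (\<lambda>t. sin (k * t) / k)"
    by (auto simp: sn_def)
  then show ?thesis
    using False by (auto intro!: derivative_eq_intros)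
qed

lemma sn_area_deriv: "(sn_area k has_real_derivative k * (sn k t)\<^sup>2) (at t)"
proof (cases "k = 0")
  case True
  then have "sn_area k = (\<lambda>t. 0)"
    by (auto simp: sn_area_def)
  then show ?thesis
    using True by simp
next
  case False
  then have eq: "sn_area k = (\<lambda>t. (t - sn k t * cos (k * t)) / (2 * k))"
    by (auto simp: sn_area_def)
  have 1: "((\<lambda>t. (t - sn k t * cos (k * t)) / (2 * k)) has_real_derivative
      (1 - (cos (k * t) * cos (k * t) + - (k * sin (k * t)) * sn k t)) / (2 * k)) (at t)"
    by (intro DERIV_cdivide DERIV_diff DERIV_ident DERIV_mult sn_deriv)
      (auto intro!: derivative_eq_intros)
  have "cos (k * t) * cos (k * t) = 1 - (k * sn k t)\<^sup>2"
    using sin_cos_squared_add[of "k * t"] by (simp add: k_times_sn power2_eq_square)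
  then have "(1 - (cos (k * t) * cos (k * t) + - (k * sin (k * t)) * sn k t)) / (2 * k) = k * (sn k t)\<^sup>2"
    unfolding k_times_sn[symmetric] using False by (simp add: field_simps power2_eq_square)
  then show ?thesis
    unfolding eq using 1 by simp
qed

lemma continuous_on_sn [continuous_intros]:
  assumes "continuous_on A f"
  shows "continuous_on A (\<lambda>x. sn k (f x))"
proof -
  have "continuous_on UNIV (sn k)"
    by (rule DERIV_continuous_on) (auto intro: DERIV_subset[OF sn_deriv])
  then show ?thesis
    using assms continuous_on_compose2 by blast
qed

lemma continuous_on_sn_area [continuous_intros]:
  assumes "continuous_on A f"
  shows "continuous_on A (\<lambda>x. sn_area k (f x))"
proof -
  have "continuous_on UNIV (sn_area k)"
    by (rule DERIV_continuous_on) (auto intro: DERIV_subset[OF sn_area_deriv])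
  then show ?thesis
    using assms continuous_on_compose2 by blast
qed

text \<open>The rate \<open>g\<close> is only bounded and measurable, so the clock can follow curves
  of arbitrary speed. The lower bound \<open>\<delta>\<close> makes \<open>\<theta>\<close> strictly
  increasing and allows division by \<open>g\<close>.\<close>

locale clock =
  fixes T :: real and \<theta> g :: "real \<Rightarrow> real" and \<delta> :: real
  assumes T: "0 < T" and \<theta>: "lip_deriv 0 T \<theta> g" and \<delta>: "0 < \<delta>"
    and g: "\<And>t. t \<in> {0..T} \<Longrightarrow> \<delta> \<le> g t" and \<theta>0: "\<theta> 0 = 0"
begin

lemma mono: "0 \<le> s \<Longrightarrow> s \<le> t \<Longrightarrow> t \<le> T \<Longrightarrow> \<theta> s \<le> \<theta> t"
  using lip_deriv_increment_ge[OF \<theta> g, of s t] \<delta> mult_nonneg_nonneg[of \<delta> "t - s"] by linarith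

lemma image: "\<theta> ` {0..T} \<subseteq> {0..\<theta> T}"
  using mono[of 0] mono[of _ T] \<theta>0 by auto

lemma total_pos: "0 < \<theta> T"
  using lip_deriv_increment_ge[OF \<theta> g, of 0 T] T mult_pos_pos[OF \<delta> T] \<theta>0 by auto

lemma compose:
  assumes "\<And>s. (\<psi> has_real_derivative \<psi>' s) (at s)" "continuous_on UNIV \<psi>'"
  shows "lip_deriv 0 T (\<lambda>t. \<psi> (\<theta> t)) (\<lambda>t. \<psi>' (\<theta> t) * g t)"
  by (rule lip_deriv_compose[OF \<theta> image])
    (use T assms continuous_on_subset[OF assms(2)] in auto)

lemma cos_deriv: "lip_deriv 0 T (\<lambda>t. cos (k * \<theta> t)) (\<lambda>t. - (k * sin (k * \<theta> t)) * g t)"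
  by (rule compose) (auto intro!: derivative_eq_intros continuous_intros)

lemma sin_deriv: "lip_deriv 0 T (\<lambda>t. sin (k * \<theta> t)) (\<lambda>t. k * cos (k * \<theta> t) * g t)"
  by (rule compose) (auto intro!: derivative_eq_intros continuous_intros)

lemma sn_deriv: "lip_deriv 0 T (\<lambda>t. sn k (\<theta> t)) (\<lambda>t. cos (k * \<theta> t) * g t)"
  by (rule compose) (auto intro!: sn_deriv continuous_intros)

text \<open>After subtracting the extremal \<open>A sn\<close>, the cross terms are total derivatives.\<close>

lemma extremal_line:
  assumes k: "\<bar>k\<bar> * \<theta> T \<le> pi"
    and X: "lip_deriv 0 T X X'" and X0: "X 0 = 0" and XT: "X T = A * sn k (\<theta> T)"
  defines "V \<equiv> \<lambda>t. (X' t)\<^sup>2 / g t - k\<^sup>2 * (g t * (X t)\<^sup>2)"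
  shows extremal_line_ge: "A\<^sup>2 * sn k (\<theta> T) * cos (k * \<theta> T) \<le> integral {0..T} V"
    and extremal_line_eq: "integral {0..T} V = A\<^sup>2 * sn k (\<theta> T) * cos (k * \<theta> T) \<Longrightarrow>
      \<exists>A'. \<forall>t\<in>{0..T}. X t = A' * sn k (\<theta> t)"
proof -
  \<comment> \<open>The frequency whose half period is the whole clock time. As
    \<open>\<bar>k\<bar> \<le> \<mu>\<close>, replacing \<open>k\<close> by \<open>\<mu>\<close> in
    the potential leaves the nonnegative surplus \<open>(\<mu>^2 - k^2) G\<close>; this is where the
    bound \<open>pi\<close> on the angle enters.\<close>
  define \<mu> where "\<mu> = pi / \<theta> T"
  have \<mu>: "0 < \<mu>" "\<bar>k\<bar> \<le> \<mu>"
    using total_pos k by (auto simp: \<mu>_def field_simps)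
  then have k\<mu>: "k\<^sup>2 \<le> \<mu>\<^sup>2"
    by (simp add: abs_le_square_iff[symmetric])
  define \<eta> where "\<eta> t = X t - A * sn k (\<theta> t)" for t
  define \<eta>' where "\<eta>' t = X' t - A * (cos (k * \<theta> t) * g t)" for t
  define W where "W t = (\<eta>' t)\<^sup>2 / g t - \<mu>\<^sup>2 * (g t * (\<eta> t)\<^sup>2)" for t
  have \<eta>: "lip_deriv 0 T \<eta> \<eta>'"
    unfolding \<eta>_def \<eta>'_def by (intro lip_deriv_diff lip_deriv_cmult X sn_deriv)
  have \<eta>0: "\<eta> 0 = 0" "\<eta> T = 0"
    by (auto simp: \<eta>_def X0 XT \<theta>0)
  note Wirt0 = weighted_wirtinger[OF T \<theta> \<delta> g \<theta>0 \<eta> \<eta>0, folded \<mu>_def, folded W_def]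
  have Wirt: "0 \<le> integral {0..T} W"
    "integral {0..T} W = 0 \<Longrightarrow> \<exists>C. \<forall>t\<in>{0..T}. \<eta> t = C * sin (\<mu> * \<theta> t)"
    using Wirt0 by auto
  note gb = lip_deriv_bounded_measurable(2)[OF \<theta>] and \<eta>b = lip_deriv_bounded_measurable[OF \<eta>]
  have Wi: "W integrable_on {0..T}"
    unfolding W_def
    by (intro bounded_measurable_integrable bounded_measurable_intros bounded_measurable_divide[OF _ _ \<delta> g] gb \<eta>b)
  define G where "G t = g t * (\<eta> t)\<^sup>2" for t
  have Gi: "G integrable_on {0..T}"
    unfolding G_def by (intro bounded_measurable_integrable bounded_measurable_intros gb \<eta>b)
  define D where "D t = 2 * A * ((- (k * sin (k * \<theta> t)) * g t) * \<eta> t + cos (k * \<theta> t) * \<eta>' t)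
     + A\<^sup>2 * (cos (k * \<theta> t) * g t * cos (k * \<theta> t) + sn k (\<theta> t) * (- (k * sin (k * \<theta> t)) * g t))" for t
  have "lip_deriv 0 T (\<lambda>t. 2 * A * (cos (k * \<theta> t) * \<eta> t) + A\<^sup>2 * (sn k (\<theta> t) * cos (k * \<theta> t))) D"
    unfolding D_def by (intro lip_deriv_add lip_deriv_cmult lip_deriv_mult \<eta> cos_deriv sn_deriv)
  from lip_deriv_has_integral[OF this]
  have Di: "(D has_integral A\<^sup>2 * sn k (\<theta> T) * cos (k * \<theta> T)) {0..T}"
    using T by (simp add: \<eta>0 \<theta>0 mult.assoc)
  have "((\<lambda>t. W t + (\<mu>\<^sup>2 - k\<^sup>2) * G t + D t) has_integral
      integral {0..T} W + (\<mu>\<^sup>2 - k\<^sup>2) * integral {0..T} G + A\<^sup>2 * sn k (\<theta> T) * cos (k * \<theta> T)) {0..T}"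
    by (intro has_integral_add has_integral_mult_right Di integrable_integral Wi Gi)
  moreover have "W t + (\<mu>\<^sup>2 - k\<^sup>2) * G t + D t = V t" if t: "t \<in> {0..T}" for t
  proof -
    have gt: "g t \<noteq> 0"
      using g[OF t] \<delta> by auto
    have X: "X t = \<eta> t + A * sn k (\<theta> t)" "X' t = \<eta>' t + A * (cos (k * \<theta> t) * g t)"
      by (auto simp: \<eta>_def \<eta>'_def)
    show ?thesis
      unfolding V_def W_def G_def D_def X using gt
      by (simp add: k_times_sn[symmetric] field_simps power2_eq_square)
  qed
  ultimately have "(V has_integral
      integral {0..T} W + (\<mu>\<^sup>2 - k\<^sup>2) * integral {0..T} G + A\<^sup>2 * sn k (\<theta> T) * cos (k * \<theta> T)) {0..T}"
    by (rule has_integral_eq[rotated]) auto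
  then have V: "integral {0..T} V =
      integral {0..T} W + (\<mu>\<^sup>2 - k\<^sup>2) * integral {0..T} G + A\<^sup>2 * sn k (\<theta> T) * cos (k * \<theta> T)"
    by blast
  have G\<eta>: "\<delta> * (\<eta> t)\<^sup>2 \<le> G t" if "t \<in> {0..T}" for t
    unfolding G_def by (intro mult_right_mono g that) auto
  have sqi: "((\<lambda>t. (\<eta> t)\<^sup>2) has_integral integral {0..T} (\<lambda>t. (\<eta> t)\<^sup>2)) {0..T}"
    by (intro integrable_integral bounded_measurable_integrable bounded_measurable_intros \<eta>b)
  have Gge: "\<delta> * integral {0..T} (\<lambda>t. (\<eta> t)\<^sup>2) \<le> integral {0..T} G"
    by (rule has_integral_le[OF has_integral_mult_right[OF sqi] integrable_integral[OF Gi]])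
      (use G\<eta> in auto)
  have sq0: "0 \<le> integral {0..T} (\<lambda>t. (\<eta> t)\<^sup>2)"
    using sqi by (rule has_integral_nonneg) auto
  have G0: "0 \<le> integral {0..T} G"
    using Gge sq0 \<delta> by (meson mult_nonneg_nonneg less_imp_le order_trans)
  have nn: "0 \<le> (\<mu>\<^sup>2 - k\<^sup>2) * integral {0..T} G"
    using k\<mu> G0 by auto
  show "A\<^sup>2 * sn k (\<theta> T) * cos (k * \<theta> T) \<le> integral {0..T} V"
    using V Wirt(1) nn by linarith
  assume "integral {0..T} V = A\<^sup>2 * sn k (\<theta> T) * cos (k * \<theta> T)"
  then have W0: "integral {0..T} W = 0" and "(\<mu>\<^sup>2 - k\<^sup>2) * integral {0..T} G = 0"
    using V Wirt(1) nn by linarith+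
  then consider "\<mu>\<^sup>2 = k\<^sup>2" | "integral {0..T} G = 0"
    by auto
  then show "\<exists>A'. \<forall>t\<in>{0..T}. X t = A' * sn k (\<theta> t)"
  proof cases
    \<comment> \<open>The critical angle: \<open>sn k\<close> vanishes at the final clock time, the
      end point leaves the amplitude free, and a multiple of the sine may be added at no
      cost.\<close>
    case 1
    obtain C where C: "\<And>t. t \<in> {0..T} \<Longrightarrow> \<eta> t = C * sin (\<mu> * \<theta> t)"
      using Wirt(2)[OF W0] by blast
    have "k = \<mu> \<or> k = - \<mu>"
      using 1 by (auto simp: power2_eq_iff)
    then have sin\<mu>: "sin (\<mu> * v) = \<mu> * sn k v" for v
      using \<mu> by (auto simp: sn_def)
    have "X t = (A + C * \<mu>) * sn k (\<theta> t)" if "t \<in> {0..T}" for t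
      using C[OF that] unfolding sin\<mu> by (simp add: \<eta>_def algebra_simps)
    then show ?thesis
      by blast
  next
    case 2
    then have "integral {0..T} (\<lambda>t. (\<eta> t)\<^sup>2) = 0"
      using Gge sq0 \<delta> by (simp add: mult_le_0_iff)
    moreover have "continuous_on {0..T} (\<lambda>t. (\<eta> t)\<^sup>2)"
      by (intro continuous_intros lip_deriv_continuous[OF \<eta>])
    ultimately have "(\<eta> t)\<^sup>2 = 0" if "t \<in> {0..T}" for t
      using integral_eq_0_iff[of 0 T "\<lambda>t. (\<eta> t)\<^sup>2"] T that by auto
    then show ?thesis
      by (auto simp: \<eta>_def)
  qed
qed

text \<open>In the frame rotating with angular velocity \<open>k\<close> the area term turns into the potential
  of \<open>extremal_line\<close>, and the two coordinates decouple.\<close>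

lemma extremal_plane:
  assumes k: "\<bar>k\<bar> * \<theta> T \<le> pi"
    and x: "lip_deriv 0 T x x'" and y: "lip_deriv 0 T y y'" and x0: "x 0 = 0" and y0: "y 0 = 0"
    and xT: "x T = sn k (\<theta> T) * (p * cos (k * \<theta> T) - q * sin (k * \<theta> T))"
    and yT: "y T = sn k (\<theta> T) * (p * sin (k * \<theta> T) + q * cos (k * \<theta> T))"
  defines "V \<equiv> \<lambda>t. ((x' t)\<^sup>2 + (y' t)\<^sup>2) / g t - 2 * k * (x t * y' t - y t * x' t)"
  shows extremal_plane_ge: "(p\<^sup>2 + q\<^sup>2) * sn k (\<theta> T) * cos (k * \<theta> T) \<le> integral {0..T} V"
    and extremal_plane_eq: "integral {0..T} V = (p\<^sup>2 + q\<^sup>2) * sn k (\<theta> T) * cos (k * \<theta> T) \<Longrightarrow>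
      \<exists>p' q'. \<forall>t\<in>{0..T}. x t = sn k (\<theta> t) * (p' * cos (k * \<theta> t) - q' * sin (k * \<theta> t)) \<and>
        y t = sn k (\<theta> t) * (p' * sin (k * \<theta> t) + q' * cos (k * \<theta> t))"
proof -
  define c where "c t = cos (k * \<theta> t)" for t
  define s where "s t = sin (k * \<theta> t)" for t
  have cs: "c t * c t = 1 - s t * s t" for t
    by (simp add: c_def s_def cos_squared_eq power2_eq_square[symmetric])
  define X where "X t = x t * c t + y t * s t" for t
  define Y where "Y t = y t * c t - x t * s t" for t
  define X' where "X' t = (x' t * c t + x t * (- (k * s t) * g t)) + (y' t * s t + y t * (k * c t * g t))" for t
  define Y' where "Y' t = (y' t * c t + y t * (- (k * s t) * g t)) - (x' t * s t + x t * (k * c t * g t))" for t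
  have X: "lip_deriv 0 T X X'"
    unfolding X_def X'_def c_def s_def by (intro lip_deriv_add lip_deriv_mult x y cos_deriv sin_deriv)
  have Y: "lip_deriv 0 T Y Y'"
    unfolding Y_def Y'_def c_def s_def by (intro lip_deriv_diff lip_deriv_mult x y cos_deriv sin_deriv)
  have X0: "X 0 = 0" and Y0: "Y 0 = 0"
    by (auto simp: X_def Y_def x0 y0)
  have XT: "X T = p * sn k (\<theta> T)"
  proof -
    have "X T = p * sn k (\<theta> T) * (c T * c T + s T * s T)"
      unfolding X_def xT yT c_def[symmetric] s_def[symmetric] by (simp add: algebra_simps)
    then show ?thesis
      by (simp add: cs)
  qed
  have YT: "Y T = q * sn k (\<theta> T)"
  proof -
    have "Y T = q * sn k (\<theta> T) * (c T * c T + s T * s T)"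
      unfolding Y_def xT yT c_def[symmetric] s_def[symmetric] by (simp add: algebra_simps)
    then show ?thesis
      by (simp add: cs)
  qed
  define VX where "VX t = (X' t)\<^sup>2 / g t - k\<^sup>2 * (g t * (X t)\<^sup>2)" for t
  define VY where "VY t = (Y' t)\<^sup>2 / g t - k\<^sup>2 * (g t * (Y t)\<^sup>2)" for t
  note LX = extremal_line[OF k X X0 XT, folded VX_def] and LY = extremal_line[OF k Y Y0 YT, folded VY_def]
  note gb = lip_deriv_bounded_measurable(2)[OF \<theta>]
  note Xb = lip_deriv_bounded_measurable[OF X] and Yb = lip_deriv_bounded_measurable[OF Y]
  have "VX integrable_on {0..T}"
    unfolding VX_def
    by (intro bounded_measurable_integrable bounded_measurable_intros bounded_measurable_divide[OF _ _ \<delta> g] gb Xb)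
  moreover have "VY integrable_on {0..T}"
    unfolding VY_def
    by (intro bounded_measurable_integrable bounded_measurable_intros bounded_measurable_divide[OF _ _ \<delta> g] gb Yb)
  ultimately
  have "((\<lambda>t. VX t + VY t) has_integral integral {0..T} VX + integral {0..T} VY) {0..T}"
    by (intro has_integral_add integrable_integral)
  moreover have "VX t + VY t = V t" if t: "t \<in> {0..T}" for t
  proof -
    have gt: "g t \<noteq> 0"
      using g[OF t] \<delta> by auto
    \<comment> \<open>\<open>(a, b)\<close> is the velocity corrected for the rotation of the frame,
      and \<open>(X', Y')\<close> is its rotated image, so the two have the same length.\<close>
    define a where "a = x' t + k * g t * y t"
    define b where "b = y' t - k * g t * x t"
    have 1: "X' t = a * c t + b * s t" "Y' t = b * c t - a * s t"
      by (auto simp: X'_def Y'_def a_def b_def algebra_simps)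
    have 2: "(u * c t + v * s t)\<^sup>2 + (v * c t - u * s t)\<^sup>2 = u\<^sup>2 + v\<^sup>2" for u v
    proof -
      have "(u * c t + v * s t)\<^sup>2 + (v * c t - u * s t)\<^sup>2 = (u\<^sup>2 + v\<^sup>2) * (c t * c t + s t * s t)"
        by (simp add: power2_eq_square algebra_simps)
      then show ?thesis
        by (simp add: cs)
    qed
    have "VX t + VY t = ((X' t)\<^sup>2 + (Y' t)\<^sup>2) / g t - k\<^sup>2 * (g t * ((X t)\<^sup>2 + (Y t)\<^sup>2))"
      by (simp add: VX_def VY_def algebra_simps add_divide_distrib)
    also have "\<dots> = (a\<^sup>2 + b\<^sup>2) / g t - k\<^sup>2 * (g t * ((x t)\<^sup>2 + (y t)\<^sup>2))"
      unfolding 1 X_def Y_def 2 by simp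
    also have "\<dots> = V t"
      unfolding V_def a_def b_def using gt by (simp add: field_simps power2_eq_square)
    finally show ?thesis .
  qed
  ultimately have "(V has_integral integral {0..T} VX + integral {0..T} VY) {0..T}"
    by (rule has_integral_eq[rotated]) auto
  then have V: "integral {0..T} V = integral {0..T} VX + integral {0..T} VY"
    by blast
  have split: "(p\<^sup>2 + q\<^sup>2) * sn k (\<theta> T) * cos (k * \<theta> T) =
      p\<^sup>2 * sn k (\<theta> T) * cos (k * \<theta> T) + q\<^sup>2 * sn k (\<theta> T) * cos (k * \<theta> T)"
    by (simp add: algebra_simps)
  show "(p\<^sup>2 + q\<^sup>2) * sn k (\<theta> T) * cos (k * \<theta> T) \<le> integral {0..T} V"
    using LX(1) LY(1) V split by linarith
  assume "integral {0..T} V = (p\<^sup>2 + q\<^sup>2) * sn k (\<theta> T) * cos (k * \<theta> T)"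
  then have "integral {0..T} VX = p\<^sup>2 * sn k (\<theta> T) * cos (k * \<theta> T)"
    "integral {0..T} VY = q\<^sup>2 * sn k (\<theta> T) * cos (k * \<theta> T)"
    using LX(1) LY(1) V split by linarith+
  then obtain p' q' where pq: "\<And>t. t \<in> {0..T} \<Longrightarrow> X t = p' * sn k (\<theta> t)"
    "\<And>t. t \<in> {0..T} \<Longrightarrow> Y t = q' * sn k (\<theta> t)"
    using LX(2) LY(2) by blast
  have "x t = sn k (\<theta> t) * (p' * cos (k * \<theta> t) - q' * sin (k * \<theta> t)) \<and>
        y t = sn k (\<theta> t) * (p' * sin (k * \<theta> t) + q' * cos (k * \<theta> t))" if t: "t \<in> {0..T}" for t
  proof -
    have "x t = x t * (c t * c t + s t * s t)" "y t = y t * (c t * c t + s t * s t)"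
      by (simp_all add: cs)
    then have "x t = X t * c t - Y t * s t" "y t = X t * s t + Y t * c t"
      by (auto simp: X_def Y_def algebra_simps)
    then show ?thesis
      unfolding pq[OF t] by (simp add: c_def s_def algebra_simps)
  qed
  then show "\<exists>p' q'. \<forall>t\<in>{0..T}. x t = sn k (\<theta> t) * (p' * cos (k * \<theta> t) - q' * sin (k * \<theta> t)) \<and>
        y t = sn k (\<theta> t) * (p' * sin (k * \<theta> t) + q' * cos (k * \<theta> t))"
    by blast
qed

end

section \<open>The frame in coordinates\<close>

lemma exhaust_5:
  fixes x :: 5
  shows "x = 1 \<or> x = 2 \<or> x = 3 \<or> x = 4 \<or> x = 5"
proof (induct x)
  case (of_int z)
  then have "z = 0 \<or> z = 1 \<or> z = 2 \<or> z = 3 \<or> z = 4" by fastforce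
  then show ?case by auto
qed

lemma forall_5: "(\<forall>i::5. P i) \<longleftrightarrow> P 1 \<and> P 2 \<and> P 3 \<and> P 4 \<and> P 5"
  by (metis exhaust_5)

lemma UNIV_5: "UNIV = {1, 2, 3, 4, 5::5}"
  using exhaust_5 by auto

lemma sum_5: "sum f (UNIV::5 set) = f 1 + f 2 + f 3 + f 4 + f 5"
  unfolding UNIV_5 by (simp add: ac_simps)

lemma vector_4 [simp]:
  "(vector [a,b,c,d] :: ('a::zero)^4) $ 1 = a"
  "(vector [a,b,c,d] :: ('a::zero)^4) $ 2 = b"
  "(vector [a,b,c,d] :: ('a::zero)^4) $ 3 = c"
  "(vector [a,b,c,d] :: ('a::zero)^4) $ 4 = d"
  unfolding vector_def by simp_all

lemma vector_5 [simp]: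
  "(vector [a,b,c,d,e] :: ('a::zero)^5) $ 1 = a"
  "(vector [a,b,c,d,e] :: ('a::zero)^5) $ 2 = b"
  "(vector [a,b,c,d,e] :: ('a::zero)^5) $ 3 = c"
  "(vector [a,b,c,d,e] :: ('a::zero)^5) $ 4 = d"
  "(vector [a,b,c,d,e] :: ('a::zero)^5) $ 5 = e"
  unfolding vector_def by simp_all

lemma vec5_eq_iff:
  "(x :: 'a^5) = y \<longleftrightarrow> x $ 1 = y $ 1 \<and> x $ 2 = y $ 2 \<and> x $ 3 = y $ 3 \<and> x $ 4 = y $ 4 \<and> x $ 5 = y $ 5"
  by (simp add: vec_eq_iff forall_5)

lemma axis_5 [simp]:
  "axis 1 (c::real) = (vector [c, 0, 0, 0, 0] :: real^5)"
  "axis 2 (c::real) = (vector [0, c, 0, 0, 0] :: real^5)"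
  "axis 3 (c::real) = (vector [0, 0, c, 0, 0] :: real^5)"
  "axis 4 (c::real) = (vector [0, 0, 0, c, 0] :: real^5)"
  "axis 5 (c::real) = (vector [0, 0, 0, 0, c] :: real^5)"
  by (simp_all add: vec5_eq_iff axis_def)

lemma has_vector_derivative_vec_iff:
  fixes \<gamma> :: "real \<Rightarrow> real^'n"
  shows "(\<gamma> has_vector_derivative v) (at t within S) \<longleftrightarrow>
    (\<forall>i. ((\<lambda>t. \<gamma> t $ i) has_real_derivative v $ i) (at t within S))"
  unfolding has_vector_derivative_def has_field_derivative_def
    has_derivative_componentwise_within[of \<gamma>]
  by (auto simp: Basis_vec_def inner_axis mult_commute_abs)

text \<open>Horizontality of \<open>v\<close> at \<open>q\<close> means that \<open>v $ 5\<close>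
  has this value. The same bilinear form is the cocycle of the group law behind
  \<open>translate\<close>.\<close>

definition area_form :: "real \<Rightarrow> real \<Rightarrow> real^5 \<Rightarrow> real^5 \<Rightarrow> real" where
  "area_form \<alpha>1 \<alpha>2 q v = \<alpha>1 / 2 * (q $ 1 * v $ 2 - q $ 2 * v $ 1) + \<alpha>2 / 2 * (q $ 3 * v $ 4 - q $ 4 * v $ 3)"

lemma area_form_add_right: "area_form \<alpha>1 \<alpha>2 q (v + w) = area_form \<alpha>1 \<alpha>2 q v + area_form \<alpha>1 \<alpha>2 q w"
  and area_form_scale_right: "area_form \<alpha>1 \<alpha>2 q (r *\<^sub>R v) = r * area_form \<alpha>1 \<alpha>2 q v"
  by (simp_all add: area_form_def field_simps)

text \<open>The last component is ignored. On horizontal vectors this is the sub-Riemannian norm,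
  and for a covector \<open>p\<close> at the origin the Hamiltonian is half its square.\<close>

definition hnorm :: "real^5 \<Rightarrow> real" where
  "hnorm v = sqrt ((v $ 1)\<^sup>2 + (v $ 2)\<^sup>2 + (v $ 3)\<^sup>2 + (v $ 4)\<^sup>2)"

lemma hnorm_nonneg [simp]: "0 \<le> hnorm v"
  by (simp add: hnorm_def)

lemma hnorm_squared: "(hnorm v)\<^sup>2 = (v $ 1)\<^sup>2 + (v $ 2)\<^sup>2 + (v $ 3)\<^sup>2 + (v $ 4)\<^sup>2"
  by (simp add: hnorm_def)

lemma hnorm_scale: "hnorm (r *\<^sub>R v) = \<bar>r\<bar> * hnorm v"
  by (simp add: hnorm_def power_mult_distrib flip: distrib_left real_sqrt_abs real_sqrt_mult)

lemma bi_heisenberg_combination: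
  "(\<Sum>j\<in>UNIV. u $ j *\<^sub>R bi_heisenberg \<alpha>1 \<alpha>2 q $ j) = vector [u $ 1, u $ 2, u $ 3, u $ 4,
     \<alpha>1 / 2 * (q $ 1 * u $ 2 - q $ 2 * u $ 1) + \<alpha>2 / 2 * (q $ 3 * u $ 4 - q $ 4 * u $ 3)]"
  by (simp add: sum_4 bi_heisenberg_def vec5_eq_iff algebra_simps)

lemma in_distribution_iff:
  "v \<in> distribution (bi_heisenberg \<alpha>1 \<alpha>2) q \<longleftrightarrow> v $ 5 = area_form \<alpha>1 \<alpha>2 q v"
proof
  have "subspace {v. v $ 5 = area_form \<alpha>1 \<alpha>2 q v}"
    by (auto simp: subspace_def area_form_add_right area_form_scale_right) (simp add: area_form_def)
  moreover have "bi_heisenberg \<alpha>1 \<alpha>2 q $ j \<in> {v. v $ 5 = area_form \<alpha>1 \<alpha>2 q v}" for j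
    using exhaust_4[of j] by (auto simp: bi_heisenberg_def area_form_def)
  ultimately have "distribution (bi_heisenberg \<alpha>1 \<alpha>2) q \<subseteq> {v. v $ 5 = area_form \<alpha>1 \<alpha>2 q v}"
    unfolding distribution_def by (intro span_minimal) auto
  then show "v $ 5 = area_form \<alpha>1 \<alpha>2 q v" if "v \<in> distribution (bi_heisenberg \<alpha>1 \<alpha>2) q"
    using that by auto
next
  assume v: "v $ 5 = area_form \<alpha>1 \<alpha>2 q v"
  define u :: "real^4" where "u = vector [v $ 1, v $ 2, v $ 3, v $ 4]"
  have "v = (\<Sum>j\<in>UNIV. u $ j *\<^sub>R bi_heisenberg \<alpha>1 \<alpha>2 q $ j)"
    using v unfolding bi_heisenberg_combination by (simp add: vec5_eq_iff u_def area_form_def)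
  then show "v \<in> distribution (bi_heisenberg \<alpha>1 \<alpha>2) q"
    unfolding distribution_def by (metis (mono_tags, lifting) rangeI span_base span_scale span_sum)
qed

text \<open>The first four components of a combination of the frame are its coefficients, so the
  definite description in \<open>frame_coords\<close> has exactly one solution.\<close>

lemma sr_norm_bi_heisenberg:
  assumes "v $ 5 = area_form \<alpha>1 \<alpha>2 q v"
  shows "sr_norm (bi_heisenberg \<alpha>1 \<alpha>2) q v = hnorm v"
proof -
  have "frame_coords (bi_heisenberg \<alpha>1 \<alpha>2) q v = vector [v $ 1, v $ 2, v $ 3, v $ 4]"
    unfolding frame_coords_def bi_heisenberg_combination
  proof (rule the_equality)
    let ?u = "vector [v $ 1, v $ 2, v $ 3, v $ 4] :: real^4"
    show "v = vector [?u $ 1, ?u $ 2, ?u $ 3, ?u $ 4,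
       \<alpha>1 / 2 * (q $ 1 * ?u $ 2 - q $ 2 * ?u $ 1) + \<alpha>2 / 2 * (q $ 3 * ?u $ 4 - q $ 4 * ?u $ 3)]"
      using assms by (simp add: vec5_eq_iff area_form_def)
  qed (auto simp: vec_eq_iff forall_4 forall_5)
  then show ?thesis
    by (simp add: sr_norm_def sr_inner_def hnorm_def inner_vec_def sum_4 power2_eq_square)
qed

lemma horizontal_iff:
  "horizontal (bi_heisenberg \<alpha>1 \<alpha>2) a b \<gamma> \<longleftrightarrow> (\<exists>L. L-lipschitz_on {a..b} \<gamma>) \<and>
    (\<exists>N. negligible N \<and> (\<forall>t\<in>{a..b} - N. \<exists>v. (\<gamma> has_vector_derivative v) (at t) \<and>
       v $ 5 = area_form \<alpha>1 \<alpha>2 (\<gamma> t) v))"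
  unfolding horizontal_def by (subst AE_lebesgue_on_iff) (auto simp: in_distribution_iff Bex_def conj_commute)

lemma sr_speed_bi_heisenberg:
  assumes "(\<gamma> has_vector_derivative v) (at t)" "v $ 5 = area_form \<alpha>1 \<alpha>2 (\<gamma> t) v"
  shows "sr_speed (bi_heisenberg \<alpha>1 \<alpha>2) \<gamma> t = hnorm v"
  using assms by (simp add: sr_speed_def vector_derivative_at sr_norm_bi_heisenberg)

text \<open>The velocity is carried along as a bounded measurable function on the whole interval. It
  is the true derivative, and horizontal, only off a null set.\<close>

definition horizontal_deriv ::
  "real \<Rightarrow> real \<Rightarrow> real \<Rightarrow> real \<Rightarrow> (real \<Rightarrow> real^5) \<Rightarrow> (real \<Rightarrow> real^5) \<Rightarrow> bool" where
  "horizontal_deriv \<alpha>1 \<alpha>2 a b \<gamma> v \<longleftrightarrow> (\<forall>i. lip_deriv a b (\<lambda>t. \<gamma> t $ i) (\<lambda>t. v t $ i)) \<and>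
     (\<exists>N. negligible N \<and> (\<forall>t\<in>{a..b} - N. (\<gamma> has_vector_derivative v t) (at t) \<and>
        v t $ 5 = area_form \<alpha>1 \<alpha>2 (\<gamma> t) (v t)))"

lemma horizontal_imp_deriv:
  assumes "horizontal (bi_heisenberg \<alpha>1 \<alpha>2) a b \<gamma>" "a \<le> b"
  shows "\<exists>v. horizontal_deriv \<alpha>1 \<alpha>2 a b \<gamma> v"
proof -
  obtain L N where L: "L-lipschitz_on {a..b} \<gamma>" and N: "negligible N"
    and ex: "\<forall>t\<in>{a..b} - N. \<exists>v. (\<gamma> has_vector_derivative v) (at t) \<and> v $ 5 = area_form \<alpha>1 \<alpha>2 (\<gamma> t) v"
    using assms(1) unfolding horizontal_iff by blast
  obtain d where d: "\<And>t. t \<in> {a..b} - N \<Longrightarrow> (\<gamma> has_vector_derivative d t) (at t)"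
    "\<And>t. t \<in> {a..b} - N \<Longrightarrow> d t $ 5 = area_form \<alpha>1 \<alpha>2 (\<gamma> t) (d t)"
    using ex by metis
  have "\<exists>g. lip_deriv a b (\<lambda>t. \<gamma> t $ i) g \<and> (\<forall>t\<in>{a<..<b} - N. g t = d t $ i)" for i
  proof -
    have "L-lipschitz_on {a..b} (\<lambda>t. \<gamma> t $ i)"
    proof (rule lipschitz_onI)
      show "dist (\<gamma> s $ i) (\<gamma> t $ i) \<le> L * dist s t" if "s \<in> {a..b}" "t \<in> {a..b}" for s t
        using lipschitz_onD[OF L that] dist_vec_nth_le[of "\<gamma> s" i "\<gamma> t"] by linarith
    qed (use L lipschitz_on_nonneg in auto)
    moreover have "((\<lambda>t. \<gamma> t $ i) has_real_derivative d t $ i) (at t)" if "t \<in> {a..b} - N" for t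
      using d(1)[OF that] by (simp add: has_vector_derivative_vec_iff)
    ultimately show ?thesis
      using lipschitz_deriv[OF assms(2) _ N, of L "\<lambda>t. \<gamma> t $ i" "\<lambda>t. d t $ i"] by blast
  qed
  then obtain g where g: "\<And>i. lip_deriv a b (\<lambda>t. \<gamma> t $ i) (g i)"
    "\<And>i t. t \<in> {a<..<b} - N \<Longrightarrow> g i t = d t $ i"
    by metis
  define v where "v t = (\<chi> i. g i t)" for t
  have "\<forall>i. lip_deriv a b (\<lambda>t. \<gamma> t $ i) (\<lambda>t. v t $ i)"
    using g(1) by (simp add: v_def eta_contract_eq)
  moreover have "(\<gamma> has_vector_derivative v t) (at t) \<and> v t $ 5 = area_form \<alpha>1 \<alpha>2 (\<gamma> t) (v t)"
    if t: "t \<in> {a..b} - (N \<union> {a, b})" for t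
  proof -
    have "v t = d t"
      using t g(2) by (auto simp: v_def vec_eq_iff)
    then show ?thesis
      using d t by auto
  qed
  moreover have "negligible (N \<union> {a, b})"
    using N by (auto intro: negligible_Un)
  ultimately show ?thesis
    unfolding horizontal_deriv_def by blast
qed

lemma hnorm_bounded_measurable:
  assumes "\<And>i. lip_deriv a b (\<lambda>t. \<gamma> t $ i) (\<lambda>t. v t $ i)"
  shows "bounded_measurable a b (\<lambda>t. hnorm (v t))"
proof -
  define f where "f t = (v t $ 1)\<^sup>2 + (v t $ 2)\<^sup>2 + (v t $ 3)\<^sup>2 + (v t $ 4)\<^sup>2" for t
  have f: "bounded_measurable a b f"
    unfolding f_def by (intro bounded_measurable_intros lip_deriv_bounded_measurable(2)[OF assms])
  then obtain M where M: "\<And>t. t \<in> {a..b} \<Longrightarrow> \<bar>f t\<bar> \<le> M"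
    unfolding bounded_measurable_def bounded_iff by (metis imageI real_norm_def)
  have "\<bar>sqrt (f t)\<bar> \<le> sqrt M" if "t \<in> {a..b}" for t
    using M[OF that] by (simp add: f_def)
  then show ?thesis
    using f unfolding bounded_measurable_def bounded_iff hnorm_def f_def[symmetric]
    by (auto intro!: exI[of _ "sqrt M"])
qed

lemma sr_length_bi_heisenberg:
  assumes "horizontal_deriv \<alpha>1 \<alpha>2 a b \<gamma> v"
  shows "sr_length (bi_heisenberg \<alpha>1 \<alpha>2) a b \<gamma> = integral {a..b} (\<lambda>t. hnorm (v t))"
proof -
  obtain N where N: "negligible N" "\<And>t. t \<in> {a..b} - N \<Longrightarrow> (\<gamma> has_vector_derivative v t) (at t)"
    "\<And>t. t \<in> {a..b} - N \<Longrightarrow> v t $ 5 = area_form \<alpha>1 \<alpha>2 (\<gamma> t) (v t)"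
    using assms unfolding horizontal_deriv_def by blast
  show ?thesis
    unfolding sr_length_def
    by (rule integral_spike[OF N(1)]) (use sr_speed_bi_heisenberg N(2,3) in metis)
qed

section \<open>Extremals through the origin\<close>

text \<open>The extremal with initial covector \<open>p\<close>. With \<open>\<zeta>\<^sub>j = x\<^sub>j + i y\<^sub>j\<close>, \<open>c\<^sub>j = p\<^sub>2\<^sub>j\<^sub>-\<^sub>1 + i p\<^sub>2\<^sub>j\<close> and
  \<open>k\<^sub>j = \<alpha>\<^sub>j p\<^sub>5 / 2\<close>, one has \<open>\<zeta>\<^sub>j' = c\<^sub>j exp (2 i k\<^sub>j t)\<close>, i.e.
  \<open>\<zeta>\<^sub>j = c\<^sub>j exp (i k\<^sub>j t) sn k\<^sub>j t\<close>.\<close>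

definition extremal :: "real \<Rightarrow> real \<Rightarrow> real^5 \<Rightarrow> real \<Rightarrow> real^5" where
  "extremal \<alpha>1 \<alpha>2 p t = (let k1 = \<alpha>1 * p $ 5 / 2; k2 = \<alpha>2 * p $ 5 / 2 in vector
     [sn k1 t * (p $ 1 * cos (k1 * t) - p $ 2 * sin (k1 * t)),
      sn k1 t * (p $ 1 * sin (k1 * t) + p $ 2 * cos (k1 * t)),
      sn k2 t * (p $ 3 * cos (k2 * t) - p $ 4 * sin (k2 * t)),
      sn k2 t * (p $ 3 * sin (k2 * t) + p $ 4 * cos (k2 * t)),
      \<alpha>1 / 2 * ((p $ 1)\<^sup>2 + (p $ 2)\<^sup>2) * sn_area k1 t + \<alpha>2 / 2 * ((p $ 3)\<^sup>2 + (p $ 4)\<^sup>2) * sn_area k2 t])"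

text \<open>These are the pairings of the covector with the frame along the extremal, not the
  components of the covector in coordinates. They rotate with angular velocity
  \<open>\<alpha> * p $ 5\<close>, twice that of the rotating frame.\<close>

definition momentum :: "real \<Rightarrow> real \<Rightarrow> real^5 \<Rightarrow> real \<Rightarrow> real^5" where
  "momentum \<alpha>1 \<alpha>2 p t = (let a1 = \<alpha>1 * p $ 5; a2 = \<alpha>2 * p $ 5 in vector
     [p $ 1 * cos (a1 * t) - p $ 2 * sin (a1 * t), p $ 1 * sin (a1 * t) + p $ 2 * cos (a1 * t),
      p $ 3 * cos (a2 * t) - p $ 4 * sin (a2 * t), p $ 3 * sin (a2 * t) + p $ 4 * cos (a2 * t), p $ 5])"

lemma extremal_nth:
  "extremal \<alpha>1 \<alpha>2 p t $ 1 = sn (\<alpha>1 * p $ 5 / 2) t * (p $ 1 * cos (\<alpha>1 * p $ 5 / 2 * t) - p $ 2 * sin (\<alpha>1 * p $ 5 / 2 * t))"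
  "extremal \<alpha>1 \<alpha>2 p t $ 2 = sn (\<alpha>1 * p $ 5 / 2) t * (p $ 1 * sin (\<alpha>1 * p $ 5 / 2 * t) + p $ 2 * cos (\<alpha>1 * p $ 5 / 2 * t))"
  "extremal \<alpha>1 \<alpha>2 p t $ 3 = sn (\<alpha>2 * p $ 5 / 2) t * (p $ 3 * cos (\<alpha>2 * p $ 5 / 2 * t) - p $ 4 * sin (\<alpha>2 * p $ 5 / 2 * t))"
  "extremal \<alpha>1 \<alpha>2 p t $ 4 = sn (\<alpha>2 * p $ 5 / 2) t * (p $ 3 * sin (\<alpha>2 * p $ 5 / 2 * t) + p $ 4 * cos (\<alpha>2 * p $ 5 / 2 * t))"
  "extremal \<alpha>1 \<alpha>2 p t $ 5 = \<alpha>1 / 2 * ((p $ 1)\<^sup>2 + (p $ 2)\<^sup>2) * sn_area (\<alpha>1 * p $ 5 / 2) t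
     + \<alpha>2 / 2 * ((p $ 3)\<^sup>2 + (p $ 4)\<^sup>2) * sn_area (\<alpha>2 * p $ 5 / 2) t"
  unfolding extremal_def Let_def by (rule vector_5)+

lemma momentum_nth:
  "momentum \<alpha>1 \<alpha>2 p t $ 1 = p $ 1 * cos (\<alpha>1 * p $ 5 * t) - p $ 2 * sin (\<alpha>1 * p $ 5 * t)"
  "momentum \<alpha>1 \<alpha>2 p t $ 2 = p $ 1 * sin (\<alpha>1 * p $ 5 * t) + p $ 2 * cos (\<alpha>1 * p $ 5 * t)"
  "momentum \<alpha>1 \<alpha>2 p t $ 3 = p $ 3 * cos (\<alpha>2 * p $ 5 * t) - p $ 4 * sin (\<alpha>2 * p $ 5 * t)"
  "momentum \<alpha>1 \<alpha>2 p t $ 4 = p $ 3 * sin (\<alpha>2 * p $ 5 * t) + p $ 4 * cos (\<alpha>2 * p $ 5 * t)"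
  unfolding momentum_def Let_def by (rule vector_5)+

lemma extremal_0 [simp]: "extremal \<alpha>1 \<alpha>2 p 0 = 0"
  by (simp add: extremal_def vec5_eq_iff)

lemma sn_scale: "sn (r * k) t * r = sn k (r * t)"
  by (simp add: sn_def mult_ac)

lemma sn_area_scale: "sn_area (r * k) t * r\<^sup>2 = sn_area k (r * t)"
proof (cases "r = 0 \<or> k = 0")
  case False
  then show ?thesis
    unfolding sn_area_def sn_scale[symmetric] by (simp add: power2_eq_square field_simps)
qed (auto simp: sn_area_def)

text \<open>Homogeneity of the Hamiltonian: a longer covector is a faster clock. This trades
  arbitrary times for time 1 and unit covectors for arbitrary ones.\<close>

lemma extremal_scale: "extremal \<alpha>1 \<alpha>2 (r *\<^sub>R p) t = extremal \<alpha>1 \<alpha>2 p (r * t)"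
proof -
  have k: "\<alpha> * (r * w) / 2 = r * (\<alpha> * w / 2)" for \<alpha> w
    by simp
  have 1: "sn (r * k) t * (r * u * c - r * v * s) = sn k (r * t) * (u * c - v * s)"
    "sn (r * k) t * (r * u * c + r * v * s) = sn k (r * t) * (u * c + v * s)" for k u v c s
    by (simp_all add: sn_scale[symmetric] algebra_simps)
  have 2: "a * ((r * u)\<^sup>2 + (r * v)\<^sup>2) * sn_area (r * k) t = a * (u\<^sup>2 + v\<^sup>2) * sn_area k (r * t)" for a k u v
    by (simp add: sn_area_scale[symmetric] power_mult_distrib algebra_simps)
  show ?thesis
    unfolding extremal_def Let_def vector_scaleR_component k real_scaleR_def 1 2
    by (simp add: mult_ac)
qed

lemma momentum_0 [simp]: "momentum \<alpha>1 \<alpha>2 p 0 = p"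
  by (simp add: momentum_def vec5_eq_iff)

lemma momentum_5 [simp]: "momentum \<alpha>1 \<alpha>2 p t $ 5 = p $ 5"
  by (simp add: momentum_def Let_def)

lemma rotation_squares:
  "(u * cos a - v * sin a)\<^sup>2 + (u * sin a + v * cos a)\<^sup>2 = u\<^sup>2 + (v::real)\<^sup>2"
proof -
  have "(u * c - v * s)\<^sup>2 + (u * s + v * c)\<^sup>2 = (u\<^sup>2 + v\<^sup>2) * (s\<^sup>2 + c\<^sup>2)" for s c
    by (simp add: power2_eq_square algebra_simps)
  from this[of "cos a" "sin a"] show ?thesis
    by simp
qed

lemma hnorm_momentum [simp]: "hnorm (momentum \<alpha>1 \<alpha>2 p t) = hnorm p"
  using rotation_squares[of "p $ 1" "\<alpha>1 * p $ 5 * t" "p $ 2"] rotation_squares[of "p $ 3" "\<alpha>2 * p $ 5 * t" "p $ 4"]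
  by (simp add: hnorm_def momentum_def Let_def)

text \<open>Used to turn frame momenta into a velocity: the fifth entry of \<open>momentum\<close>
  is the conserved multiplier, while the fifth entry of the velocity is dictated by
  horizontality.\<close>

definition horizontal_lift :: "real \<Rightarrow> real \<Rightarrow> real^5 \<Rightarrow> real^5 \<Rightarrow> real^5" where
  "horizontal_lift \<alpha>1 \<alpha>2 q v = vector [v $ 1, v $ 2, v $ 3, v $ 4, area_form \<alpha>1 \<alpha>2 q v]"

lemma hnorm_lift [simp]: "hnorm (horizontal_lift \<alpha>1 \<alpha>2 q v) = hnorm v"
  by (simp add: hnorm_def horizontal_lift_def)

lemma area_form_lift [simp]:
  "area_form \<alpha>1 \<alpha>2 q (horizontal_lift \<alpha>1 \<alpha>2 q' v) = area_form \<alpha>1 \<alpha>2 q v"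
  by (simp add: area_form_def horizontal_lift_def)

lemma horizontal_lift_5 [simp]: "horizontal_lift \<alpha>1 \<alpha>2 q v $ 5 = area_form \<alpha>1 \<alpha>2 q v"
  by (simp add: horizontal_lift_def)

lemma cos_sin_double:
  "cos (2 * k * t) = cos (k * t) * cos (k * t) - sin (k * t) * sin (k * (t::real))"
  "sin (2 * k * t) = 2 * (sin (k * t) * cos (k * t))"
  using cos_add[of "k * t" "k * t"] sin_add[of "k * t" "k * t"] by (simp_all add: mult_ac)

lemma extremal_deriv:
  "(extremal \<alpha>1 \<alpha>2 p has_vector_derivative
     horizontal_lift \<alpha>1 \<alpha>2 (extremal \<alpha>1 \<alpha>2 p t) (momentum \<alpha>1 \<alpha>2 p t)) (at t)"
proof -
  have x: "((\<lambda>t. sn k t * (u * cos (k * t) - v * sin (k * t))) has_real_derivative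
      u * cos (2 * k * t) - v * sin (2 * k * t)) (at t)" for k u v
  proof -
    have "((\<lambda>t. sn k t * (u * cos (k * t) - v * sin (k * t))) has_real_derivative
      cos (k * t) * (u * cos (k * t) - v * sin (k * t)) +
      (u * (- (k * sin (k * t))) - v * (k * cos (k * t))) * sn k t) (at t)"
      by (intro DERIV_mult sn_deriv) (auto intro!: derivative_eq_intros)
    moreover have "cos (k * t) * (u * cos (k * t) - v * sin (k * t)) +
      (u * (- (k * sin (k * t))) - v * (k * cos (k * t))) * sn k t =
      u * cos (2 * k * t) - v * sin (2 * k * t)"
      unfolding cos_sin_double unfolding k_times_sn[symmetric] by (simp add: algebra_simps)
    ultimately show ?thesis
      by simp
  qed
  have y: "((\<lambda>t. sn k t * (u * sin (k * t) + v * cos (k * t))) has_real_derivative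
      u * sin (2 * k * t) + v * cos (2 * k * t)) (at t)" for k u v
  proof -
    have "((\<lambda>t. sn k t * (u * sin (k * t) + v * cos (k * t))) has_real_derivative
      cos (k * t) * (u * sin (k * t) + v * cos (k * t)) +
      (u * (k * cos (k * t)) + v * (- (k * sin (k * t)))) * sn k t) (at t)"
      by (intro DERIV_mult sn_deriv) (auto intro!: derivative_eq_intros)
    moreover have "cos (k * t) * (u * sin (k * t) + v * cos (k * t)) +
      (u * (k * cos (k * t)) + v * (- (k * sin (k * t)))) * sn k t =
      u * sin (2 * k * t) + v * cos (2 * k * t)"
      unfolding cos_sin_double unfolding k_times_sn[symmetric] by (simp add: algebra_simps)
    ultimately show ?thesis
      by simp
  qed
  have z: "sn k t * (u * cos (k * t) - v * sin (k * t)) * (u * sin (2 * k * t) + v * cos (2 * k * t)) -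
      sn k t * (u * sin (k * t) + v * cos (k * t)) * (u * cos (2 * k * t) - v * sin (2 * k * t)) =
      (u\<^sup>2 + v\<^sup>2) * (k * (sn k t)\<^sup>2)" for k u v
  proof -
    define c where "c = cos (k * t)"
    define s where "s = sin (k * t)"
    have cs: "c\<^sup>2 = 1 - s\<^sup>2"
      by (simp add: c_def s_def cos_squared_eq)
    have "sn k t * (u * c - v * s) * (u * (2 * (s * c)) + v * (c * c - s * s)) -
      sn k t * (u * s + v * c) * (u * (c * c - s * s) - v * (2 * (s * c))) =
      (u\<^sup>2 + v\<^sup>2) * (sn k t * s) * (c\<^sup>2 + s\<^sup>2)"
      by (simp only: power2_eq_square) (simp add: algebra_simps)
    also have "\<dots> = (u\<^sup>2 + v\<^sup>2) * (k * (sn k t)\<^sup>2)"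
      by (simp add: cs) (simp add: s_def k_times_sn[symmetric] power2_eq_square)
    finally show ?thesis
      unfolding cos_sin_double c_def s_def .
  qed
  have zd: "((\<lambda>t. \<alpha>1 / 2 * ((p $ 1)\<^sup>2 + (p $ 2)\<^sup>2) * sn_area k1 t + \<alpha>2 / 2 * ((p $ 3)\<^sup>2 + (p $ 4)\<^sup>2) * sn_area k2 t)
      has_real_derivative \<alpha>1 / 2 * (((p $ 1)\<^sup>2 + (p $ 2)\<^sup>2) * (k1 * (sn k1 t)\<^sup>2)) +
        \<alpha>2 / 2 * (((p $ 3)\<^sup>2 + (p $ 4)\<^sup>2) * (k2 * (sn k2 t)\<^sup>2))) (at t)" for k1 k2
    using DERIV_add[OF DERIV_cmult[OF sn_area_deriv[of k1 t], of "\<alpha>1 / 2 * ((p $ 1)\<^sup>2 + (p $ 2)\<^sup>2)"]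
        DERIV_cmult[OF sn_area_deriv[of k2 t], of "\<alpha>2 / 2 * ((p $ 3)\<^sup>2 + (p $ 4)\<^sup>2)"]]
    by (simp only: mult.assoc)
  define k1 where "k1 = \<alpha>1 * p $ 5 / 2"
  define k2 where "k2 = \<alpha>2 * p $ 5 / 2"
  note e = extremal_nth[of \<alpha>1 \<alpha>2 p, folded k1_def k2_def]
  have a: "\<alpha>1 * p $ 5 = 2 * k1" "\<alpha>2 * p $ 5 = 2 * k2"
    by (simp_all add: k1_def k2_def)
  note m = momentum_nth[of \<alpha>1 \<alpha>2 p, unfolded a]
  have area: "area_form \<alpha>1 \<alpha>2 (extremal \<alpha>1 \<alpha>2 p t) (momentum \<alpha>1 \<alpha>2 p t) =
      \<alpha>1 / 2 * (((p $ 1)\<^sup>2 + (p $ 2)\<^sup>2) * (k1 * (sn k1 t)\<^sup>2)) +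
      \<alpha>2 / 2 * (((p $ 3)\<^sup>2 + (p $ 4)\<^sup>2) * (k2 * (sn k2 t)\<^sup>2))"
    unfolding area_form_def e m z ..
  show ?thesis
    unfolding has_vector_derivative_vec_iff forall_5 horizontal_lift_def vector_5 e m area
    by (intro conjI x y zd)
qed

text \<open>The weight \<open>p\<^sub>5\<close> acts as a Lagrange multiplier for the constraint on the last coordinate.\<close>

lemma (in clock) energy_bound:
  assumes hd: "horizontal_deriv \<alpha>1 \<alpha>2 0 T \<gamma> v"
    and \<gamma>0: "\<gamma> 0 = 0" and \<gamma>T: "\<gamma> T = extremal \<alpha>1 \<alpha>2 p (\<theta> T)"
    and k1: "\<bar>\<alpha>1 * p $ 5 / 2\<bar> * \<theta> T \<le> pi" and k2: "\<bar>\<alpha>2 * p $ 5 / 2\<bar> * \<theta> T \<le> pi"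
  defines "E \<equiv> integral {0..T} (\<lambda>t. (hnorm (v t))\<^sup>2 / g t)"
  shows energy_ge: "(hnorm p)\<^sup>2 * \<theta> T \<le> E"
    and energy_eq: "E = (hnorm p)\<^sup>2 * \<theta> T \<Longrightarrow> \<exists>p'. p' $ 5 = p $ 5 \<and>
      (\<forall>t\<in>{0..T}. \<forall>i. i \<noteq> 5 \<longrightarrow> \<gamma> t $ i = extremal \<alpha>1 \<alpha>2 p' (\<theta> t) $ i)"
proof -
  define w where "w = p $ 5"
  define k1 where "k1 = \<alpha>1 * w / 2"
  define k2 where "k2 = \<alpha>2 * w / 2"
  note ld = hd[unfolded horizontal_deriv_def, THEN conjunct1, rule_format]
  obtain N where N: "negligible N" "\<And>t. t \<in> {0..T} - N \<Longrightarrow> v t $ 5 = area_form \<alpha>1 \<alpha>2 (\<gamma> t) (v t)"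
    using hd unfolding horizontal_deriv_def by blast
  define V1 where "V1 t = ((v t $ 1)\<^sup>2 + (v t $ 2)\<^sup>2) / g t - 2 * k1 * (\<gamma> t $ 1 * v t $ 2 - \<gamma> t $ 2 * v t $ 1)" for t
  define V2 where "V2 t = ((v t $ 3)\<^sup>2 + (v t $ 4)\<^sup>2) / g t - 2 * k2 * (\<gamma> t $ 3 * v t $ 4 - \<gamma> t $ 4 * v t $ 3)" for t
  have \<gamma>0i: "\<gamma> 0 $ i = 0" for i
    by (simp add: \<gamma>0)
  note P1 = extremal_plane[OF k1[folded w_def, folded k1_def] ld[of 1] ld[of 2] \<gamma>0i \<gamma>0i
      \<gamma>T[THEN arg_cong[where f = "\<lambda>q. q $ 1"], unfolded extremal_nth, folded w_def, folded k1_def]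
      \<gamma>T[THEN arg_cong[where f = "\<lambda>q. q $ 2"], unfolded extremal_nth, folded w_def, folded k1_def],
      folded V1_def]
  note P2 = extremal_plane[OF k2[folded w_def, folded k2_def] ld[of 3] ld[of 4] \<gamma>0i \<gamma>0i
      \<gamma>T[THEN arg_cong[where f = "\<lambda>q. q $ 3"], unfolded extremal_nth, folded w_def, folded k2_def]
      \<gamma>T[THEN arg_cong[where f = "\<lambda>q. q $ 4"], unfolded extremal_nth, folded w_def, folded k2_def],
      folded V2_def]
  note gb = lip_deriv_bounded_measurable(2)[OF \<theta>]
  note b = lip_deriv_bounded_measurable[OF ld]
  have V1i: "V1 integrable_on {0..T}"
    unfolding V1_def
    by (intro bounded_measurable_integrable bounded_measurable_intros bounded_measurable_divide[OF _ _ \<delta> g] gb b)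
  have V2i: "V2 integrable_on {0..T}"
    unfolding V2_def
    by (intro bounded_measurable_integrable bounded_measurable_intros bounded_measurable_divide[OF _ _ \<delta> g] gb b)
  have z: "((\<lambda>t. v t $ 5) has_integral \<gamma> T $ 5) {0..T}"
    using lip_deriv_has_integral[OF ld[of 5]] T \<gamma>0 by simp
  \<comment> \<open>By horizontality \<open>2 * w * v t $ 5\<close> equals the area terms subtracted
    in \<open>V1\<close> and \<open>V2\<close>. Its integral is fixed by the end points, so lower
    bounds for the two planes bound the energy.\<close>
  have "((\<lambda>t. V1 t + V2 t + 2 * w * v t $ 5) has_integral
      integral {0..T} V1 + integral {0..T} V2 + 2 * w * \<gamma> T $ 5) {0..T}"
    by (intro has_integral_add has_integral_mult_right z integrable_integral V1i V2i)
  then have "((\<lambda>t. (hnorm (v t))\<^sup>2 / g t) has_integral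
      integral {0..T} V1 + integral {0..T} V2 + 2 * w * \<gamma> T $ 5) {0..T}"
  proof (rule has_integral_spike[OF N(1), rotated])
    fix t assume t: "t \<in> {0..T} - N"
    show "(hnorm (v t))\<^sup>2 / g t = V1 t + V2 t + 2 * w * v t $ 5"
      unfolding N(2)[OF t] V1_def V2_def k1_def k2_def area_form_def hnorm_squared
      by (simp add: add_divide_distrib) (simp add: field_simps)
  qed
  then have E: "E = integral {0..T} V1 + integral {0..T} V2 + 2 * w * \<gamma> T $ 5"
    unfolding E_def by blast
  \<comment> \<open>By \<open>sn_area_eq\<close> the height of the end point contributes clock time
    minus the terms \<open>sn cos\<close>, and the latter cancel against the lower bounds from the
    planes.\<close>
  have "2 * w * \<gamma> T $ 5 = ((p $ 1)\<^sup>2 + (p $ 2)\<^sup>2) * (2 * k1 * sn_area k1 (\<theta> T))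
      + ((p $ 3)\<^sup>2 + (p $ 4)\<^sup>2) * (2 * k2 * sn_area k2 (\<theta> T))"
    unfolding \<gamma>T extremal_nth w_def[symmetric] k1_def[symmetric] k2_def[symmetric]
    by (simp add: k1_def k2_def field_simps)
  also have "\<dots> = (hnorm p)\<^sup>2 * \<theta> T - ((p $ 1)\<^sup>2 + (p $ 2)\<^sup>2) * sn k1 (\<theta> T) * cos (k1 * \<theta> T)
      - ((p $ 3)\<^sup>2 + (p $ 4)\<^sup>2) * sn k2 (\<theta> T) * cos (k2 * \<theta> T)"
    unfolding sn_area_eq hnorm_squared by (simp add: algebra_simps)
  finally have Z: "2 * w * \<gamma> T $ 5 = (hnorm p)\<^sup>2 * \<theta> T - ((p $ 1)\<^sup>2 + (p $ 2)\<^sup>2) * sn k1 (\<theta> T) * cos (k1 * \<theta> T)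
      - ((p $ 3)\<^sup>2 + (p $ 4)\<^sup>2) * sn k2 (\<theta> T) * cos (k2 * \<theta> T)" .
  show "(hnorm p)\<^sup>2 * \<theta> T \<le> E"
    using P1(1) P2(1) E Z by linarith
  assume "E = (hnorm p)\<^sup>2 * \<theta> T"
  then have "integral {0..T} V1 = ((p $ 1)\<^sup>2 + (p $ 2)\<^sup>2) * sn k1 (\<theta> T) * cos (k1 * \<theta> T)"
    "integral {0..T} V2 = ((p $ 3)\<^sup>2 + (p $ 4)\<^sup>2) * sn k2 (\<theta> T) * cos (k2 * \<theta> T)"
    using P1(1) P2(1) E Z by linarith+
  then obtain a b c d where abcd: "\<forall>t\<in>{0..T}. \<gamma> t $ 1 = sn k1 (\<theta> t) * (a * cos (k1 * \<theta> t) - b * sin (k1 * \<theta> t)) \<and>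
        \<gamma> t $ 2 = sn k1 (\<theta> t) * (a * sin (k1 * \<theta> t) + b * cos (k1 * \<theta> t))"
    "\<forall>t\<in>{0..T}. \<gamma> t $ 3 = sn k2 (\<theta> t) * (c * cos (k2 * \<theta> t) - d * sin (k2 * \<theta> t)) \<and>
        \<gamma> t $ 4 = sn k2 (\<theta> t) * (c * sin (k2 * \<theta> t) + d * cos (k2 * \<theta> t))"
    using P1(2) P2(2) by blast
  define p' :: "real^5" where "p' = vector [a, b, c, d, w]"
  have "\<gamma> t $ i = extremal \<alpha>1 \<alpha>2 p' (\<theta> t) $ i" if "t \<in> {0..T}" "i \<noteq> 5" for t i
    using abcd that exhaust_5[of i] by (auto simp: extremal_nth p'_def k1_def k2_def)
  moreover have "p' $ 5 = p $ 5"
    by (simp add: p'_def w_def)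
  ultimately show "\<exists>p'. p' $ 5 = p $ 5 \<and>
      (\<forall>t\<in>{0..T}. \<forall>i. i \<noteq> 5 \<longrightarrow> \<gamma> t $ i = extremal \<alpha>1 \<alpha>2 p' (\<theta> t) $ i)"
    by blast
qed

section \<open>Lengths and distances\<close>

lemma dominated_convergence_spike:
  fixes f :: "nat \<Rightarrow> real \<Rightarrow> real"
  assumes f: "\<And>n. f n integrable_on S" and N: "negligible N" and h: "h integrable_on S"
    and le: "\<And>n t. t \<in> S - N \<Longrightarrow> \<bar>f n t\<bar> \<le> h t"
    and lim: "\<And>t. t \<in> S - N \<Longrightarrow> (\<lambda>n. f n t) \<longlonglongrightarrow> g t"
  shows "(\<lambda>n. integral S (f n)) \<longlonglongrightarrow> integral S g"
proof -
  define z where "z F t = (if t \<in> N then 0 else F t)" for F :: "real \<Rightarrow> real" and t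
  have int: "integral S (z F) = integral S F" for F
    by (rule integral_spike[OF N]) (auto simp: z_def)
  have "(\<lambda>n. integral S (z (f n))) \<longlonglongrightarrow> integral S (z g)"
  proof (rule dominated_convergence[of _ _ "z h"])
    show "z (f n) integrable_on S" for n
      by (rule integrable_spike[OF f N]) (auto simp: z_def)
    show "z h integrable_on S"
      by (rule integrable_spike[OF h N]) (auto simp: z_def)
  qed (use le lim in \<open>auto simp: z_def\<close>)
  then show ?thesis
    by (simp add: int)
qed

text \<open>Measurability provides continuous functions that converge almost everywhere. Clipping
  them to the range of \<open>s\<close> keeps the limit and gives the common bound that dominated
  convergence asks for.\<close>

lemma bounded_measurable_approx:
  assumes s: "bounded_measurable a b s" and s0: "\<And>t. 0 \<le> s t"
  obtains h :: "nat \<Rightarrow> real \<Rightarrow> real" and M N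
  where "\<And>n. continuous_on UNIV (h n)" "\<And>n t. 0 \<le> h n t" "\<And>n t. h n t \<le> M" "negligible N"
    "\<And>t. t \<in> {a..b} - N \<Longrightarrow> (\<lambda>n. h n t) \<longlonglongrightarrow> s t" "0 \<le> M" "\<And>t. t \<in> {a..b} \<Longrightarrow> s t \<le> M"
proof -
  obtain M where M: "\<And>t. t \<in> {a..b} \<Longrightarrow> \<bar>s t\<bar> \<le> M"
    using s unfolding bounded_measurable_def bounded_iff by (metis imageI real_norm_def)
  have "s measurable_on {a..b}"
    using s unfolding bounded_measurable_def
    by (simp add: measurable_on_iff_borel_measurable)
  then obtain N G where N: "negligible N" and G: "\<And>n. continuous_on UNIV (G n :: real \<Rightarrow> real)"
    and lim: "\<And>t. t \<notin> N \<Longrightarrow> (\<lambda>n. G n t) \<longlonglongrightarrow> (if t \<in> {a..b} then s t else 0)"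
    unfolding measurable_on_def by blast
  show thesis
  proof (rule that[of "\<lambda>n t. max 0 (min \<bar>M\<bar> (G n t))" "\<bar>M\<bar>" N])
    show "(\<lambda>n. max 0 (min \<bar>M\<bar> (G n t))) \<longlonglongrightarrow> s t" if t: "t \<in> {a..b} - N" for t
    proof -
      have "(\<lambda>n. max 0 (min \<bar>M\<bar> (G n t))) \<longlonglongrightarrow> max 0 (min \<bar>M\<bar> (s t))"
        using lim[of t] t by (intro tendsto_intros) auto
      moreover have "max 0 (min \<bar>M\<bar> (s t)) = s t"
        using M[of t] t s0[of t] by auto
      ultimately show ?thesis
        by simp
    qed
    show "s t \<le> \<bar>M\<bar>" if "t \<in> {a..b}" for t
      using M[OF that] by auto
  qed (use N G in \<open>auto intro!: continuous_intros\<close>)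
qed

text \<open>The clock \<open>\<theta>\<close> should run with the speed of the curve. That speed is only measurable, so it is
  approximated by continuous functions, shifted by \<open>\<delta>\<close> to keep them away from zero.\<close>

lemma length_ge_of_deriv:
  assumes hd: "horizontal_deriv \<alpha>1 \<alpha>2 0 T \<gamma> v" and T: "0 < T"
    and \<gamma>0: "\<gamma> 0 = 0" and \<gamma>T: "\<gamma> T = extremal \<alpha>1 \<alpha>2 p S" and S: "0 \<le> S"
    and k1: "\<bar>\<alpha>1 * p $ 5 / 2\<bar> * S \<le> pi" and k2: "\<bar>\<alpha>2 * p $ 5 / 2\<bar> * S \<le> pi"
  shows "hnorm p * S \<le> integral {0..T} (\<lambda>t. hnorm (v t))"
proof -
  define s where "s t = hnorm (v t)" for t
  have s: "bounded_measurable 0 T s"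
    unfolding s_def using hd hnorm_bounded_measurable unfolding horizontal_deriv_def by blast
  have s0: "0 \<le> s t" for t
    by (simp add: s_def)
  note si = bounded_measurable_integrable[OF s]
  define L where "L = integral {0..T} s"
  have L0: "0 \<le> L"
    unfolding L_def by (rule Henstock_Kurzweil_Integration.integral_nonneg[OF si]) (simp add: s0)
  obtain h :: "nat \<Rightarrow> real \<Rightarrow> real" and M N
    where h: "\<And>n. continuous_on UNIV (h n)" "\<And>n t. 0 \<le> h n t" "\<And>n t. h n t \<le> M" and N: "negligible N"
    and lim: "\<And>t. t \<in> {0..T} - N \<Longrightarrow> (\<lambda>n. h n t) \<longlonglongrightarrow> s t"
    and M: "0 \<le> M" "\<And>t. t \<in> {0..T} \<Longrightarrow> s t \<le> M"
    using bounded_measurable_approx[OF s s0] by blast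
  \<comment> \<open>\<open>A n\<close> is the total clock time and \<open>B n\<close> the energy for
    the rate \<open>h n + \<delta>\<close>. As \<open>h n\<close> tends to the speed,
    \<open>A n\<close> tends to \<open>L + \<delta> * T\<close> and \<open>B n\<close> to an
    integral that is at most \<open>L\<close>; then \<open>\<delta>\<close> tends to 0.\<close>
  have main: "(hnorm p * S)\<^sup>2 \<le> (L + \<delta> * T) * L" if \<delta>: "0 < \<delta>" for \<delta>
  proof -
    define A where "A n = integral {0..T} (\<lambda>t. h n t + \<delta>)" for n
    define B where "B n = integral {0..T} (\<lambda>t. (s t)\<^sup>2 / (h n t + \<delta>))" for n
    have hb: "bounded_measurable 0 T (\<lambda>t. h n t + \<delta>)" for n
      by (intro bounded_measurable_continuous continuous_intros continuous_on_subset[OF h(1)]) auto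
    have Bb: "bounded_measurable 0 T (\<lambda>t. (s t)\<^sup>2 / (h n t + \<delta>))" for n
      by (rule bounded_measurable_divide[OF _ hb \<delta>]) (use h(2) s in \<open>auto intro: bounded_measurable_power\<close>)
    have ineq: "(hnorm p * S)\<^sup>2 \<le> A n * B n" for n
    proof -
      define H where "H t = integral {-1..t} (\<lambda>t. h n t + \<delta>)" for t
      have hc: "continuous_on X (\<lambda>t. h n t + \<delta>)" for X
        by (intro continuous_intros continuous_on_subset[OF h(1)]) auto
      have H: "(H has_real_derivative h n t + \<delta>) (at t)" if "t \<in> {0..T}" for t
      proof -
        have "(H has_real_derivative h n t + \<delta>) (at t within {-1..T+1})"
          unfolding H_def by (rule integral_has_real_derivative[OF hc]) (use that in auto)
        then show ?thesis
          using that by (metis (no_types, lifting) at_within_interior interior_atLeastAtMost_real atLeastAtMost_iff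
              greaterThanLessThan_iff le_less_trans less_le_trans neg_less_0_iff_less zero_less_one less_add_one
              minus_less_iff order_le_less_trans order_less_le_trans)
      qed
      define \<theta> where "\<theta> t = H t - H 0" for t
      interpret clock T \<theta> "\<lambda>t. h n t + \<delta>" \<delta>
      proof
        show "lip_deriv 0 T \<theta> (\<lambda>t. h n t + \<delta>)"
          unfolding \<theta>_def
          by (rule lip_deriv_C1) (use H hc T in \<open>auto intro!: derivative_eq_intros\<close>)
      qed (use T \<delta> h(2) in \<open>auto simp: \<theta>_def\<close>)
      have A: "\<theta> T = A n"
        using lip_deriv_integral[OF \<theta>] T \<theta>0 by (simp add: A_def)
      have A0: "0 < A n"
        using total_pos A by simp
      \<comment> \<open>The covector is rescaled so that its extremal reaches the same end point at
        clock time \<open>A n\<close>. The angles \<open>\<alpha> p5 S / 2\<close> do not change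
        under this.\<close>
      define r where "r = S / A n"
      have rA: "r * A n = S" "0 \<le> r"
        using A0 S by (auto simp: r_def)
      have "(hnorm (r *\<^sub>R p))\<^sup>2 * \<theta> T \<le> integral {0..T} (\<lambda>t. (hnorm (v t))\<^sup>2 / (h n t + \<delta>))"
      proof (rule energy_ge[OF hd \<gamma>0])
        show "\<gamma> T = extremal \<alpha>1 \<alpha>2 (r *\<^sub>R p) (\<theta> T)"
          by (simp add: \<gamma>T extremal_scale A rA)
        have "\<bar>\<alpha> * (r *\<^sub>R p) $ 5 / 2\<bar> * \<theta> T = \<bar>\<alpha> * p $ 5 / 2\<bar> * S" for \<alpha>
          using rA(2) unfolding A rA(1)[symmetric] by (simp add: abs_mult)
        then show "\<bar>\<alpha>1 * (r *\<^sub>R p) $ 5 / 2\<bar> * \<theta> T \<le> pi" "\<bar>\<alpha>2 * (r *\<^sub>R p) $ 5 / 2\<bar> * \<theta> T \<le> pi"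
          using k1 k2 by auto
      qed
      then have "(r * hnorm p)\<^sup>2 * A n \<le> B n"
        unfolding A B_def s_def hnorm_scale using rA(2) by simp
      then have "A n * ((r * hnorm p)\<^sup>2 * A n) \<le> A n * B n"
        using A0 by (intro mult_left_mono) auto
      moreover have "A n * ((r * hnorm p)\<^sup>2 * A n) = (hnorm p * S)\<^sup>2"
        unfolding rA(1)[symmetric] by (simp add: power2_eq_square mult_ac)
      ultimately show ?thesis
        by simp
    qed
    have Al: "A \<longlonglongrightarrow> integral {0..T} (\<lambda>t. s t + \<delta>)"
      unfolding A_def
    proof (rule dominated_convergence_spike[OF _ N, of _ _ "\<lambda>t. M + \<delta>"])
      show "(\<lambda>t. h n t + \<delta>) integrable_on {0..T}" for n
        by (rule bounded_measurable_integrable[OF hb])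
      show "\<bar>h n t + \<delta>\<bar> \<le> M + \<delta>" for n t
        using h(2)[of n t] h(3)[of n t] \<delta> by auto
      show "(\<lambda>n. h n t + \<delta>) \<longlonglongrightarrow> s t + \<delta>" if "t \<in> {0..T} - N" for t
        by (intro tendsto_intros lim that)
    qed (rule integrable_const_ivl)
    have Bl: "B \<longlonglongrightarrow> integral {0..T} (\<lambda>t. (s t)\<^sup>2 / (s t + \<delta>))"
      unfolding B_def
    proof (rule dominated_convergence_spike[OF _ N, of _ _ "\<lambda>t. M\<^sup>2 / \<delta>"])
      show "(\<lambda>t. (s t)\<^sup>2 / (h n t + \<delta>)) integrable_on {0..T}" for n
        by (rule bounded_measurable_integrable[OF Bb])
      show "\<bar>(s t)\<^sup>2 / (h n t + \<delta>)\<bar> \<le> M\<^sup>2 / \<delta>" if "t \<in> {0..T} - N" for n t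
      proof -
        have "(s t)\<^sup>2 \<le> M\<^sup>2"
          using M(2)[of t] that s0 by (intro power_mono) auto
        then have "(s t)\<^sup>2 / (h n t + \<delta>) \<le> M\<^sup>2 / \<delta>"
          using h(2)[of n t] \<delta> by (intro frac_le) auto
        moreover have "0 \<le> (s t)\<^sup>2 / (h n t + \<delta>)"
          using h(2)[of n t] \<delta> by simp
        ultimately show ?thesis
          by (simp only: abs_of_nonneg)
      qed
      show "(\<lambda>n. (s t)\<^sup>2 / (h n t + \<delta>)) \<longlonglongrightarrow> (s t)\<^sup>2 / (s t + \<delta>)" if "t \<in> {0..T} - N" for t
        using s0[of t] \<delta> by (intro tendsto_intros lim that) auto
    qed (rule integrable_const_ivl)
    have "(hnorm p * S)\<^sup>2 \<le> integral {0..T} (\<lambda>t. s t + \<delta>) * integral {0..T} (\<lambda>t. (s t)\<^sup>2 / (s t + \<delta>))"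
      by (rule tendsto_lowerbound[OF tendsto_mult[OF Al Bl]]) (use ineq in auto)
    also have "integral {0..T} (\<lambda>t. s t + \<delta>) = L + \<delta> * T"
      using T unfolding L_def by (subst Henstock_Kurzweil_Integration.integral_add[OF si]) (auto simp: integrable_const_ivl)
    also have "(L + \<delta> * T) * integral {0..T} (\<lambda>t. (s t)\<^sup>2 / (s t + \<delta>)) \<le> (L + \<delta> * T) * L"
    proof (rule mult_left_mono)
      show "integral {0..T} (\<lambda>t. (s t)\<^sup>2 / (s t + \<delta>)) \<le> L"
        unfolding L_def
      proof (rule integral_le[OF _ si])
        show "(\<lambda>t. (s t)\<^sup>2 / (s t + \<delta>)) integrable_on {0..T}"
          by (intro bounded_measurable_integrable bounded_measurable_divide[OF _ _ \<delta>] bounded_measurable_intros s)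
            (use s0 in auto)
        show "(s t)\<^sup>2 / (s t + \<delta>) \<le> s t" for t
          using s0[of t] \<delta> by (simp add: divide_le_eq power2_eq_square algebra_simps)
      qed
    qed (use L0 \<delta> T in auto)
    finally show ?thesis .
  qed
  have "(hnorm p * S)\<^sup>2 \<le> (L + 0 * T) * L"
  proof (rule tendsto_lowerbound)
    show "((\<lambda>\<delta>. (L + \<delta> * T) * L) \<longlongrightarrow> (L + 0 * T) * L) (at_right 0)"
      by (intro tendsto_intros)
    show "\<forall>\<^sub>F \<delta> in at_right 0. (hnorm p * S)\<^sup>2 \<le> (L + \<delta> * T) * L"
      using eventually_at_right_less by (rule eventually_mono) (use main in auto)
  qed auto
  then have "(hnorm p * S)\<^sup>2 \<le> L\<^sup>2"
    by (simp add: power2_eq_square)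
  then show ?thesis
    using L0 unfolding L_def s_def by (rule power2_le_imp_le)
qed

lemma horizontal_deriv_0: "horizontal_deriv \<alpha>1 \<alpha>2 a b (\<lambda>t. 0) (\<lambda>t. 0)"
  unfolding horizontal_deriv_def by (auto simp: lip_deriv_const area_form_def intro!: exI[of _ "{}"])

lemma length_ge:
  assumes "horizontal (bi_heisenberg \<alpha>1 \<alpha>2) 0 T \<gamma>" and T: "0 \<le> T"
    and \<gamma>0: "\<gamma> 0 = 0" and \<gamma>T: "\<gamma> T = extremal \<alpha>1 \<alpha>2 p S" and S: "0 \<le> S"
    and k: "\<bar>\<alpha>1 * p $ 5 / 2\<bar> * S \<le> pi" "\<bar>\<alpha>2 * p $ 5 / 2\<bar> * S \<le> pi"
  shows "hnorm p * S \<le> sr_length (bi_heisenberg \<alpha>1 \<alpha>2) 0 T \<gamma>"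
proof -
  obtain v where v: "horizontal_deriv \<alpha>1 \<alpha>2 0 T \<gamma> v"
    using horizontal_imp_deriv[OF assms(1) T] by blast
  show ?thesis
  proof (cases "T = 0")
    \<comment> \<open>The end point is then the origin, which the constant curve on
      \<open>{0..1}\<close> reaches as well. The bound for that curve gives
      \<open>hnorm p * S \<le> 0\<close>.\<close>
    case True
    then have "extremal \<alpha>1 \<alpha>2 p S = 0"
      using \<gamma>0 \<gamma>T by simp
    then have "hnorm p * S \<le> integral {0..1} (\<lambda>t::real. hnorm 0)"
      by (intro length_ge_of_deriv[OF horizontal_deriv_0 _ _ _ S k]) auto
    also have "\<dots> = 0"
      by (simp add: hnorm_def)
    finally show ?thesis
      using True by (simp add: sr_length_def)
  next
    case False
    then show ?thesis
      using length_ge_of_deriv[OF v _ \<gamma>0 \<gamma>T S k] T by (simp add: sr_length_bi_heisenberg[OF v])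
  qed
qed

subsection \<open>Left translations\<close>

text \<open>Left multiplication by \<open>q\<close> in the group for which the frame is left
  invariant. The inverse of \<open>q\<close> is \<open>- q\<close>, since \<open>area_form\<close>
  is alternating.\<close>

definition translate :: "real \<Rightarrow> real \<Rightarrow> real^5 \<Rightarrow> real^5 \<Rightarrow> real^5" where
  "translate \<alpha>1 \<alpha>2 q q' = q + q' + vector [0, 0, 0, 0, area_form \<alpha>1 \<alpha>2 q q']"

text \<open>The differential of \<open>translate \<alpha>1 \<alpha>2 q\<close>; that map is affine,
  so no base point occurs.\<close>

definition translate_deriv :: "real \<Rightarrow> real \<Rightarrow> real^5 \<Rightarrow> real^5 \<Rightarrow> real^5" where
  "translate_deriv \<alpha>1 \<alpha>2 q v = v + vector [0, 0, 0, 0, area_form \<alpha>1 \<alpha>2 q v]"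

lemma translate_nth:
  "translate \<alpha>1 \<alpha>2 q q' $ 1 = q $ 1 + q' $ 1" "translate \<alpha>1 \<alpha>2 q q' $ 2 = q $ 2 + q' $ 2"
  "translate \<alpha>1 \<alpha>2 q q' $ 3 = q $ 3 + q' $ 3" "translate \<alpha>1 \<alpha>2 q q' $ 4 = q $ 4 + q' $ 4"
  "translate \<alpha>1 \<alpha>2 q q' $ 5 = q $ 5 + q' $ 5 + area_form \<alpha>1 \<alpha>2 q q'"
  by (simp_all add: translate_def)

lemma translate_0 [simp]: "translate \<alpha>1 \<alpha>2 0 q = q" "translate \<alpha>1 \<alpha>2 q 0 = q"
  by (simp_all add: vec5_eq_iff translate_nth area_form_def)

lemma translate_minus_cancel [simp]:
  "translate \<alpha>1 \<alpha>2 (- q) (translate \<alpha>1 \<alpha>2 q q') = q'"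
  "translate \<alpha>1 \<alpha>2 q (translate \<alpha>1 \<alpha>2 (- q) q') = q'"
  "translate \<alpha>1 \<alpha>2 (- q) q = 0"
  by (simp_all add: vec5_eq_iff translate_nth area_form_def field_simps)

lemma translate_inject: "translate \<alpha>1 \<alpha>2 q a = translate \<alpha>1 \<alpha>2 q b \<longleftrightarrow> a = b"
  by (metis translate_minus_cancel(1))

lemma hnorm_translate_deriv [simp]: "hnorm (translate_deriv \<alpha>1 \<alpha>2 q v) = hnorm v"
  by (simp add: hnorm_def translate_deriv_def)

text \<open>Left invariance of the distribution: the term added to the last component is exactly
  what \<open>area_form\<close> gains when the base point moves from \<open>q'\<close> to its
  translate.\<close>

lemma translate_deriv_horizontal:
  assumes "v $ 5 = area_form \<alpha>1 \<alpha>2 q' v"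
  shows "translate_deriv \<alpha>1 \<alpha>2 q v $ 5 = area_form \<alpha>1 \<alpha>2 (translate \<alpha>1 \<alpha>2 q q') (translate_deriv \<alpha>1 \<alpha>2 q v)"
  using assms by (simp add: translate_deriv_def area_form_def translate_nth field_simps)

lemma translate_eq: "translate \<alpha>1 \<alpha>2 q q' = q + translate_deriv \<alpha>1 \<alpha>2 q q'"
  by (simp add: translate_def translate_deriv_def)

lemma bounded_linear_translate_deriv: "bounded_linear (translate_deriv \<alpha>1 \<alpha>2 q)"
proof -
  have "linear (translate_deriv \<alpha>1 \<alpha>2 q)"
    by (rule linearI) (simp_all add: vec5_eq_iff translate_deriv_def area_form_add_right
        area_form_scale_right algebra_simps)
  then show ?thesis
    by (simp add: linear_conv_bounded_linear)
qed

lemma has_vector_derivative_translate: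
  assumes "(\<gamma> has_vector_derivative v) (at (t + c))"
  shows "((\<lambda>t. translate \<alpha>1 \<alpha>2 q (\<gamma> (t + c))) has_vector_derivative translate_deriv \<alpha>1 \<alpha>2 q v) (at t)"
proof -
  have "((\<lambda>t. \<gamma> (t + c)) has_vector_derivative v) (at t)"
    using assms by (simp add: has_vector_derivative_vec_iff DERIV_shift)
  from bounded_linear.has_vector_derivative[OF bounded_linear_translate_deriv this]
  show ?thesis
    unfolding translate_eq by (simp add: has_vector_derivative_add_const add.commute[of q])
qed

lemma horizontal_translate:
  assumes "horizontal (bi_heisenberg \<alpha>1 \<alpha>2) (a + c) (b + c) \<gamma>"
  shows "horizontal (bi_heisenberg \<alpha>1 \<alpha>2) a b (\<lambda>t. translate \<alpha>1 \<alpha>2 q (\<gamma> (t + c)))"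
proof -
  obtain L N where L: "L-lipschitz_on {a + c..b + c} \<gamma>" and N: "negligible N"
    and ex: "\<forall>t\<in>{a + c..b + c} - N. \<exists>v. (\<gamma> has_vector_derivative v) (at t) \<and> v $ 5 = area_form \<alpha>1 \<alpha>2 (\<gamma> t) v"
    using assms(1) unfolding horizontal_iff by blast
  obtain K where K: "K \<ge> 0" "\<And>x. norm (translate_deriv \<alpha>1 \<alpha>2 q x) \<le> norm x * K"
    using bounded_linear.nonneg_bounded[OF bounded_linear_translate_deriv] by blast
  have "(L * K)-lipschitz_on {a..b} (\<lambda>t. translate \<alpha>1 \<alpha>2 q (\<gamma> (t + c)))"
  proof (rule lipschitz_onI)
    show "0 \<le> L * K"
      using K lipschitz_on_nonneg[OF L] by simp
    fix s t assume st: "s \<in> {a..b}" "t \<in> {a..b}"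
    have "dist (translate \<alpha>1 \<alpha>2 q (\<gamma> (s + c))) (translate \<alpha>1 \<alpha>2 q (\<gamma> (t + c)))
        = norm (translate_deriv \<alpha>1 \<alpha>2 q (\<gamma> (s + c) - \<gamma> (t + c)))"
      by (simp add: translate_eq dist_norm linear_diff[OF bounded_linear.linear[OF bounded_linear_translate_deriv]])
    also have "\<dots> \<le> dist (\<gamma> (s + c)) (\<gamma> (t + c)) * K"
      using K(2) by (simp add: dist_norm)
    also have "\<dots> \<le> (L * dist (s + c) (t + c)) * K"
      using st K(1) by (intro mult_right_mono lipschitz_onD[OF L]) auto
    finally show "dist (translate \<alpha>1 \<alpha>2 q (\<gamma> (s + c))) (translate \<alpha>1 \<alpha>2 q (\<gamma> (t + c))) \<le> L * K * dist s t"
      by (simp add: mult_ac)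
  qed
  moreover have "negligible ((\<lambda>t. - c + t) ` N)"
    by (rule negligible_translation[OF N])
  moreover have "\<exists>v. ((\<lambda>t. translate \<alpha>1 \<alpha>2 q (\<gamma> (t + c))) has_vector_derivative v) (at t) \<and>
      v $ 5 = area_form \<alpha>1 \<alpha>2 (translate \<alpha>1 \<alpha>2 q (\<gamma> (t + c))) v"
    if t: "t \<in> {a..b} - (\<lambda>t. - c + t) ` N" for t
  proof -
    have "t + c \<notin> N"
    proof
      assume "t + c \<in> N"
      then have "- c + (t + c) \<in> (\<lambda>t. - c + t) ` N"
        by blast
      then show False
        using t by simp
    qed
    then obtain v where "(\<gamma> has_vector_derivative v) (at (t + c))" "v $ 5 = area_form \<alpha>1 \<alpha>2 (\<gamma> (t + c)) v"
      using ex t by force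
    then show ?thesis
      using has_vector_derivative_translate translate_deriv_horizontal by blast
  qed
  ultimately show ?thesis
    unfolding horizontal_iff by blast
qed

lemma sr_length_translate:
  assumes "horizontal (bi_heisenberg \<alpha>1 \<alpha>2) a b \<gamma>"
  shows "sr_length (bi_heisenberg \<alpha>1 \<alpha>2) a b (\<lambda>t. translate \<alpha>1 \<alpha>2 q (\<gamma> t)) = sr_length (bi_heisenberg \<alpha>1 \<alpha>2) a b \<gamma>"
proof -
  obtain N where N: "negligible N"
    and ex: "\<forall>t\<in>{a..b} - N. \<exists>v. (\<gamma> has_vector_derivative v) (at t) \<and> v $ 5 = area_form \<alpha>1 \<alpha>2 (\<gamma> t) v"
    using assms(1) unfolding horizontal_iff by blast
  show ?thesis
    unfolding sr_length_def
  proof (rule integral_spike[OF N])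
    fix t assume "t \<in> {a..b} - N"
    then obtain v where v: "(\<gamma> has_vector_derivative v) (at t)" "v $ 5 = area_form \<alpha>1 \<alpha>2 (\<gamma> t) v"
      using ex by blast
    show "sr_speed (bi_heisenberg \<alpha>1 \<alpha>2) \<gamma> t = sr_speed (bi_heisenberg \<alpha>1 \<alpha>2) (\<lambda>t. translate \<alpha>1 \<alpha>2 q (\<gamma> t)) t"
      using sr_speed_bi_heisenberg[OF v] has_vector_derivative_translate[of \<gamma> v t 0 \<alpha>1 \<alpha>2 q] v(1)
        translate_deriv_horizontal[OF v(2), of q]
        sr_speed_bi_heisenberg[of "\<lambda>t. translate \<alpha>1 \<alpha>2 q (\<gamma> t)" "translate_deriv \<alpha>1 \<alpha>2 q v" t]
      by simp
  qed
qed

text \<open>Horizontality speaks of two-sided derivatives, which at \<open>a\<close> and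
  \<open>b\<close> depend on values outside the interval. These two points are moved into the null
  set.\<close>

lemma horizontal_cong:
  assumes eq: "\<And>t. t \<in> {a..b} \<Longrightarrow> \<gamma> t = \<gamma>' t" and h: "horizontal (bi_heisenberg \<alpha>1 \<alpha>2) a b \<gamma>'"
  shows "horizontal (bi_heisenberg \<alpha>1 \<alpha>2) a b \<gamma>"
proof -
  obtain L N where L: "L-lipschitz_on {a..b} \<gamma>'" and N: "negligible N"
    and ex: "\<forall>t\<in>{a..b} - N. \<exists>v. (\<gamma>' has_vector_derivative v) (at t) \<and> v $ 5 = area_form \<alpha>1 \<alpha>2 (\<gamma>' t) v"
    using h unfolding horizontal_iff by blast
  have "L-lipschitz_on {a..b} \<gamma>"
    using L eq unfolding lipschitz_on_def by auto
  moreover have "negligible (N \<union> {a, b})"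
    using N by (auto intro: negligible_Un)
  moreover have "\<exists>v. (\<gamma> has_vector_derivative v) (at t) \<and> v $ 5 = area_form \<alpha>1 \<alpha>2 (\<gamma> t) v"
    if t: "t \<in> {a..b} - (N \<union> {a, b})" for t
  proof -
    obtain v where v: "(\<gamma>' has_vector_derivative v) (at t)" "v $ 5 = area_form \<alpha>1 \<alpha>2 (\<gamma>' t) v"
      using ex t by blast
    have "(\<gamma> has_vector_derivative v) (at t)"
      by (rule has_vector_derivative_transform_within_open[OF v(1), of "{a<..<b}"]) (use t eq in auto)
    then show ?thesis
      using v(2) eq t by auto
  qed
  ultimately show ?thesis
    unfolding horizontal_iff by blast
qed

subsection \<open>Minimality of extremals\<close>

lemma lipschitz_on_vecI:
  fixes \<gamma> :: "real \<Rightarrow> real^'n"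
  assumes "\<And>i. \<exists>L. L-lipschitz_on S (\<lambda>t. \<gamma> t $ i)"
  shows "\<exists>L. L-lipschitz_on S \<gamma>"
proof -
  obtain L where L: "\<And>i. (L i)-lipschitz_on S (\<lambda>t. \<gamma> t $ i)"
    using assms by metis
  have "(\<Sum>i\<in>UNIV. L i)-lipschitz_on S \<gamma>"
  proof (rule lipschitz_onI)
    show "0 \<le> (\<Sum>i\<in>UNIV. L i)"
      using L lipschitz_on_nonneg by (intro sum_nonneg) blast
    fix s t assume "s \<in> S" "t \<in> S"
    then have "\<bar>(\<gamma> s - \<gamma> t) $ i\<bar> \<le> L i * dist s t" for i
      using lipschitz_onD[OF L, of s t i] by (simp add: dist_real_def)
    then have "(\<Sum>i\<in>UNIV. \<bar>(\<gamma> s - \<gamma> t) $ i\<bar>) \<le> (\<Sum>i\<in>UNIV. L i * dist s t)"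
      by (rule sum_mono)
    then show "dist (\<gamma> s) (\<gamma> t) \<le> (\<Sum>i\<in>UNIV. L i) * dist s t"
      using norm_le_l1_cart[of "\<gamma> s - \<gamma> t"] by (simp add: dist_norm sum_distrib_right)
  qed
  then show ?thesis ..
qed

lemma extremal_horizontal_deriv:
  assumes "a \<le> b"
  shows "horizontal_deriv \<alpha>1 \<alpha>2 a b (extremal \<alpha>1 \<alpha>2 p)
    (\<lambda>t. horizontal_lift \<alpha>1 \<alpha>2 (extremal \<alpha>1 \<alpha>2 p t) (momentum \<alpha>1 \<alpha>2 p t))"
proof -
  have "lip_deriv a b (\<lambda>t. extremal \<alpha>1 \<alpha>2 p t $ i)
     (\<lambda>t. horizontal_lift \<alpha>1 \<alpha>2 (extremal \<alpha>1 \<alpha>2 p t) (momentum \<alpha>1 \<alpha>2 p t) $ i)" for i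
  proof (rule lip_deriv_C1)
    show "((\<lambda>t. extremal \<alpha>1 \<alpha>2 p t $ i) has_real_derivative
      horizontal_lift \<alpha>1 \<alpha>2 (extremal \<alpha>1 \<alpha>2 p t) (momentum \<alpha>1 \<alpha>2 p t) $ i) (at t)" for t
      using extremal_deriv by (auto simp: has_vector_derivative_vec_iff)
    show "continuous_on {a..b} (\<lambda>t. horizontal_lift \<alpha>1 \<alpha>2 (extremal \<alpha>1 \<alpha>2 p t) (momentum \<alpha>1 \<alpha>2 p t) $ i)"
      using exhaust_5[of i]
      by (elim disjE) (simp_all add: horizontal_lift_def area_form_def extremal_nth momentum_def Let_def,
          (intro continuous_intros; simp)+)
  qed (rule assms)
  then show ?thesis
    unfolding horizontal_deriv_def using extremal_deriv
    by (auto intro!: exI[of _ "{}"])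
qed

lemma horizontal_deriv_imp_horizontal:
  assumes "horizontal_deriv \<alpha>1 \<alpha>2 a b \<gamma> v"
  shows "horizontal (bi_heisenberg \<alpha>1 \<alpha>2) a b \<gamma>"
proof -
  have "\<exists>L. L-lipschitz_on {a..b} \<gamma>"
    by (rule lipschitz_on_vecI) (use assms in \<open>auto simp: horizontal_deriv_def lip_deriv_def\<close>)
  then show ?thesis
    using assms unfolding horizontal_deriv_def horizontal_iff by blast
qed

lemma horizontal_extremal: "horizontal (bi_heisenberg \<alpha>1 \<alpha>2) a b (\<lambda>t. translate \<alpha>1 \<alpha>2 q (extremal \<alpha>1 \<alpha>2 p (t + c)))"
proof (cases "a \<le> b")
  case True
  then show ?thesis
    by (intro horizontal_translate horizontal_deriv_imp_horizontal[OF extremal_horizontal_deriv]) auto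
next
  case False
  then show ?thesis
    by (auto simp: horizontal_iff lipschitz_on_def intro!: exI[of _ "{}"] exI[of _ 0])
qed

lemma extremal_translate_deriv:
  "((\<lambda>t. translate \<alpha>1 \<alpha>2 q (extremal \<alpha>1 \<alpha>2 p (t + c))) has_vector_derivative translate_deriv \<alpha>1 \<alpha>2 q
     (horizontal_lift \<alpha>1 \<alpha>2 (extremal \<alpha>1 \<alpha>2 p (t + c)) (momentum \<alpha>1 \<alpha>2 p (t + c)))) (at t)"
  by (rule has_vector_derivative_translate[OF extremal_deriv])

lemma sr_speed_extremal:
  "sr_speed (bi_heisenberg \<alpha>1 \<alpha>2) (\<lambda>t. translate \<alpha>1 \<alpha>2 q (extremal \<alpha>1 \<alpha>2 p (t + c))) t = hnorm p"
  using sr_speed_bi_heisenberg[OF extremal_translate_deriv translate_deriv_horizontal] by simp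

text \<open>The infimum is attained by the translated extremal itself; any competitor is translated
  back to the origin and bounded by \<open>length_ge\<close>.\<close>

lemma sr_dist_extremal:
  assumes S: "0 \<le> S" and k: "\<bar>\<alpha>1 * p $ 5 / 2\<bar> * S \<le> pi" "\<bar>\<alpha>2 * p $ 5 / 2\<bar> * S \<le> pi"
  shows "sr_dist (bi_heisenberg \<alpha>1 \<alpha>2) q (translate \<alpha>1 \<alpha>2 q (extremal \<alpha>1 \<alpha>2 p S)) = hnorm p * S"
  unfolding sr_dist_def
proof (rule cInf_eq_minimum)
  let ?\<gamma> = "\<lambda>t. translate \<alpha>1 \<alpha>2 q (extremal \<alpha>1 \<alpha>2 p (t + 0))"
  have "sr_length (bi_heisenberg \<alpha>1 \<alpha>2) 0 S ?\<gamma> = hnorm p * S"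
    unfolding sr_length_def sr_speed_extremal using S by simp
  then show "hnorm p * S \<in> {sr_length (bi_heisenberg \<alpha>1 \<alpha>2) 0 T \<gamma> |T \<gamma>. 0 \<le> T \<and>
      horizontal (bi_heisenberg \<alpha>1 \<alpha>2) 0 T \<gamma> \<and> \<gamma> 0 = q \<and>
      \<gamma> T = translate \<alpha>1 \<alpha>2 q (extremal \<alpha>1 \<alpha>2 p S)}"
    using horizontal_extremal[of \<alpha>1 \<alpha>2 0 S q p 0] S
    by (intro CollectI exI[of _ S] exI[of _ ?\<gamma>]) auto
next
  fix l assume "l \<in> {sr_length (bi_heisenberg \<alpha>1 \<alpha>2) 0 T \<gamma> |T \<gamma>. 0 \<le> T \<and>
      horizontal (bi_heisenberg \<alpha>1 \<alpha>2) 0 T \<gamma> \<and> \<gamma> 0 = q \<and>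
      \<gamma> T = translate \<alpha>1 \<alpha>2 q (extremal \<alpha>1 \<alpha>2 p S)}"
  then obtain T \<gamma> where l: "l = sr_length (bi_heisenberg \<alpha>1 \<alpha>2) 0 T \<gamma>" and T: "0 \<le> T"
    and h: "horizontal (bi_heisenberg \<alpha>1 \<alpha>2) 0 T \<gamma>" and "\<gamma> 0 = q"
    and "\<gamma> T = translate \<alpha>1 \<alpha>2 q (extremal \<alpha>1 \<alpha>2 p S)"
    by blast
  then have "hnorm p * S \<le> sr_length (bi_heisenberg \<alpha>1 \<alpha>2) 0 T (\<lambda>t. translate \<alpha>1 \<alpha>2 (- q) (\<gamma> t))"
    using horizontal_translate[of \<alpha>1 \<alpha>2 0 0 T \<gamma> "- q"] by (intro length_ge[OF _ T _ _ S k]) auto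
  then show "hnorm p * S \<le> l"
    by (simp add: l sr_length_translate[OF h])
qed

lemma extremal_minimizer:
  assumes "a < b" and \<gamma>: "\<And>t. t \<in> {a..b} \<Longrightarrow> \<gamma> t = translate \<alpha>1 \<alpha>2 q (extremal \<alpha>1 \<alpha>2 p (t - a))"
    and p: "hnorm p = 1"
    and k: "\<bar>\<alpha>1 * p $ 5 / 2\<bar> * (b - a) \<le> pi" "\<bar>\<alpha>2 * p $ 5 / 2\<bar> * (b - a) \<le> pi"
  shows "length_minimizer (bi_heisenberg \<alpha>1 \<alpha>2) a b \<gamma>"
proof -
  let ?\<gamma> = "\<lambda>t. translate \<alpha>1 \<alpha>2 q (extremal \<alpha>1 \<alpha>2 p (t + (- a)))"
  have h: "horizontal (bi_heisenberg \<alpha>1 \<alpha>2) a b \<gamma>"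
    by (rule horizontal_cong[OF _ horizontal_extremal[of \<alpha>1 \<alpha>2 a b q p "- a"]]) (simp add: \<gamma>)
  have "sr_speed (bi_heisenberg \<alpha>1 \<alpha>2) \<gamma> t = 1" if t: "t \<in> {a..b} - {a, b}" for t
  proof -
    let ?v = "translate_deriv \<alpha>1 \<alpha>2 q
      (horizontal_lift \<alpha>1 \<alpha>2 (extremal \<alpha>1 \<alpha>2 p (t + - a)) (momentum \<alpha>1 \<alpha>2 p (t + - a)))"
    have "(\<gamma> has_vector_derivative ?v) (at t)"
      by (rule has_vector_derivative_transform_within_open[OF extremal_translate_deriv, of "{a<..<b}"])
        (use t \<gamma> in auto)
    moreover have "\<gamma> t = translate \<alpha>1 \<alpha>2 q (extremal \<alpha>1 \<alpha>2 p (t + - a))"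
      using \<gamma> t by auto
    ultimately have "sr_speed (bi_heisenberg \<alpha>1 \<alpha>2) \<gamma> t = hnorm ?v"
      by (intro sr_speed_bi_heisenberg) (simp_all add: translate_deriv_horizontal)
    then show ?thesis
      using p by simp
  qed
  then have "sr_length (bi_heisenberg \<alpha>1 \<alpha>2) a b \<gamma> = integral {a..b} (\<lambda>t. 1)"
    unfolding sr_length_def by (intro integral_spike[of "{a, b}"]) auto
  also have "\<dots> = b - a"
    using assms(1) by simp
  also have "\<dots> = sr_dist (bi_heisenberg \<alpha>1 \<alpha>2) (\<gamma> a) (\<gamma> b)"
    using \<gamma>[of a] \<gamma>[of b] sr_dist_extremal[of "b - a" \<alpha>1 p \<alpha>2 q] k p \<open>a < b\<close> by simp
  finally show ?thesis
    using h by (simp add: length_minimizer_def)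
qed

text \<open>The planar components determine the last one: its derivative is the area form of the
  planar motion, and both curves start at the origin. This supplies the component on which the
  equality case of the energy bound is silent.\<close>

lemma horizontal_eq_extremal:
  assumes hd: "horizontal_deriv \<alpha>1 \<alpha>2 0 T \<gamma> v" and \<gamma>0: "\<gamma> 0 = 0"
    and eq: "\<And>t i. t \<in> {0..T} \<Longrightarrow> i \<noteq> 5 \<Longrightarrow> \<gamma> t $ i = extremal \<alpha>1 \<alpha>2 p t $ i"
    and t: "t \<in> {0..T}"
  shows "\<gamma> t = extremal \<alpha>1 \<alpha>2 p t"
proof -
  let ?u = "\<lambda>t. horizontal_lift \<alpha>1 \<alpha>2 (extremal \<alpha>1 \<alpha>2 p t) (momentum \<alpha>1 \<alpha>2 p t)"
  obtain N where N: "negligible N" "\<And>s. s \<in> {0..T} - N \<Longrightarrow> (\<gamma> has_vector_derivative v s) (at s)"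
    "\<And>s. s \<in> {0..T} - N \<Longrightarrow> v s $ 5 = area_form \<alpha>1 \<alpha>2 (\<gamma> s) (v s)"
    using hd unfolding horizontal_deriv_def by blast
  have "lip_deriv 0 T (\<lambda>s. \<gamma> s $ 5 - extremal \<alpha>1 \<alpha>2 p s $ 5) (\<lambda>s. v s $ 5 - ?u s $ 5)"
  proof (rule lip_deriv_diff)
    show "lip_deriv 0 T (\<lambda>s. \<gamma> s $ 5) (\<lambda>s. v s $ 5)"
      using hd unfolding horizontal_deriv_def by blast
    show "lip_deriv 0 T (\<lambda>s. extremal \<alpha>1 \<alpha>2 p s $ 5) (\<lambda>s. ?u s $ 5)"
    proof -
      have "0 \<le> T"
        using t by auto
      from extremal_horizontal_deriv[OF this, of \<alpha>1 \<alpha>2 p] show ?thesis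
        unfolding horizontal_deriv_def by blast
    qed
  qed
  then have "((\<lambda>s. v s $ 5 - ?u s $ 5) has_integral
      (\<gamma> t $ 5 - extremal \<alpha>1 \<alpha>2 p t $ 5) - (\<gamma> 0 $ 5 - extremal \<alpha>1 \<alpha>2 p 0 $ 5)) {0..t}"
    using t by (intro lip_deriv_has_integral[OF lip_deriv_subinterval]) auto
  moreover have "((\<lambda>s. v s $ 5 - ?u s $ 5) has_integral 0) {0..t}"
  proof (rule has_integral_spike[OF _ _ has_integral_0])
    show "negligible (N \<union> {0, T})"
      using N(1) by (auto intro: negligible_Un)
    fix s assume s: "s \<in> {0..t} - (N \<union> {0, T})"
    have vu: "v s $ i = ?u s $ i" if i: "i \<noteq> 5" for i
    proof (rule DERIV_unique)
      show "((\<lambda>s. \<gamma> s $ i) has_real_derivative v s $ i) (at s)"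
        using N(2)[of s] s t by (auto simp: has_vector_derivative_vec_iff)
      have "((\<lambda>s. extremal \<alpha>1 \<alpha>2 p s $ i) has_real_derivative ?u s $ i) (at s)"
        using extremal_deriv[of \<alpha>1 \<alpha>2 p s] by (auto simp: has_vector_derivative_vec_iff)
      then show "((\<lambda>s. \<gamma> s $ i) has_real_derivative ?u s $ i) (at s)"
        by (rule has_field_derivative_transform_within_open[of _ _ _ "{0<..<T}"]) (use s t eq i in auto)
    qed
    have "v s $ 5 = area_form \<alpha>1 \<alpha>2 (\<gamma> s) (v s)"
      using N(3) s t by auto
    also have "\<dots> = area_form \<alpha>1 \<alpha>2 (extremal \<alpha>1 \<alpha>2 p s) (?u s)"
      using s t by (simp add: area_form_def vu eq)
    finally show "v s $ 5 - ?u s $ 5 = 0"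
      by simp
  qed
  ultimately have "(\<gamma> t $ 5 - extremal \<alpha>1 \<alpha>2 p t $ 5) - (\<gamma> 0 $ 5 - extremal \<alpha>1 \<alpha>2 p 0 $ 5) = 0"
    by (rule has_integral_unique)
  then have "\<gamma> t $ 5 = extremal \<alpha>1 \<alpha>2 p t $ 5"
    by (simp add: \<gamma>0)
  then show ?thesis
    using eq[OF t] unfolding vec5_eq_iff by auto
qed

text \<open>Comparing the length of \<open>\<gamma>\<close> with the distance gives
  \<open>hnorm p = 1\<close>. At unit speed and with the identity as clock, the energy is then
  exactly the lower bound, so the equality case applies.\<close>

lemma minimizer_imp_extremal:
  assumes min: "length_minimizer (bi_heisenberg \<alpha>1 \<alpha>2) a b \<gamma>" and ab: "a < b"
    and speed: "AE t in lebesgue_on {a..b}. sr_speed (bi_heisenberg \<alpha>1 \<alpha>2) \<gamma> t = 1"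
    and endpoint: "\<gamma> b = translate \<alpha>1 \<alpha>2 (\<gamma> a) (extremal \<alpha>1 \<alpha>2 p (b - a))"
    and k: "\<bar>\<alpha>1 * p $ 5 / 2\<bar> * (b - a) \<le> pi" "\<bar>\<alpha>2 * p $ 5 / 2\<bar> * (b - a) \<le> pi"
  shows "\<exists>p'. p' $ 5 = p $ 5 \<and> hnorm p' = 1 \<and>
    (\<forall>t\<in>{a..b}. \<gamma> t = translate \<alpha>1 \<alpha>2 (\<gamma> a) (extremal \<alpha>1 \<alpha>2 p' (t - a)))"
proof -
  define T where "T = b - a"
  have T: "0 < T"
    using ab by (simp add: T_def)
  define \<beta> where "\<beta> t = translate \<alpha>1 \<alpha>2 (- \<gamma> a) (\<gamma> (t + a))" for t
  have h: "horizontal (bi_heisenberg \<alpha>1 \<alpha>2) a b \<gamma>"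
    using min by (simp add: length_minimizer_def)
  then have "horizontal (bi_heisenberg \<alpha>1 \<alpha>2) 0 T \<beta>"
    unfolding \<beta>_def T_def by (intro horizontal_translate) simp
  then obtain v where v: "horizontal_deriv \<alpha>1 \<alpha>2 0 T \<beta> v"
    using horizontal_imp_deriv T by fastforce
  have \<beta>0: "\<beta> 0 = 0" and \<beta>T: "\<beta> T = extremal \<alpha>1 \<alpha>2 p T"
    using endpoint by (simp_all add: \<beta>_def T_def)
  obtain N0 where N0: "negligible N0" "\<And>t. t \<in> {a..b} - N0 \<Longrightarrow> sr_speed (bi_heisenberg \<alpha>1 \<alpha>2) \<gamma> t = 1"
    using speed by (subst (asm) AE_lebesgue_on_iff) auto
  obtain N1 where N1: "negligible N1"
    "\<And>t. t \<in> {a..b} - N1 \<Longrightarrow> \<exists>v. (\<gamma> has_vector_derivative v) (at t) \<and> v $ 5 = area_form \<alpha>1 \<alpha>2 (\<gamma> t) v"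
    using h unfolding horizontal_iff by blast
  obtain N2 where N2: "negligible N2" "\<And>t. t \<in> {0..T} - N2 \<Longrightarrow> (\<beta> has_vector_derivative v t) (at t)"
    using v unfolding horizontal_deriv_def by blast
  define N where "N = N2 \<union> ((\<lambda>t. - a + t) ` (N0 \<union> N1)) \<union> {0, T}"
  have N: "negligible N"
    unfolding N_def using N0 N1 N2 by (intro negligible_Un negligible_translation) auto
  have v1: "hnorm (v t) = 1" if t: "t \<in> {0..T} - N" for t
  proof -
    have "t + a \<notin> N0 \<union> N1"
    proof
      assume "t + a \<in> N0 \<union> N1"
      then have "- a + (t + a) \<in> (\<lambda>t. - a + t) ` (N0 \<union> N1)"
        by blast
      then show False
        using t by (simp add: N_def)
    qed
    moreover have "t + a \<in> {a..b}"
      using t by (auto simp: T_def)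
    ultimately obtain d where d: "(\<gamma> has_vector_derivative d) (at (t + a))" "d $ 5 = area_form \<alpha>1 \<alpha>2 (\<gamma> (t + a)) d"
      and s: "sr_speed (bi_heisenberg \<alpha>1 \<alpha>2) \<gamma> (t + a) = 1"
      using N0(2) N1(2) by (metis DiffI UnCI)
    have "(\<beta> has_vector_derivative translate_deriv \<alpha>1 \<alpha>2 (- \<gamma> a) d) (at t)"
      unfolding \<beta>_def by (rule has_vector_derivative_translate[OF d(1)])
    then have "v t = translate_deriv \<alpha>1 \<alpha>2 (- \<gamma> a) d"
      using N2(2)[of t] t vector_derivative_unique_at by (auto simp: N_def)
    then show ?thesis
      using s sr_speed_bi_heisenberg[OF d] by simp
  qed
  have "sr_length (bi_heisenberg \<alpha>1 \<alpha>2) a b \<gamma> = integral {a..b} (\<lambda>t. 1)"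
    unfolding sr_length_def by (rule integral_spike[OF N0(1)]) (use N0(2) in auto)
  then have "sr_dist (bi_heisenberg \<alpha>1 \<alpha>2) (\<gamma> a) (\<gamma> b) = T"
    using min ab by (simp add: length_minimizer_def T_def)
  moreover have "sr_dist (bi_heisenberg \<alpha>1 \<alpha>2) (\<gamma> a) (\<gamma> b) = hnorm p * T"
    unfolding endpoint T_def by (rule sr_dist_extremal) (use ab k in auto)
  ultimately have p1: "hnorm p = 1"
    using T by simp
  interpret clock T "\<lambda>t. t" "\<lambda>t. 1" 1
  proof
    show "lip_deriv 0 T (\<lambda>t. t) (\<lambda>t. 1)"
      using T by (intro lip_deriv_C1) auto
  qed (use T in auto)
  have "integral {0..T} (\<lambda>t. (hnorm (v t))\<^sup>2 / 1) = integral {0..T} (\<lambda>t. 1)"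
    by (rule integral_spike[OF N]) (use v1 in auto)
  also have "\<dots> = (hnorm p)\<^sup>2 * T"
    using T p1 by simp
  finally obtain p' where p': "p' $ 5 = p $ 5"
    "\<And>t i. t \<in> {0..T} \<Longrightarrow> i \<noteq> 5 \<Longrightarrow> \<beta> t $ i = extremal \<alpha>1 \<alpha>2 p' t $ i"
    using energy_eq[OF v \<beta>0 \<beta>T] k unfolding T_def by blast
  have \<beta>: "\<beta> t = extremal \<alpha>1 \<alpha>2 p' t" if "t \<in> {0..T}" for t
    by (rule horizontal_eq_extremal[OF v \<beta>0 p'(2) that])
  \<comment> \<open>The equality case says nothing about the length of \<open>p'\<close>. It is read
    off from the speed at one time outside the null set.\<close>
  have "hnorm p' = 1"
  proof -
    have "\<not> negligible {0..T}"
      using T negligible_interval(1)[of 0 T] by (auto simp: box_ne_empty)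
    then obtain t where t: "t \<in> {0..T} - N"
      using N negligible_subset[of N "{0..T}"] by blast
    have "(extremal \<alpha>1 \<alpha>2 p' has_vector_derivative v t) (at t)"
      by (rule has_vector_derivative_transform_within_open[OF N2(2), of t "{0<..<T}"])
        (use t \<beta> in \<open>auto simp: N_def\<close>)
    then have "v t = horizontal_lift \<alpha>1 \<alpha>2 (extremal \<alpha>1 \<alpha>2 p' t) (momentum \<alpha>1 \<alpha>2 p' t)"
      using extremal_deriv vector_derivative_unique_at by blast
    then show ?thesis
      using v1[OF t] by simp
  qed
  moreover have "\<gamma> t = translate \<alpha>1 \<alpha>2 (\<gamma> a) (extremal \<alpha>1 \<alpha>2 p' (t - a))" if "t \<in> {a..b}" for t
    using \<beta>[of "t - a"] that unfolding \<beta>_def T_def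
    by (metis atLeastAtMost_iff diff_add_cancel diff_ge_0_iff_ge diff_right_mono translate_minus_cancel(2))
  ultimately show ?thesis
    using p'(1) by blast
qed

subsection \<open>Extremals as a flow\<close>

lemma horizontal_lift_nth [simp]:
  "horizontal_lift \<alpha>1 \<alpha>2 q v $ 1 = v $ 1" "horizontal_lift \<alpha>1 \<alpha>2 q v $ 2 = v $ 2"
  "horizontal_lift \<alpha>1 \<alpha>2 q v $ 3 = v $ 3" "horizontal_lift \<alpha>1 \<alpha>2 q v $ 4 = v $ 4"
  by (simp_all add: horizontal_lift_def)

lemma momentum_add: "momentum \<alpha>1 \<alpha>2 p (s + t) = momentum \<alpha>1 \<alpha>2 (momentum \<alpha>1 \<alpha>2 p s) t"
  by (simp add: vec5_eq_iff momentum_def Let_def distrib_left cos_add sin_add algebra_simps)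

text \<open>An extremal restarted at time \<open>s\<close> is the left translate of one from the
  origin whose initial covector consists of the frame momenta at \<open>s\<close>. Both sides agree
  at \<open>t = 0\<close> and have the same planar velocity; once the planar components agree, so do
  the last velocities.\<close>

lemma extremal_add:
  "extremal \<alpha>1 \<alpha>2 p (s + t) =
    translate \<alpha>1 \<alpha>2 (extremal \<alpha>1 \<alpha>2 p s) (extremal \<alpha>1 \<alpha>2 (momentum \<alpha>1 \<alpha>2 p s) t)"
proof -
  let ?l = "\<lambda>t. extremal \<alpha>1 \<alpha>2 p (t + s)"
  let ?r = "\<lambda>t. translate \<alpha>1 \<alpha>2 (extremal \<alpha>1 \<alpha>2 p s) (extremal \<alpha>1 \<alpha>2 (momentum \<alpha>1 \<alpha>2 p s) (t + 0))"
  define L where "L t = horizontal_lift \<alpha>1 \<alpha>2 (?l t) (momentum \<alpha>1 \<alpha>2 p (t + s))" for t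
  define R where "R t = translate_deriv \<alpha>1 \<alpha>2 (extremal \<alpha>1 \<alpha>2 p s)
      (horizontal_lift \<alpha>1 \<alpha>2 (extremal \<alpha>1 \<alpha>2 (momentum \<alpha>1 \<alpha>2 p s) t) (momentum \<alpha>1 \<alpha>2 p (t + s)))" for t
  have l: "((\<lambda>t. ?l t $ i) has_real_derivative L t $ i) (at t)" for i t
    using extremal_deriv[of \<alpha>1 \<alpha>2 p "t + s"] by (simp add: has_vector_derivative_vec_iff L_def DERIV_shift)
  have r: "((\<lambda>t. ?r t $ i) has_real_derivative R t $ i) (at t)" for i t
    using extremal_translate_deriv[of \<alpha>1 \<alpha>2 "extremal \<alpha>1 \<alpha>2 p s" "momentum \<alpha>1 \<alpha>2 p s" 0 t]
    by (simp add: has_vector_derivative_vec_iff R_def momentum_add[symmetric] add.commute)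
  have eq: "?l t $ i = ?r t $ i" if LR: "\<And>t. L t $ i = R t $ i" for i t
  proof -
    have "((\<lambda>t. ?l t $ i - ?r t $ i) has_real_derivative 0) (at t)" for t
      using DERIV_diff[OF l[of i t] r[of i t]] by (simp add: LR)
    then have "?l t $ i - ?r t $ i = ?l 0 $ i - ?r 0 $ i"
      by (intro DERIV_isconst_all) auto
    then show ?thesis
      by simp
  qed
  have "?l t $ i = ?r t $ i" if i: "i \<noteq> 5" for i t
    by (rule eq) (use i exhaust_5[of i] in \<open>auto simp: L_def R_def horizontal_lift_def translate_deriv_def\<close>)
  note low = this[of 1] this[of 2] this[of 3] this[of 4]
  have "L t $ 5 = R t $ 5" for t
    using low[of t] by (simp add: L_def R_def translate_deriv_def area_form_def translate_nth field_simps)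
  then have "?l t $ 5 = ?r t $ 5"
    by (rule eq)
  then show ?thesis
    using low[of t] by (simp add: vec5_eq_iff add.commute)
qed

text \<open>No motion in a plane with nonzero \<open>\<alpha>\<close>. The extremal is then a line
  or constant and does not depend on \<open>p $ 5\<close>, which therefore cannot be recovered from
  the curve.\<close>

definition straight :: "real \<Rightarrow> real \<Rightarrow> real^5 \<Rightarrow> bool" where
  "straight \<alpha>1 \<alpha>2 p \<longleftrightarrow> \<alpha>1 * ((p $ 1)\<^sup>2 + (p $ 2)\<^sup>2) = 0 \<and> \<alpha>2 * ((p $ 3)\<^sup>2 + (p $ 4)\<^sup>2) = 0"

lemma straight_momentum [simp]: "straight \<alpha>1 \<alpha>2 (momentum \<alpha>1 \<alpha>2 p t) \<longleftrightarrow> straight \<alpha>1 \<alpha>2 p"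
  by (simp add: straight_def momentum_def Let_def rotation_squares)

lemma straight_scale: "r \<noteq> 0 \<Longrightarrow> straight \<alpha>1 \<alpha>2 (r *\<^sub>R p) \<longleftrightarrow> straight \<alpha>1 \<alpha>2 p"
  by (simp add: straight_def power_mult_distrib flip: distrib_left)

lemma straight_extremal:
  assumes "straight \<alpha>1 \<alpha>2 p" and "\<And>i. i \<noteq> 5 \<Longrightarrow> p' $ i = p $ i"
  shows "extremal \<alpha>1 \<alpha>2 p' t = extremal \<alpha>1 \<alpha>2 p t"
proof -
  have "p' $ 1 = p $ 1" "p' $ 2 = p $ 2" "p' $ 3 = p $ 3" "p' $ 4 = p $ 4"
    using assms(2) by auto
  then show ?thesis
    using assms(1) by (auto simp: vec5_eq_iff extremal_nth straight_def sum_power2_eq_zero_iff)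
qed

text \<open>Differentiating the common curve at a single time gives equal products of
  \<open>a\<close> and \<open>a'\<close> with its position. So the frequencies agree unless the
  curve is at the origin, and rotating back recovers the initial vectors.\<close>

lemma rotation_unique:
  fixes u v u' v' :: real
  assumes lr: "l < r"
    and x: "\<And>t. t \<in> {l<..<r} \<Longrightarrow> u * cos (a * t) - v * sin (a * t) = u' * cos (a' * t) - v' * sin (a' * t)"
    and y: "\<And>t. t \<in> {l<..<r} \<Longrightarrow> u * sin (a * t) + v * cos (a * t) = u' * sin (a' * t) + v' * cos (a' * t)"
  shows "u = u' \<and> v = v' \<and> (a = a' \<or> u = 0 \<and> v = 0)"
proof -
  define t where "t = (l + r) / 2"
  have t: "t \<in> {l<..<r}"
    using lr by (auto simp: t_def)
  define X where "X = u * cos (a * t) - v * sin (a * t)"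
  define Y where "Y = u * sin (a * t) + v * cos (a * t)"
  have XY': "X = u' * cos (a' * t) - v' * sin (a' * t)" "Y = u' * sin (a' * t) + v' * cos (a' * t)"
    using x[OF t] y[OF t] by (auto simp: X_def Y_def)
  have dx: "((\<lambda>t. u * cos (a * t) - v * sin (a * t)) has_real_derivative - a * (u * sin (a * t) + v * cos (a * t))) (at t)"
    for u v a by (auto intro!: derivative_eq_intros simp: algebra_simps)
  have dy: "((\<lambda>t. u * sin (a * t) + v * cos (a * t)) has_real_derivative a * (u * cos (a * t) - v * sin (a * t))) (at t)"
    for u v a by (auto intro!: derivative_eq_intros simp: algebra_simps)
  have "((\<lambda>t. u * cos (a * t) - v * sin (a * t)) has_real_derivative - a' * Y) (at t)"
    unfolding XY' by (rule has_field_derivative_transform_within_open[OF dx, of "{l<..<r}"]) (use t x in auto)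
  then have 1: "- a * Y = - a' * Y"
    using DERIV_unique dx unfolding Y_def by blast
  have "((\<lambda>t. u * sin (a * t) + v * cos (a * t)) has_real_derivative a' * X) (at t)"
    unfolding XY' by (rule has_field_derivative_transform_within_open[OF dy, of "{l<..<r}"]) (use t y in auto)
  then have 2: "a * X = a' * X"
    using DERIV_unique dy unfolding X_def by blast
  have inverse_rotation: "u = (u * cos b - v * sin b) * cos b + (u * sin b + v * cos b) * sin b"
    "v = (u * sin b + v * cos b) * cos b - (u * cos b - v * sin b) * sin b" for u v b :: real
  proof -
    have "(u * c - v * s) * c + (u * s + v * c) * s = u * (s\<^sup>2 + c\<^sup>2)"
      "(u * s + v * c) * c - (u * c - v * s) * s = v * (s\<^sup>2 + c\<^sup>2)" for s c
      by (simp_all add: power2_eq_square algebra_simps)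
    note id = this[where s = "sin b" and c = "cos b"]
    show "u = (u * cos b - v * sin b) * cos b + (u * sin b + v * cos b) * sin b"
      "v = (u * sin b + v * cos b) * cos b - (u * cos b - v * sin b) * sin b"
      unfolding id by simp_all
  qed
  have "u = X * cos (a * t) + Y * sin (a * t)" "v = Y * cos (a * t) - X * sin (a * t)"
    unfolding X_def Y_def by (rule inverse_rotation)+
  moreover have "u' = X * cos (a' * t) + Y * sin (a' * t)" "v' = Y * cos (a' * t) - X * sin (a' * t)"
    unfolding XY' by (rule inverse_rotation)+
  ultimately have uv: "u = X * cos (a * t) + Y * sin (a * t)" "v = Y * cos (a * t) - X * sin (a * t)"
    "u' = X * cos (a' * t) + Y * sin (a' * t)" "v' = Y * cos (a' * t) - X * sin (a' * t)"
    by blast+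
  show ?thesis
  proof (cases "a = a'")
    case True
    then show ?thesis
      using uv by simp
  next
    case False
    then have "X = 0" "Y = 0"
      using 1 2 by auto
    then show ?thesis
      using uv by simp
  qed
qed

text \<open>Equal velocities are equal planar momenta, and a nonzero rotating vector reveals both
  its initial value and its frequency \<open>\<alpha> * p $ 5\<close>. A short arc thus determines
  the extremal, which is what gluing needs.\<close>

lemma extremal_unique:
  assumes lr: "l < r" and eq: "\<And>t. t \<in> {l<..<r} \<Longrightarrow> extremal \<alpha>1 \<alpha>2 p t = extremal \<alpha>1 \<alpha>2 p' t"
  shows "(\<forall>i. i \<noteq> 5 \<longrightarrow> p $ i = p' $ i) \<and> (straight \<alpha>1 \<alpha>2 p \<or> p $ 5 = p' $ 5)"
proof -
  let ?d = "\<lambda>p t. horizontal_lift \<alpha>1 \<alpha>2 (extremal \<alpha>1 \<alpha>2 p t) (momentum \<alpha>1 \<alpha>2 p t)"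
  have "?d p t = ?d p' t" if t: "t \<in> {l<..<r}" for t
  proof -
    have "(extremal \<alpha>1 \<alpha>2 p has_vector_derivative ?d p' t) (at t)"
      by (rule has_vector_derivative_transform_within_open[OF extremal_deriv, of "{l<..<r}"])
        (use t eq in auto)
    then show ?thesis
      using extremal_deriv vector_derivative_unique_at by blast
  qed
  then have m: "momentum \<alpha>1 \<alpha>2 p t $ 1 = momentum \<alpha>1 \<alpha>2 p' t $ 1 \<and> momentum \<alpha>1 \<alpha>2 p t $ 2 = momentum \<alpha>1 \<alpha>2 p' t $ 2 \<and>
     momentum \<alpha>1 \<alpha>2 p t $ 3 = momentum \<alpha>1 \<alpha>2 p' t $ 3 \<and> momentum \<alpha>1 \<alpha>2 p t $ 4 = momentum \<alpha>1 \<alpha>2 p' t $ 4"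
    if "t \<in> {l<..<r}" for t
    using that by (simp add: horizontal_lift_def vec5_eq_iff)
  have "p $ 1 = p' $ 1 \<and> p $ 2 = p' $ 2 \<and> (\<alpha>1 * p $ 5 = \<alpha>1 * p' $ 5 \<or> p $ 1 = 0 \<and> p $ 2 = 0)"
    by (rule rotation_unique[OF lr]) (use m in \<open>auto simp: momentum_def Let_def\<close>)
  moreover have "p $ 3 = p' $ 3 \<and> p $ 4 = p' $ 4 \<and> (\<alpha>2 * p $ 5 = \<alpha>2 * p' $ 5 \<or> p $ 3 = 0 \<and> p $ 4 = 0)"
    by (rule rotation_unique[OF lr]) (use m in \<open>auto simp: momentum_def Let_def\<close>)
  ultimately show ?thesis
    using exhaust_5 by (auto simp: straight_def) metis+
qed

subsection \<open>Every point is reached by a short extremal\<close>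

text \<open>For a plane extremal at time 1, twice the swept area divided by the squared distance
  from the origin. It depends on \<open>k\<close> alone, so it expresses the height through the end
  point.\<close>

definition area_ratio :: "real \<Rightarrow> real" where
  "area_ratio k = sn_area k 1 / (sn k 1)\<^sup>2"

lemma sn_pos: "0 \<le> k \<Longrightarrow> k < pi \<Longrightarrow> 0 < sn k 1"
  using sin_gt_zero[of k] by (auto simp: sn_def)

lemma area_ratio_0 [simp]: "area_ratio 0 = 0"
  by (simp add: area_ratio_def sn_area_def)

lemma area_ratio_eq:
  assumes "k \<noteq> 0"
  shows "area_ratio k = (k - sin k * cos k) / (2 * (sin k)\<^sup>2)"
proof (cases "sin k = 0")
  case True
  then show ?thesis
    using assms by (simp add: area_ratio_def sn_def)
next
  case False
  then show ?thesis
    using assms by (simp add: area_ratio_def sn_area_def sn_def divide_simps power2_eq_square)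
qed

lemma area_ratio_nonneg: 
  assumes "0 \<le> k"
  shows "0 \<le> area_ratio k"
proof (cases "k = 0")
  case False
  have "sin k * cos k \<le> k"
    using sin_x_le_x[of "2 * k"] assms sin_double[of k] by simp
  then show ?thesis
    using False by (simp add: area_ratio_eq)
qed simp

text \<open>The only delicate point is \<open>k = 0\<close>, where the closed formula has the form
  0/0; its limit there is the value 0 from the definition.\<close>

lemma continuous_on_area_ratio:
  assumes "b < pi"
  shows "continuous_on {0..b} area_ratio"
  unfolding continuous_on_eq_continuous_within
proof
  fix k assume k: "k \<in> {0..b}"
  show "continuous (at k within {0..b}) area_ratio"
  proof (cases "k = 0")
    case True
    show ?thesis
    proof (cases "0 < b")
      case b: True
      have "((\<lambda>k. (k - sin k * cos k) / (2 * (sin k)\<^sup>2)) \<longlongrightarrow> 0) (at_right (0::real))"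
        by real_asymp
      moreover have "\<forall>\<^sub>F k in at_right 0. (k - sin k * cos k) / (2 * (sin k)\<^sup>2) = area_ratio k"
        using eventually_at_right_less by (rule eventually_mono) (simp add: area_ratio_eq)
      ultimately have "(area_ratio \<longlongrightarrow> 0) (at_right 0)"
        by (rule Lim_transform_eventually)
      then show ?thesis
        using b True at_within_Icc_at_right[OF b] by (simp add: continuous_within)
    next
      case False
      then have "{0..b} = {k}"
        using True k by auto
      show ?thesis
        unfolding \<open>{0..b} = {k}\<close> using continuous_on_sing[of k area_ratio]
        by (simp add: continuous_on_eq_continuous_within)
    qed
  next
    case False
    then have k0: "0 < k" "k < pi"
      using k assms by auto
    then have "isCont (\<lambda>k. (k - sin k * cos k) / (2 * (sin k)\<^sup>2)) k"
      using sin_gt_zero[of k] by (intro continuous_intros) auto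
    moreover have "\<forall>\<^sub>F x in nhds k. area_ratio x = (x - sin x * cos x) / (2 * (sin x)\<^sup>2)"
      using eventually_nhds_in_open[of "{0<..}" k] k0 by (auto elim!: eventually_mono simp: area_ratio_eq)
    ultimately have "isCont area_ratio k"
      by (simp add: isCont_cong)
    then show ?thesis
      by (rule continuous_at_imp_continuous_at_within)
  qed
qed

lemma area_ratio_unbounded: "\<exists>k. 0 < k \<and> k < pi \<and> C \<le> area_ratio k"
proof -
  have "filterlim (\<lambda>k. (k - sin k * cos k) / (2 * (sin k)\<^sup>2)) at_top (at_left pi)"
    by real_asymp
  then have "\<forall>\<^sub>F k in at_left pi. C \<le> (k - sin k * cos k) / (2 * (sin k)\<^sup>2)"
    by (simp add: filterlim_at_top)
  moreover have "\<forall>\<^sub>F k in at_left pi. k \<in> {0<..<pi}"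
    using eventually_at_left_real[of 0 pi] by simp
  ultimately have "\<forall>\<^sub>F k in at_left pi. 0 < k \<and> k < pi \<and> C \<le> area_ratio k"
    by eventually_elim (auto simp: area_ratio_eq)
  then show ?thesis
    using eventually_happens' trivial_limit_at_left_real by blast
qed

text \<open>The end point is the initial velocity rotated by \<open>k\<close> and scaled by
  \<open>sn k 1\<close>, hence the velocity can be recovered as long as that factor is
  nonzero.\<close>

lemma plane_solve:
  assumes "sn k 1 \<noteq> 0"
  obtains u v where "sn k 1 * (u * cos k - v * sin k) = x" "sn k 1 * (u * sin k + v * cos k) = y"
    "(u\<^sup>2 + v\<^sup>2) * sn_area k 1 = (x\<^sup>2 + y\<^sup>2) * area_ratio k"
proof -
  have cs: "cos k * cos k = 1 - sin k * sin k"
    using sin_cos_squared_add[of k] by (simp add: power2_eq_square)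
  define u where "u = (x * cos k + y * sin k) / sn k 1"
  define v where "v = (y * cos k - x * sin k) / sn k 1"
  have snuv: "sn k 1 * u = x * cos k + y * sin k" "sn k 1 * v = y * cos k - x * sin k"
    using assms by (auto simp: u_def v_def)
  have 1: "sn k 1 * (u * cos k - v * sin k) = x"
  proof -
    have "sn k 1 * (u * cos k - v * sin k) = (sn k 1 * u) * cos k - (sn k 1 * v) * sin k"
      by (simp add: algebra_simps)
    also have "\<dots> = x * (cos k * cos k + sin k * sin k)"
      unfolding snuv by (simp only: algebra_simps)
    finally show ?thesis
      by (simp add: cs)
  qed
  have 2: "sn k 1 * (u * sin k + v * cos k) = y"
  proof -
    have "sn k 1 * (u * sin k + v * cos k) = (sn k 1 * u) * sin k + (sn k 1 * v) * cos k"
      by (simp add: algebra_simps)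
    also have "\<dots> = y * (cos k * cos k + sin k * sin k)"
      unfolding snuv by (simp only: algebra_simps)
    finally show ?thesis
      by (simp add: cs)
  qed
  have "x\<^sup>2 + y\<^sup>2 = (sn k 1)\<^sup>2 * (u\<^sup>2 + v\<^sup>2)"
    using rotation_squares[of u k v] unfolding 1[symmetric] 2[symmetric] power_mult_distrib
    by (simp flip: distrib_left)
  then have "(u\<^sup>2 + v\<^sup>2) * sn_area k 1 = (x\<^sup>2 + y\<^sup>2) * area_ratio k"
    using assms by (simp add: area_ratio_def)
  with 1 2 show thesis
    by (rule that)
qed

lemma extremal_swap:
  "extremal \<alpha>2 \<alpha>1 (vector [p $ 3, p $ 4, p $ 1, p $ 2, p $ 5]) t =
    vector [extremal \<alpha>1 \<alpha>2 p t $ 3, extremal \<alpha>1 \<alpha>2 p t $ 4, extremal \<alpha>1 \<alpha>2 p t $ 1, extremal \<alpha>1 \<alpha>2 p t $ 2,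
      extremal \<alpha>1 \<alpha>2 p t $ 5]"
  by (simp add: vec5_eq_iff extremal_nth)

lemma sn_minus: "sn (- k) t = sn k t" "sn_area (- k) t = - sn_area k t"
proof -
  show "sn (- k) t = sn k t"
    by (simp add: sn_def)
  then show "sn_area (- k) t = - sn_area k t"
    unfolding sn_area_def by (simp add: minus_divide_right[symmetric])
qed

lemma extremal_reflect:
  "extremal \<alpha>1 \<alpha>2 (vector [p $ 1, - (p $ 2), p $ 3, - (p $ 4), - (p $ 5)]) t =
    vector [extremal \<alpha>1 \<alpha>2 p t $ 1, - (extremal \<alpha>1 \<alpha>2 p t $ 2), extremal \<alpha>1 \<alpha>2 p t $ 3,
      - (extremal \<alpha>1 \<alpha>2 p t $ 4), - (extremal \<alpha>1 \<alpha>2 p t $ 5)]"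
  by (simp add: vec5_eq_iff extremal_nth sn_minus algebra_simps)

text \<open>Below the critical multiplier the planar components of \<open>q\<close> fix the initial
  velocity, and one equation \<open>h1 w + h2 w = q $ 5\<close> is left for the intermediate value
  theorem. If \<open>q\<close> vanishes in every plane of maximal \<open>\<alpha>\<close>, the
  height reachable in this way can be bounded; what is missing is then supplied by a full circle in
  the first plane.\<close>

lemma extremal_unit_surj_aux:
  assumes \<alpha>: "0 \<le> \<alpha>2" "\<alpha>2 \<le> \<alpha>1" "0 < \<alpha>1" and z: "0 \<le> q $ 5"
  shows "\<exists>p. extremal \<alpha>1 \<alpha>2 p 1 = q \<and> 0 \<le> p $ 5 \<and> \<alpha>1 * p $ 5 \<le> 2 * pi"
proof -
  define r1 where "r1 = (q $ 1)\<^sup>2 + (q $ 2)\<^sup>2"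
  define r2 where "r2 = (q $ 3)\<^sup>2 + (q $ 4)\<^sup>2"
  define h1 where "h1 w = \<alpha>1 / 2 * r1 * area_ratio (\<alpha>1 * w / 2)" for w
  define h2 where "h2 w = \<alpha>2 / 2 * r2 * area_ratio (\<alpha>2 * w / 2)" for w
  have r: "0 \<le> r1" "0 \<le> r2"
    by (auto simp: r1_def r2_def)
  have h_nonneg: "0 \<le> h1 w" "0 \<le> h2 w" if "0 \<le> w" for w
    using that \<alpha> r by (auto simp: h1_def h2_def intro!: mult_nonneg_nonneg area_ratio_nonneg)
  have "continuous_on {0..b} h1" if "\<alpha>1 * b / 2 < pi" for b
    unfolding h1_def
    by (intro continuous_intros continuous_on_compose2[OF continuous_on_area_ratio[OF that]])
      (use \<alpha> in \<open>auto intro: mult_left_mono\<close>)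
  note h1_cont = this
  have h2_cont: "continuous_on {0..b} h2" if "\<alpha>2 * b / 2 < pi" for b
    unfolding h2_def
    by (intro continuous_intros continuous_on_compose2[OF continuous_on_area_ratio[OF that]])
      (use \<alpha> in \<open>auto intro: mult_left_mono\<close>)
  have two: "\<alpha>2 * w / 2 \<le> \<alpha>1 * w / 2" if "0 \<le> w" for w
    using that \<alpha> by (simp add: mult_right_mono)
  define w0 where "w0 = 2 * pi / \<alpha>1"
  have w0: "\<alpha>1 * w0 / 2 = pi" "0 < w0" "\<alpha>1 * w0 = 2 * pi"
    using \<alpha> by (auto simp: w0_def)
  have sn2: "sn (\<alpha>2 * w / 2) 1 \<noteq> 0" if "0 \<le> w" "\<alpha>2 * w / 2 < pi" for w
    using sn_pos[of "\<alpha>2 * w / 2"] that \<alpha> by auto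
  show ?thesis
  proof (cases "0 < r1 \<or> \<alpha>2 = \<alpha>1 \<and> 0 < r2")
    case True
    \<comment> \<open>The squared distance in a plane of maximal \<open>\<alpha>\<close> where
      \<open>q\<close> does not vanish. The area ratio of that plane is unbounded below the critical
      angle, so every height is exceeded.\<close>
    define \<rho> where "\<rho> = (if 0 < r1 then r1 else r2)"
    have \<rho>: "0 < \<rho>"
      using True by (auto simp: \<rho>_def)
    obtain k where k: "0 < k" "k < pi" "2 * q $ 5 / (\<alpha>1 * \<rho>) \<le> area_ratio k"
      using area_ratio_unbounded by blast
    define b where "b = 2 * k / \<alpha>1"
    have b: "\<alpha>1 * b / 2 = k" "0 \<le> b"
      using \<alpha> k by (auto simp: b_def)
    have "q $ 5 \<le> \<alpha>1 / 2 * \<rho> * area_ratio k"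
      using k(3) \<alpha> \<rho> by (simp add: field_simps)
    also have "\<dots> \<le> h1 b + h2 b"
      using h_nonneg[OF b(2)] b(1) True by (auto simp: \<rho>_def h1_def h2_def)
    finally have "q $ 5 \<le> h1 b + h2 b" .
    moreover have "h1 0 + h2 0 \<le> q $ 5"
      using z by (simp add: h1_def h2_def)
    moreover have "continuous_on {0..b} (\<lambda>w. h1 w + h2 w)"
      using b two[of b] k(2) by (intro continuous_intros h1_cont h2_cont) auto
    ultimately obtain w where w: "0 \<le> w" "w \<le> b" "h1 w + h2 w = q $ 5"
      using IVT'[of "\<lambda>w. h1 w + h2 w" 0 "q $ 5" b] b(2) by blast
    have kw: "\<alpha>1 * w / 2 < pi"
    proof -
      have "\<alpha>1 * w \<le> \<alpha>1 * b"
        using w(2) \<alpha> by (intro mult_left_mono) auto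
      then show ?thesis
        using b(1) k(2) by linarith
    qed
    then have kw2: "\<alpha>2 * w / 2 < pi"
      using two[OF w(1)] by auto
    have "sn (\<alpha>1 * w / 2) 1 \<noteq> 0"
      using sn_pos[of "\<alpha>1 * w / 2"] kw w \<alpha> by auto
    from plane_solve[OF this, of "q $ 1" "q $ 2"] obtain u v where uv:
      "sn (\<alpha>1 * w / 2) 1 * (u * cos (\<alpha>1 * w / 2) - v * sin (\<alpha>1 * w / 2)) = q $ 1"
      "sn (\<alpha>1 * w / 2) 1 * (u * sin (\<alpha>1 * w / 2) + v * cos (\<alpha>1 * w / 2)) = q $ 2"
      "(u\<^sup>2 + v\<^sup>2) * sn_area (\<alpha>1 * w / 2) 1 = r1 * area_ratio (\<alpha>1 * w / 2)"
      unfolding r1_def by blast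
    from plane_solve[OF sn2[OF w(1) kw2], of "q $ 3" "q $ 4"] obtain u' v' where uv':
      "sn (\<alpha>2 * w / 2) 1 * (u' * cos (\<alpha>2 * w / 2) - v' * sin (\<alpha>2 * w / 2)) = q $ 3"
      "sn (\<alpha>2 * w / 2) 1 * (u' * sin (\<alpha>2 * w / 2) + v' * cos (\<alpha>2 * w / 2)) = q $ 4"
      "(u'\<^sup>2 + v'\<^sup>2) * sn_area (\<alpha>2 * w / 2) 1 = r2 * area_ratio (\<alpha>2 * w / 2)"
      unfolding r2_def by blast
    have "extremal \<alpha>1 \<alpha>2 (vector [u, v, u', v', w]) 1 = q"
      using uv uv' w(3) by (simp add: vec5_eq_iff extremal_nth h1_def h2_def mult.assoc)
    then show ?thesis
      using w(1) kw by (intro exI[of _ "vector [u, v, u', v', w]"]) auto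
  next
    case False
    then have r1: "r1 = 0" and r2: "\<alpha>2 = \<alpha>1 \<Longrightarrow> r2 = 0"
      using r by auto
    then have q12: "q $ 1 = 0" "q $ 2 = 0"
      by (auto simp: r1_def sum_power2_eq_zero_iff)
    show ?thesis
    proof (cases "\<alpha>2 < \<alpha>1 \<and> q $ 5 \<le> h2 w0")
      case True
      have k2: "\<alpha>2 * w0 / 2 < pi"
        using True w0 by (smt (verit) mult_strict_right_mono divide_strict_right_mono)
      have "h2 0 \<le> q $ 5"
        using z by (simp add: h2_def)
      then obtain w where w: "0 \<le> w" "w \<le> w0" "h2 w = q $ 5"
        using IVT'[of h2 0 "q $ 5" w0] h2_cont[OF k2] True w0 by auto
      have kw2: "\<alpha>2 * w / 2 < pi"
        using mult_left_mono[OF w(2) \<alpha>(1)] k2 by linarith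
      from plane_solve[OF sn2[OF w(1) kw2], of "q $ 3" "q $ 4"] obtain u' v' where uv':
        "sn (\<alpha>2 * w / 2) 1 * (u' * cos (\<alpha>2 * w / 2) - v' * sin (\<alpha>2 * w / 2)) = q $ 3"
        "sn (\<alpha>2 * w / 2) 1 * (u' * sin (\<alpha>2 * w / 2) + v' * cos (\<alpha>2 * w / 2)) = q $ 4"
        "(u'\<^sup>2 + v'\<^sup>2) * sn_area (\<alpha>2 * w / 2) 1 = r2 * area_ratio (\<alpha>2 * w / 2)"
        unfolding r2_def by blast
      have "extremal \<alpha>1 \<alpha>2 (vector [0, 0, u', v', w]) 1 = q"
        using uv' w(3) q12 by (simp add: vec5_eq_iff extremal_nth h2_def mult.assoc)
      moreover have "\<alpha>1 * w \<le> 2 * pi"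
        using mult_left_mono[OF w(2), of \<alpha>1] w0(3) \<alpha> by linarith
      ultimately show ?thesis
        using w(1) by (intro exI[of _ "vector [0, 0, u', v', w]"]) auto
    next
      case F: False
      \<comment> \<open>At the critical multiplier \<open>w0\<close> the second plane is solved
        first. The height it uses up is at most \<open>q $ 5\<close>, so the remainder
        \<open>c\<close> can be left to the first plane.\<close>
      have "\<exists>u' v'. sn (\<alpha>2 * w0 / 2) 1 * (u' * cos (\<alpha>2 * w0 / 2) - v' * sin (\<alpha>2 * w0 / 2)) = q $ 3 \<and>
          sn (\<alpha>2 * w0 / 2) 1 * (u' * sin (\<alpha>2 * w0 / 2) + v' * cos (\<alpha>2 * w0 / 2)) = q $ 4 \<and>
          \<alpha>2 / 2 * (u'\<^sup>2 + v'\<^sup>2) * sn_area (\<alpha>2 * w0 / 2) 1 \<le> q $ 5"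
      proof (cases "\<alpha>2 = \<alpha>1")
        case True
        then have "q $ 3 = 0" "q $ 4 = 0"
          using r2 by (auto simp: r2_def sum_power2_eq_zero_iff)
        then show ?thesis
          using z by (intro exI[of _ 0]) simp
      next
        case False
        then have lt: "\<alpha>2 < \<alpha>1"
          using \<alpha> by auto
        have k2: "\<alpha>2 * w0 / 2 < pi"
          using lt w0 by (smt (verit) mult_strict_right_mono divide_strict_right_mono)
        from plane_solve[OF sn2[OF less_imp_le[OF w0(2)] k2], of "q $ 3" "q $ 4"] obtain u' v' where uv':
          "sn (\<alpha>2 * w0 / 2) 1 * (u' * cos (\<alpha>2 * w0 / 2) - v' * sin (\<alpha>2 * w0 / 2)) = q $ 3"
          "sn (\<alpha>2 * w0 / 2) 1 * (u' * sin (\<alpha>2 * w0 / 2) + v' * cos (\<alpha>2 * w0 / 2)) = q $ 4"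
          "(u'\<^sup>2 + v'\<^sup>2) * sn_area (\<alpha>2 * w0 / 2) 1 = r2 * area_ratio (\<alpha>2 * w0 / 2)"
          unfolding r2_def by blast
        have "\<alpha>2 / 2 * (u'\<^sup>2 + v'\<^sup>2) * sn_area (\<alpha>2 * w0 / 2) 1 = h2 w0"
          using uv'(3) by (simp add: h2_def mult.assoc)
        then show ?thesis
          using uv'(1,2) F lt by (intro exI[of _ u'] exI[of _ v']) auto
      qed
      then obtain u' v' where uv': "sn (\<alpha>2 * w0 / 2) 1 * (u' * cos (\<alpha>2 * w0 / 2) - v' * sin (\<alpha>2 * w0 / 2)) = q $ 3"
          "sn (\<alpha>2 * w0 / 2) 1 * (u' * sin (\<alpha>2 * w0 / 2) + v' * cos (\<alpha>2 * w0 / 2)) = q $ 4"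
          "\<alpha>2 / 2 * (u'\<^sup>2 + v'\<^sup>2) * sn_area (\<alpha>2 * w0 / 2) 1 \<le> q $ 5"
        by blast
      define c where "c = q $ 5 - \<alpha>2 / 2 * (u'\<^sup>2 + v'\<^sup>2) * sn_area (\<alpha>2 * w0 / 2) 1"
      have c: "0 \<le> c"
        using uv'(3) by (simp add: c_def)
      \<comment> \<open>A circle closing at time 1 has \<open>sn_area pi 1 = 1 / (2 * pi)\<close>,
        so initial speed \<open>u\<close> contributes the height
        \<open>\<alpha>1 * u^2 / (4 * pi)\<close>, which is to equal \<open>c\<close>.\<close>
      define u where "u = sqrt (4 * pi * c / \<alpha>1)"
      have "u\<^sup>2 = 4 * pi * c / \<alpha>1"
        using c \<alpha> by (simp add: u_def)
      moreover have pi: "sn pi 1 = 0" "sn_area pi 1 = 1 / (2 * pi)"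
        by (auto simp: sn_def sn_area_def)
      ultimately have "\<alpha>1 / 2 * u\<^sup>2 * sn_area pi 1 = c"
        using \<alpha> by (simp add: field_simps)
      then have "extremal \<alpha>1 \<alpha>2 (vector [u, 0, u', v', w0]) 1 = q"
        using uv' q12 pi by (simp add: vec5_eq_iff extremal_nth w0 c_def)
      then show ?thesis
        using w0 by (intro exI[of _ "vector [u, 0, u', v', w0]"]) auto
    qed
  qed
qed

text \<open>Two symmetries reduce the general case to ordered parameters and nonnegative height:
  reflection of \<open>y1\<close>, \<open>y2\<close> and \<open>z\<close> together with the
  multiplier, and exchange of the two planes.\<close>

lemma extremal_unit_surj:
  assumes \<alpha>: "0 \<le> \<alpha>1" "0 \<le> \<alpha>2" "\<alpha>1 \<noteq> 0 \<or> \<alpha>2 \<noteq> 0"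
  shows "\<exists>p. extremal \<alpha>1 \<alpha>2 p 1 = q \<and> max \<alpha>1 \<alpha>2 * \<bar>p $ 5\<bar> \<le> 2 * pi"
proof -
  have ordered: "\<exists>p. extremal \<alpha>1 \<alpha>2 p 1 = q \<and> \<alpha>1 * \<bar>p $ 5\<bar> \<le> 2 * pi"
    if \<alpha>: "0 \<le> \<alpha>2" "\<alpha>2 \<le> \<alpha>1" "0 < \<alpha>1" for \<alpha>1 \<alpha>2 q
  proof (cases "0 \<le> q $ 5")
    case True
    then show ?thesis
      using extremal_unit_surj_aux[OF \<alpha>] by (metis abs_of_nonneg)
  next
    case False
    let ?q = "vector [q $ 1, - (q $ 2), q $ 3, - (q $ 4), - (q $ 5)] :: real^5"
    obtain p where p: "extremal \<alpha>1 \<alpha>2 p 1 = ?q" "0 \<le> p $ 5" "\<alpha>1 * p $ 5 \<le> 2 * pi"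
      using extremal_unit_surj_aux[OF \<alpha>, of ?q] False by auto
    have "extremal \<alpha>1 \<alpha>2 (vector [p $ 1, - (p $ 2), p $ 3, - (p $ 4), - (p $ 5)]) 1 = q"
      unfolding extremal_reflect p(1) by (simp add: vec5_eq_iff)
    then show ?thesis
      using p by (metis vector_5(5) abs_minus_cancel abs_of_nonneg)
  qed
  show ?thesis
  proof (cases "\<alpha>2 \<le> \<alpha>1")
    case True
    then show ?thesis
      using ordered[of \<alpha>2 \<alpha>1 q] \<alpha> by (auto simp: max_absorb1)
  next
    case False
    let ?q = "vector [q $ 3, q $ 4, q $ 1, q $ 2, q $ 5] :: real^5"
    obtain p where p: "extremal \<alpha>2 \<alpha>1 p 1 = ?q" "\<alpha>2 * \<bar>p $ 5\<bar> \<le> 2 * pi"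
      using ordered[of \<alpha>1 \<alpha>2 ?q] \<alpha> False by auto
    have "extremal \<alpha>1 \<alpha>2 (vector [p $ 3, p $ 4, p $ 1, p $ 2, p $ 5]) 1 = q"
      unfolding extremal_swap[of \<alpha>1 \<alpha>2 p 1] p(1) by (simp add: vec5_eq_iff)
    then show ?thesis
      using p(2) False by (intro exI[of _ "vector [p $ 3, p $ 4, p $ 1, p $ 2, p $ 5]"]) auto
  qed
qed

section \<open>Geodesics and cut times\<close>

locale bi_heisenberg_params =
  fixes \<alpha>1 \<alpha>2 :: real
  assumes \<alpha>1_nonneg: "0 \<le> \<alpha>1" and \<alpha>2_nonneg: "0 \<le> \<alpha>2" and \<alpha>_nonzero: "\<alpha>1 \<noteq> 0 \<or> \<alpha>2 \<noteq> 0"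
begin

abbreviation "F \<equiv> bi_heisenberg \<alpha>1 \<alpha>2"
abbreviation "extr \<equiv> extremal \<alpha>1 \<alpha>2"
abbreviation "ltrans \<equiv> translate \<alpha>1 \<alpha>2"
abbreviation "m \<equiv> max \<alpha>1 \<alpha>2"

lemma m_pos: "0 < m"
  using \<alpha>1_nonneg \<alpha>2_nonneg \<alpha>_nonzero by (auto simp: max_def)

lemma short:
  assumes "m * \<bar>w\<bar> * S \<le> 2 * pi" "0 \<le> S"
  shows "\<bar>\<alpha>1 * w / 2\<bar> * S \<le> pi" "\<bar>\<alpha>2 * w / 2\<bar> * S \<le> pi"
proof -
  have "\<alpha> * (\<bar>w\<bar> * S) \<le> m * (\<bar>w\<bar> * S)" if "\<alpha> \<le> m" for \<alpha>
    using that assms(2) by (intro mult_right_mono) auto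
  from this[of \<alpha>1] this[of \<alpha>2] show "\<bar>\<alpha>1 * w / 2\<bar> * S \<le> pi" "\<bar>\<alpha>2 * w / 2\<bar> * S \<le> pi"
    using assms \<alpha>1_nonneg \<alpha>2_nonneg by (auto simp: abs_mult mult.assoc)
qed

lemma short_subinterval:
  assumes "m * \<bar>w\<bar> * S \<le> 2 * pi" "S' \<le> S"
  shows "m * \<bar>w\<bar> * S' \<le> 2 * pi"
proof -
  have "m * \<bar>w\<bar> * S' \<le> m * \<bar>w\<bar> * S"
    using assms m_pos by (intro mult_left_mono) auto
  then show ?thesis
    using assms by linarith
qed

lemma extremal_surj:
  assumes "0 < S"
  shows "\<exists>p. extr p S = q \<and> m * \<bar>p $ 5\<bar> * S \<le> 2 * pi"
proof -
  obtain p where p: "extr p 1 = q" "m * \<bar>p $ 5\<bar> \<le> 2 * pi"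
    using extremal_unit_surj[OF \<alpha>1_nonneg \<alpha>2_nonneg \<alpha>_nonzero] by blast
  have "extr ((1 / S) *\<^sub>R p) S = q"
    using assms p by (simp add: extremal_scale)
  moreover have "m * \<bar>((1 / S) *\<^sub>R p) $ 5\<bar> * S \<le> 2 * pi"
    using assms p by (simp add: abs_mult)
  ultimately show ?thesis
    by blast
qed

lemma sr_dist_short:
  assumes "0 \<le> S" "m * \<bar>p $ 5\<bar> * S \<le> 2 * pi"
  shows "sr_dist F 0 (extr p S) = hnorm p * S"
  using sr_dist_extremal[of S \<alpha>1 p \<alpha>2 0] short[OF assms(2,1)] assms(1) by simp

lemma minimizer_extremal:
  assumes "length_minimizer F a b \<gamma>" "a < b" "AE t in lebesgue_on {a..b}. sr_speed F \<gamma> t = 1"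
  obtains p where "hnorm p = 1" "m * \<bar>p $ 5\<bar> * (b - a) \<le> 2 * pi"
    "\<And>t. t \<in> {a..b} \<Longrightarrow> \<gamma> t = ltrans (\<gamma> a) (extr p (t - a))"
proof -
  obtain p where p: "extr p (b - a) = ltrans (- \<gamma> a) (\<gamma> b)" "m * \<bar>p $ 5\<bar> * (b - a) \<le> 2 * pi"
    using extremal_surj[of "b - a"] assms(2) by auto
  have "\<gamma> b = ltrans (\<gamma> a) (extr p (b - a))"
    by (simp add: p(1))
  moreover have "0 \<le> b - a"
    using assms(2) by simp
  ultimately obtain p' where p': "p' $ 5 = p $ 5" "hnorm p' = 1"
    "\<forall>t\<in>{a..b}. \<gamma> t = ltrans (\<gamma> a) (extr p' (t - a))"
    using minimizer_imp_extremal[OF assms _ short[OF p(2)]] by blast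
  show thesis
  proof (rule that)
    show "m * \<bar>p' $ 5\<bar> * (b - a) \<le> 2 * pi"
      using p(2) by (simp only: p'(1))
  qed (use p'(2,3) in blast)+
qed

lemma arclength_geodesic_speed:
  assumes "arclength_geodesic F q0 \<gamma>" "0 \<le> a"
  shows "AE t in lebesgue_on {a..b}. sr_speed F \<gamma> t = 1"
proof -
  have "AE t in lebesgue_on {0..}. sr_speed F \<gamma> t = 1"
    using assms(1) by (simp add: arclength_geodesic_def)
  then obtain N where "negligible N" "\<forall>t\<in>{0..} - N. sr_speed F \<gamma> t = 1"
    by (subst (asm) AE_lebesgue_on_iff) auto
  then show ?thesis
    using assms(2) by (subst AE_lebesgue_on_iff) auto
qed

lemma extremal_arclength_geodesic:
  assumes "hnorm p = 1"
  shows "arclength_geodesic F 0 (extr p)"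
proof -
  have speed: "sr_speed F (extr p) t = 1" for t
    using sr_speed_extremal[of \<alpha>1 \<alpha>2 0 p 0 t] assms by simp
  have "\<exists>\<epsilon>>0. length_minimizer F (max 0 (t - \<epsilon>)) (t + \<epsilon>) (extr p)" if "0 \<le> t" for t
  proof -
    \<comment> \<open>Chosen so that an interval of length \<open>2 * \<epsilon>\<close> satisfies
      the bound \<open>2 * pi\<close>; adding 1 covers \<open>p $ 5 = 0\<close>.\<close>
    define \<epsilon> where "\<epsilon> = pi / (m * (\<bar>p $ 5\<bar> + 1))"
    have \<epsilon>: "0 < \<epsilon>"
      using m_pos by (simp add: \<epsilon>_def add_nonneg_pos)
    have "m * (\<bar>p $ 5\<bar> + 1) * \<epsilon> = pi"
      using m_pos by (simp add: \<epsilon>_def add_nonneg_eq_0_iff)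
    moreover have "m * \<bar>p $ 5\<bar> * (2 * \<epsilon>) \<le> 2 * (m * (\<bar>p $ 5\<bar> + 1) * \<epsilon>)"
      using m_pos \<epsilon> by (simp add: algebra_simps)
    ultimately have 1: "m * \<bar>p $ 5\<bar> * (2 * \<epsilon>) \<le> 2 * pi"
      by simp
    define a where "a = max 0 (t - \<epsilon>)"
    have a: "a < t + \<epsilon>" "t + \<epsilon> - a \<le> 2 * \<epsilon>"
      using that \<epsilon> by (auto simp: a_def)
    have "length_minimizer F a (t + \<epsilon>) (extr p)"
    proof (rule extremal_minimizer[OF a(1)])
      show "extr p s = ltrans (extr p a) (extr (momentum \<alpha>1 \<alpha>2 p a) (s - a))" for s
        using extremal_add[of \<alpha>1 \<alpha>2 p a "s - a"] by simp
      have "m * \<bar>p $ 5\<bar> * (t + \<epsilon> - a) \<le> 2 * pi"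
        by (rule short_subinterval[OF 1 a(2)])
      from short[OF this] a(1)
      show "\<bar>\<alpha>1 * momentum \<alpha>1 \<alpha>2 p a $ 5 / 2\<bar> * (t + \<epsilon> - a) \<le> pi"
        "\<bar>\<alpha>2 * momentum \<alpha>1 \<alpha>2 p a $ 5 / 2\<bar> * (t + \<epsilon> - a) \<le> pi"
        by simp_all
    qed (use assms in simp)
    then show ?thesis
      using \<epsilon> by (auto simp: a_def)
  qed
  moreover have "horizontal F 0 T (extr p)" for T
    using horizontal_extremal[of \<alpha>1 \<alpha>2 0 T 0 p 0] by simp
  ultimately show ?thesis
    unfolding arclength_geodesic_def geodesic_def by (auto simp: speed)
qed

lemma extremal_short_minimizer:
  assumes "0 < s" "hnorm p = 1" "m * \<bar>p $ 5\<bar> * s \<le> 2 * pi" "\<And>t. t \<in> {0..s} \<Longrightarrow> \<gamma> t = extr p t"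
  shows "length_minimizer F 0 s \<gamma>"
  by (rule extremal_minimizer[where q = 0 and p = p]) (use assms short[OF assms(3)] in auto)

text \<open>A minimizer is some short extremal \<open>p'\<close>. Since \<open>p\<close> is not
  straight, the common arc forces the same multiplier, and the bound for \<open>p'\<close> is one
  for \<open>p\<close>.\<close>

lemma minimizer_imp_short:
  assumes \<gamma>: "arclength_geodesic F 0 \<gamma>" and eq: "\<And>t. t \<in> {0..s} \<Longrightarrow> \<gamma> t = extr p t"
    and ns: "\<not> straight \<alpha>1 \<alpha>2 p" and s: "0 < s" and min: "length_minimizer F 0 s \<gamma>"
  shows "m * \<bar>p $ 5\<bar> * s \<le> 2 * pi"
proof -
  obtain p' where p': "m * \<bar>p' $ 5\<bar> * s \<le> 2 * pi" "\<And>t. t \<in> {0..s} \<Longrightarrow> \<gamma> t = ltrans (\<gamma> 0) (extr p' t)"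
    using minimizer_extremal[OF min s arclength_geodesic_speed[OF \<gamma>]] by auto
  have "\<gamma> 0 = 0"
    using \<gamma> by (simp add: arclength_geodesic_def)
  then have "extr p t = extr p' t" if "t \<in> {0<..<s}" for t
    using p'(2)[of t] eq[of t] that by auto
  from extremal_unique[OF s this] ns have "p $ 5 = p' $ 5"
    by blast
  then show ?thesis
    using p'(1) by simp
qed

section \<open>Cut times and the cut locus\<close>

lemma cut_time_extremal:
  assumes p: "hnorm p = 1" and ns: "\<not> straight \<alpha>1 \<alpha>2 p" and T: "0 < T" and mT: "m * \<bar>p $ 5\<bar> * T = 2 * pi"
  shows "cut_time F (extr p) = ereal T"
proof -
  have "0 < t \<and> length_minimizer F 0 t (extr p) \<longleftrightarrow> 0 < t \<and> t \<le> T" for t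
  proof safe
    assume t: "0 < t" "length_minimizer F 0 t (extr p)"
    have "m * \<bar>p $ 5\<bar> * t \<le> m * \<bar>p $ 5\<bar> * T"
      using minimizer_imp_short[OF extremal_arclength_geodesic[OF p] _ ns t] mT by simp
    moreover have "0 < m * \<bar>p $ 5\<bar>"
      using mT T m_pos by (metis abs_ge_zero less_eq_real_def mult_zero_left mult_zero_right pi_gt_zero
          zero_less_mult_iff less_irrefl zero_less_numeral)
    ultimately show "t \<le> T"
      by (simp only: mult_le_cancel_left_pos)
  next
    assume t: "0 < t" "t \<le> T"
    have "m * \<bar>p $ 5\<bar> * t \<le> 2 * pi"
      by (rule short_subinterval[OF _ t(2)]) (simp only: mT)
    from extremal_short_minimizer[OF t(1) p this, of "extr p"]
    show "length_minimizer F 0 t (extr p)"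
      by blast
  qed
  then have "cut_time F (extr p) = Sup (ereal ` {t. 0 < t \<and> t \<le> T})"
    unfolding cut_time_def by simp
  also have "\<dots> = ereal T"
    using T by (intro antisym Sup_least Sup_upper) auto
  finally show ?thesis .
qed

text \<open>One extremal describes \<open>\<gamma>\<close> up to some \<open>t'\<close> close to the
  cut time \<open>T\<close>, another a neighbourhood of \<open>T\<close>. The arcs overlap after
  \<open>c\<close>, where uniqueness identifies them, so a single extremal describes
  \<open>\<gamma>\<close> beyond \<open>T\<close>. Its minimality is governed by the angle bound,
  which must become sharp at \<open>T\<close>.\<close>

lemma cut_time_finite:
  assumes \<gamma>: "arclength_geodesic F 0 \<gamma>" and fin: "cut_time F \<gamma> < \<infinity>"
  obtains T p where "cut_time F \<gamma> = ereal T" "0 < T" "hnorm p = 1" "\<not> straight \<alpha>1 \<alpha>2 p"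
    "m * \<bar>p $ 5\<bar> * T = 2 * pi" "\<And>t. t \<in> {0..T} \<Longrightarrow> \<gamma> t = extr p t"
proof -
  define M where "M = {t. 0 < t \<and> length_minimizer F 0 t \<gamma>}"
  have cut: "cut_time F \<gamma> = Sup (ereal ` M)"
    by (simp add: cut_time_def M_def)
  have \<gamma>0: "\<gamma> 0 = 0"
    using \<gamma> by (simp add: arclength_geodesic_def)
  have local: "\<exists>\<epsilon>>0. length_minimizer F (max 0 (t - \<epsilon>)) (t + \<epsilon>) \<gamma>" if "0 \<le> t" for t
    using \<gamma> that unfolding arclength_geodesic_def geodesic_def by blast
  obtain \<epsilon>0 where "0 < \<epsilon>0" "length_minimizer F (max 0 (0 - \<epsilon>0)) (0 + \<epsilon>0) \<gamma>"
    using local[of 0] by auto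
  then have \<epsilon>0: "0 < \<epsilon>0" "\<epsilon>0 \<in> M"
    by (auto simp: M_def max_def)
  then have "ereal \<epsilon>0 \<le> cut_time F \<gamma>"
    unfolding cut by (intro Sup_upper) auto
  then obtain T where T: "cut_time F \<gamma> = ereal T" "0 < T"
    using fin \<epsilon>0(1) by (cases "cut_time F \<gamma>") auto
  have MT: "t \<le> T" if "t \<in> M" for t
    using T(1) that unfolding cut by (metis Sup_upper ereal_less_eq(3) imageI)
  have Mex: "\<exists>t\<in>M. s < t" if "s < T" for s
  proof -
    have "ereal s < Sup (ereal ` M)"
      using T(1) that unfolding cut by simp
    then show ?thesis
      unfolding less_Sup_iff by auto
  qed
  obtain \<epsilon> where \<epsilon>: "0 < \<epsilon>" and min\<epsilon>: "length_minimizer F (max 0 (T - \<epsilon>)) (T + \<epsilon>) \<gamma>"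
    using local[of T] T(2) by auto
  define c where "c = max 0 (T - \<epsilon>)"
  define d where "d = T + \<epsilon>"
  have cd: "0 \<le> c" "c < T" "T < d" "c < d"
    using \<epsilon> T(2) by (auto simp: c_def d_def)
  obtain t' where t': "t' \<in> M" "c < t'"
    using Mex cd by blast
  have t'0: "0 < t'" "t' \<le> T"
    using t' cd MT by auto
  have min': "length_minimizer F 0 t' \<gamma>"
    using t' by (simp add: M_def)
  obtain p where p: "hnorm p = 1" "\<And>t. t \<in> {0..t'} \<Longrightarrow> \<gamma> t = extr p t"
    using minimizer_extremal[OF min' t'0(1) arclength_geodesic_speed[OF \<gamma>]] by (auto simp: \<gamma>0)
  obtain p' where p': "\<And>t. t \<in> {c..d} \<Longrightarrow> \<gamma> t = ltrans (\<gamma> c) (extr p' (t - c))"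
    using minimizer_extremal[OF min\<epsilon>[folded c_def d_def] cd(4) arclength_geodesic_speed[OF \<gamma> cd(1)]] by auto
  let ?r = "momentum \<alpha>1 \<alpha>2 p c"
  have flow: "extr p t = ltrans (\<gamma> c) (extr ?r (t - c))" for t
    using extremal_add[of \<alpha>1 \<alpha>2 p c "t - c"] p(2)[of c] cd t' by auto
  have eq: "extr ?r t = extr p' t" for t
  proof -
    have "extr ?r t = extr p' t" if t: "t \<in> {0<..<t' - c}" for t
    proof -
      have "ltrans (\<gamma> c) (extr ?r t) = ltrans (\<gamma> c) (extr p' t)"
        using flow[of "t + c"] p'[of "t + c"] p(2)[of "t + c"] t cd t'0 by auto
      then show ?thesis
        by (simp add: translate_inject)
    qed
    moreover have "0 < t' - c"
      using t'(2) by simp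
    ultimately have "(\<forall>i. i \<noteq> 5 \<longrightarrow> ?r $ i = p' $ i)" "straight \<alpha>1 \<alpha>2 ?r \<or> ?r $ 5 = p' $ 5"
      using extremal_unique[of 0 "t' - c" \<alpha>1 \<alpha>2 ?r p'] by blast+
    then consider "?r = p'" | "straight \<alpha>1 \<alpha>2 ?r" "\<forall>i. i \<noteq> 5 \<longrightarrow> p' $ i = ?r $ i"
      unfolding vec5_eq_iff by fastforce
    then show ?thesis
    proof cases
      case 2
      from straight_extremal[OF 2(1), of p'] 2(2) show ?thesis
        by simp
    qed simp
  qed
  have \<gamma>p: "\<gamma> t = extr p t" if t: "t \<in> {0..d}" for t
  proof (cases "t \<le> c")
    case True
    then show ?thesis
      using p(2) t t'(2) by auto
  next
    case False
    then show ?thesis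
      using p'[of t] t flow[of t] eq by auto
  qed
  have Mi: "s \<in> M" if "0 < s" "s \<le> d" "hnorm r = 1" "m * \<bar>r $ 5\<bar> * s \<le> 2 * pi" "\<And>t. extr r t = extr p t" for s r
    unfolding M_def using that \<gamma>p by (auto intro!: extremal_short_minimizer[of s r])
  \<comment> \<open>A straight extremal is unchanged when \<open>p $ 5\<close> is replaced by 0.
    With that multiplier it would minimize up to \<open>d\<close>, which lies beyond
    \<open>T\<close>.\<close>
  have ns: "\<not> straight \<alpha>1 \<alpha>2 p"
  proof
    assume st: "straight \<alpha>1 \<alpha>2 p"
    define r :: "real^5" where "r = vector [p $ 1, p $ 2, p $ 3, p $ 4, 0]"
    have "r $ i = p $ i" if "i \<noteq> 5" for i
      using exhaust_5[of i] that by (auto simp: r_def)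
    then have "extr r t = extr p t" for t
      by (rule straight_extremal[OF st])
    moreover have "hnorm r = 1"
      using p(1) by (simp add: hnorm_def r_def)
    ultimately have "d \<in> M"
      using cd by (intro Mi[of d r]) (auto simp: r_def)
    then show False
      using MT[of d] cd by simp
  qed
  have short': "m * \<bar>p $ 5\<bar> * t \<le> 2 * pi" if t: "t \<in> M" for t
    by (rule minimizer_imp_short[OF \<gamma> \<gamma>p ns]) (use t MT[OF t] cd in \<open>auto simp: M_def\<close>)
  have p5: "0 < m * \<bar>p $ 5\<bar>"
  proof (rule ccontr)
    assume "\<not> 0 < m * \<bar>p $ 5\<bar>"
    then have "\<bar>p $ 5\<bar> = 0"
      using m_pos by (simp add: zero_less_mult_iff)
    then have "d \<in> M"
      using p(1) cd by (intro Mi[of d p]) auto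
    then show False
      using MT[of d] cd by simp
  qed
  have "m * \<bar>p $ 5\<bar> * T = 2 * pi"
  proof (rule antisym)
    show "m * \<bar>p $ 5\<bar> * T \<le> 2 * pi"
    proof (rule ccontr)
      assume "\<not> m * \<bar>p $ 5\<bar> * T \<le> 2 * pi"
      then have "2 * pi / (m * \<bar>p $ 5\<bar>) < T"
        using p5 by (simp add: divide_less_eq mult.commute)
      then obtain t where t: "t \<in> M" "2 * pi / (m * \<bar>p $ 5\<bar>) < t"
        using Mex by blast
      then have "2 * pi < m * \<bar>p $ 5\<bar> * t"
        using p5 by (simp add: divide_less_eq mult.commute)
      then show False
        using short'[OF t(1)] by simp
    qed
    show "2 * pi \<le> m * \<bar>p $ 5\<bar> * T"
    proof (rule ccontr)
      assume "\<not> 2 * pi \<le> m * \<bar>p $ 5\<bar> * T"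
      then have lt: "T < 2 * pi / (m * \<bar>p $ 5\<bar>)"
        using p5 by (simp add: less_divide_eq mult.commute)
      define e where "e = min d (2 * pi / (m * \<bar>p $ 5\<bar>))"
      have e: "T < e" "e \<le> d" "e \<le> 2 * pi / (m * \<bar>p $ 5\<bar>)"
        using lt cd by (auto simp: e_def)
      have "m * \<bar>p $ 5\<bar> * e \<le> 2 * pi"
        using e(3) p5 by (simp add: le_divide_eq mult.commute)
      then have "e \<in> M"
        using e T(2) p(1) by (intro Mi[of e p]) auto
      then show False
        using MT e by force
    qed
  qed
  then show thesis
    using that[OF T p(1) ns] \<gamma>p cd by auto
qed

lemma unit_covector:
  assumes "\<not> straight \<alpha>1 \<alpha>2 p"
  obtains r where "hnorm r = 1" "p = hnorm p *\<^sub>R r" "0 < hnorm p" "\<not> straight \<alpha>1 \<alpha>2 r"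
    "\<And>t. extr p t = extr r (hnorm p * t)"
proof -
  have "hnorm p \<noteq> 0"
  proof
    assume "hnorm p = 0"
    then have "(p $ 1)\<^sup>2 + (p $ 2)\<^sup>2 + (p $ 3)\<^sup>2 + (p $ 4)\<^sup>2 = 0"
      by (simp flip: hnorm_squared)
    then have "p $ 1 = 0 \<and> p $ 2 = 0 \<and> p $ 3 = 0 \<and> p $ 4 = 0"
      by (auto simp: add_nonneg_eq_0_iff)
    then show False
      using assms by (simp add: straight_def)
  qed
  then have pos: "0 < hnorm p"
    using hnorm_nonneg[of p] by linarith
  define r where "r = (1 / hnorm p) *\<^sub>R p"
  have "hnorm r = 1"
    unfolding r_def hnorm_scale using pos by simp
  moreover have r: "p = hnorm p *\<^sub>R r"
    using pos by (simp add: r_def)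
  moreover have "\<not> straight \<alpha>1 \<alpha>2 r"
    using assms pos by (simp add: r_def straight_scale)
  moreover have "extr p t = extr r (hnorm p * t)" for t
    by (subst r) (rule extremal_scale)
  ultimately show thesis
    using that pos by blast
qed

text \<open>Scaling by the cut time converts unit covectors with varying cut time into arbitrary
  covectors with cut time 1, so the cut locus is the image of a critical slice under the time-one
  map.\<close>

theorem cut_locus_eq: "cut_locus F 0 = {extr p 1 | p. \<not> straight \<alpha>1 \<alpha>2 p \<and> m * \<bar>p $ 5\<bar> = 2 * pi}"
proof (intro equalityI subsetI)
  fix q assume "q \<in> cut_locus F 0"
  then obtain \<gamma> where \<gamma>: "arclength_geodesic F 0 \<gamma>" "cut_time F \<gamma> < \<infinity>" and q: "q = \<gamma> (real_of_ereal (cut_time F \<gamma>))"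
    unfolding cut_locus_def by auto
  obtain T p where T: "cut_time F \<gamma> = ereal T" "0 < T" and p: "\<not> straight \<alpha>1 \<alpha>2 p"
    "m * \<bar>p $ 5\<bar> * T = 2 * pi" "\<And>t. t \<in> {0..T} \<Longrightarrow> \<gamma> t = extr p t"
    using cut_time_finite[OF \<gamma>] by metis
  have "q = extr (T *\<^sub>R p) 1"
    using q T p(3)[of T] by (simp add: extremal_scale)
  moreover have "\<not> straight \<alpha>1 \<alpha>2 (T *\<^sub>R p)" "m * \<bar>(T *\<^sub>R p) $ 5\<bar> = 2 * pi"
    using p(1,2) T(2) by (simp_all add: straight_scale abs_mult mult_ac)
  ultimately show "q \<in> {extr p 1 | p. \<not> straight \<alpha>1 \<alpha>2 p \<and> m * \<bar>p $ 5\<bar> = 2 * pi}"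
    by blast
next
  fix q assume "q \<in> {extr p 1 | p. \<not> straight \<alpha>1 \<alpha>2 p \<and> m * \<bar>p $ 5\<bar> = 2 * pi}"
  then obtain p where q: "q = extr p 1" and p: "\<not> straight \<alpha>1 \<alpha>2 p" "m * \<bar>p $ 5\<bar> = 2 * pi"
    by blast
  obtain r where r: "hnorm r = 1" "p = hnorm p *\<^sub>R r" "0 < hnorm p" "\<not> straight \<alpha>1 \<alpha>2 r"
    "\<And>t. extr p t = extr r (hnorm p * t)"
    using unit_covector[OF p(1)] by blast
  have "p $ 5 = hnorm p * r $ 5"
    using arg_cong[OF r(2), of "\<lambda>v. v $ 5"] by simp
  then have "m * \<bar>r $ 5\<bar> * hnorm p = 2 * pi"
    using p(2) r(3) by (simp add: abs_mult mult_ac)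
  then have "cut_time F (extr r) = ereal (hnorm p)"
    by (intro cut_time_extremal r)
  moreover have "q = extr r (hnorm p)"
    using q r(5)[of 1] by simp
  ultimately show "q \<in> cut_locus F 0"
    unfolding cut_locus_def using extremal_arclength_geodesic[OF r(1)]
    by (intro CollectI exI[of _ "extr r"]) auto
qed

text \<open>The equality case preserves the multiplier. The optimal geodesics to \<open>q\<close>
  thus correspond to the unit covectors with the given \<open>p $ 5\<close> whose extremals end at
  \<open>q\<close>.\<close>

lemma optimal_geodesics_eq:
  assumes T: "0 < T" and p: "hnorm p = 1" "m * \<bar>p $ 5\<bar> * T \<le> 2 * pi" and q: "q = extr p T"
  shows "sr_dist F 0 q = T"
    and "\<gamma> \<in> optimal_geodesics F 0 q \<Longrightarrow>
      \<exists>p'. hnorm p' = 1 \<and> p' $ 5 = p $ 5 \<and> extr p' T = q \<and> (\<forall>t\<in>{0..T}. \<gamma> t = extr p' t)"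
    and "hnorm p' = 1 \<Longrightarrow> p' $ 5 = p $ 5 \<Longrightarrow> extr p' T = q \<Longrightarrow> extr p' \<in> optimal_geodesics F 0 q"
proof -
  show d: "sr_dist F 0 q = T"
    unfolding q using sr_dist_short[OF _ p(2)] T p(1) by simp
  show "\<exists>p'. hnorm p' = 1 \<and> p' $ 5 = p $ 5 \<and> extr p' T = q \<and> (\<forall>t\<in>{0..T}. \<gamma> t = extr p' t)"
    if "\<gamma> \<in> optimal_geodesics F 0 q"
  proof -
    have \<gamma>: "arclength_geodesic F 0 \<gamma>" "\<gamma> T = q" "length_minimizer F 0 T \<gamma>"
      using that d by (auto simp: optimal_geodesics_def)
    have \<gamma>0: "\<gamma> 0 = 0"
      using \<gamma>(1) by (simp add: arclength_geodesic_def)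
    obtain p' where "p' $ 5 = p $ 5" "hnorm p' = 1" "\<forall>t\<in>{0..T}. \<gamma> t = ltrans (\<gamma> 0) (extr p' (t - 0))"
      using minimizer_imp_extremal[OF \<gamma>(3) T arclength_geodesic_speed[OF \<gamma>(1)], of p] short[OF p(2)] T \<gamma>(2) q
      by (auto simp: \<gamma>0)
    then show ?thesis
      using \<gamma>(2) T by (auto simp: \<gamma>0)
  qed
  show "extr p' \<in> optimal_geodesics F 0 q" if "hnorm p' = 1" "p' $ 5 = p $ 5" "extr p' T = q"
    unfolding optimal_geodesics_def d
    using that extremal_arclength_geodesic extremal_short_minimizer[OF T that(1)] p(2) by simp
qed

end

subsection \<open>The critical angle\<close>

lemma sin_pi_abs: "\<bar>k\<bar> = pi \<Longrightarrow> sin k = 0"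
  by (cases "0 \<le> k") (auto simp: abs_if split: if_splits dest: arg_cong[of _ _ sin])

lemma extremal_critical_plane:
  assumes "\<bar>k\<bar> * t = pi"
  shows "sn k t = 0" "sn_area k t = t / (2 * k)"
proof -
  have "0 < \<bar>k\<bar> * t"
    using assms pi_gt_zero by linarith
  then have "k \<noteq> 0" "0 < t"
    by (auto simp: zero_less_mult_iff)
  moreover from this have "sin (k * t) = 0"
    using assms by (intro sin_pi_abs) (simp add: abs_mult)
  ultimately show "sn k t = 0" "sn_area k t = t / (2 * k)"
    by (auto simp: sn_def sn_area_def)
qed

lemma area_ratio_pos:
  assumes "0 < k" "k < pi"
  shows "0 < area_ratio k"
proof -
  have s: "0 < sin k"
    using assms by (rule sin_gt_zero)
  have "cos k < cos 0"
    using assms by (intro cos_monotone_0_pi) auto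
  then have "sin k * cos k < sin k"
    using s by simp
  also have "\<dots> \<le> k"
    using assms by (intro sin_x_le_x) auto
  finally show ?thesis
    using assms s by (simp add: area_ratio_eq)
qed

lemma area_ratio_minus: "area_ratio (- k) = - area_ratio k"
  by (simp add: area_ratio_def sn_minus)

text \<open>When the first plane completes its circle, the second has reached the angle
  \<open>pi * \<alpha>2 / \<alpha>1\<close>. The constant \<open>K\<close> is the height per squared
  distance that the second plane has gained by then.\<close>

lemma bi_heisenberg_K_eq:
  assumes "0 < \<alpha>2" "\<alpha>2 < \<alpha>1"
  shows "bi_heisenberg_K \<alpha>1 \<alpha>2 = \<alpha>2 / 2 * area_ratio (pi * \<alpha>2 / \<alpha>1)"
proof -
  define k where "k = pi * \<alpha>2 / \<alpha>1"
  have k: "k \<noteq> 0" "2 * pi / \<alpha>1 = 2 * k / \<alpha>2"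
    using assms by (auto simp: k_def)
  have "bi_heisenberg_K \<alpha>1 \<alpha>2 = \<alpha>2\<^sup>2 / 8 * (2 * k / \<alpha>2 - 1 / \<alpha>2 * (2 * sin k * cos k)) / (sin k)\<^sup>2"
    unfolding bi_heisenberg_K_def k(2) sin_double[symmetric] by (simp add: k_def mult_ac)
  also have "2 * k / \<alpha>2 - 1 / \<alpha>2 * (2 * sin k * cos k) = 2 / \<alpha>2 * (k - sin k * cos k)"
    by (simp add: algebra_simps diff_divide_distrib)
  also have "\<alpha>2\<^sup>2 / 8 * (2 / \<alpha>2 * X) / Y = \<alpha>2 / 2 * (X / (2 * Y))" for X Y
    using assms by (simp add: power2_eq_square)
  finally show ?thesis
    using area_ratio_eq[OF k(1)] by (simp add: k_def)
qed

lemma straight_extremal_5: "straight \<alpha>1 \<alpha>2 p \<Longrightarrow> extremal \<alpha>1 \<alpha>2 p t $ 5 = 0"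
  by (auto simp: straight_def extremal_nth)

lemma plane_unique:
  assumes "sn k t \<noteq> 0" "sn k t * (u * cos b - v * sin b) = sn k t * (u' * cos b - v' * sin b)"
    "sn k t * (u * sin b + v * cos b) = sn k t * (u' * sin b + v' * cos b)"
  shows "u = u' \<and> v = v'"
proof -
  have "u * cos b - v * sin b = u' * cos b - v' * sin b" "u * sin b + v * cos b = u' * sin b + v' * cos b"
    using assms by simp_all
  then have "(u - u') * cos b - (v - v') * sin b = 0" "(u - u') * sin b + (v - v') * cos b = 0"
    by (simp_all add: algebra_simps)
  then have "(u - u')\<^sup>2 + (v - v')\<^sup>2 = 0"
    using rotation_squares[of "u - u'" b "v - v'"] by simp
  then show ?thesis
    by (simp add: sum_power2_eq_zero_iff)
qed

lemma continuous_on_vec: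
  fixes f :: "'a::topological_space \<Rightarrow> real^'n"
  assumes "\<And>i. continuous_on A (\<lambda>x. f x $ i)"
  shows "continuous_on A f"
  using continuous_on_vec_lambda[of A "\<lambda>i x. f x $ i"] assms by simp

text \<open>All members share the multiplier \<open>w\<close>, so \<open>sn\<close> and
  \<open>sn_area\<close> have to be continuous in time only, not in the frequency.\<close>

lemma continuous_on_extremal_family:
  assumes "\<And>i. continuous_on S (\<lambda>s. p s $ i)" "\<And>s. p s $ 5 = w"
  shows "continuous_on (S \<times> A) (\<lambda>(s, t). extremal \<alpha>1 \<alpha>2 (p s) t)"
proof -
  have p: "continuous_on (S \<times> A) (\<lambda>x. p (fst x) $ i)" for i
    by (rule continuous_on_compose2[OF assms(1) continuous_on_fst[OF continuous_on_id]]) auto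
  have cs: "continuous_on (S \<times> A) (\<lambda>x. cos (c * snd x))" "continuous_on (S \<times> A) (\<lambda>x. sin (c * snd x))" for c :: real
    by (rule continuous_on_compose2[of UNIV]; auto intro!: continuous_intros continuous_at_imp_continuous_on)+
  have "continuous_on (S \<times> A) (\<lambda>x. extremal \<alpha>1 \<alpha>2 (p (fst x)) (snd x) $ i)" for i
    using exhaust_5[of i]
    by (elim disjE; simp only: extremal_nth assms(2);
        intro continuous_on_add continuous_on_diff continuous_on_mult continuous_on_power continuous_on_sn
          continuous_on_sn_area continuous_on_const continuous_on_snd continuous_on_id cs p)
  then show ?thesis
    unfolding case_prod_unfold by (rule continuous_on_vec)
qed

context bi_heisenberg_params
begin

lemma cut_point:
  assumes "q \<in> cut_locus F 0"
  obtains p T where "hnorm p = 1" "0 < T" "\<not> straight \<alpha>1 \<alpha>2 p" "m * \<bar>p $ 5\<bar> * T = 2 * pi" "q = extr p T"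
proof -
  obtain P where q: "q = extr P 1" and P: "\<not> straight \<alpha>1 \<alpha>2 P" "m * \<bar>P $ 5\<bar> = 2 * pi"
    using assms unfolding cut_locus_eq by blast
  obtain r where r: "hnorm r = 1" "P = hnorm P *\<^sub>R r" "0 < hnorm P" "\<not> straight \<alpha>1 \<alpha>2 r"
    "\<And>t. extr P t = extr r (hnorm P * t)"
    using unit_covector[OF P(1)] by blast
  have "P $ 5 = hnorm P * r $ 5"
    using arg_cong[OF r(2), of "\<lambda>v. v $ 5"] by simp
  then have "m * \<bar>r $ 5\<bar> * hnorm P = 2 * pi"
    using P(2) r(3) by (simp add: abs_mult mult_ac)
  then show thesis
    using that[of r "hnorm P"] r q by auto
qed

lemma optimal_family_extremal:
  fixes S :: "'s::topological_space set"
  assumes T: "0 < T" and p: "hnorm p = 1" "m * \<bar>p $ 5\<bar> * T = 2 * pi" and q: "q = extr p T"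
    and cont: "\<And>i. continuous_on S (\<lambda>s. P s $ i)" and P5: "\<And>s. P s $ 5 = p $ 5"
    and P: "\<And>s. s \<in> S \<Longrightarrow> hnorm (P s) = 1 \<and> extr (P s) T = q"
    and exhaust: "\<And>p'. hnorm p' = 1 \<Longrightarrow> p' $ 5 = p $ 5 \<Longrightarrow> extr p' T = q \<Longrightarrow> \<exists>s\<in>S. p' = P s"
  shows "optimal_family F 0 q S (\<lambda>s. extr (P s))"
    and "inj_on P S \<Longrightarrow> injective_family F 0 q S (\<lambda>s. extr (P s))"
proof -
  note opt = optimal_geodesics_eq[OF T p(1) eq_refl[OF p(2)] q]
  show "optimal_family F 0 q S (\<lambda>s. extr (P s))"
    unfolding optimal_family_def opt(1)
  proof (intro conjI ballI)
    show "continuous_on (S \<times> {0..T}) (\<lambda>(s, t). extr (P s) t)"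
      by (rule continuous_on_extremal_family[OF cont P5])
    show "extr (P s) \<in> optimal_geodesics F 0 q" if "s \<in> S" for s
      by (rule opt(3)) (use P[OF that] P5 in auto)
    show "\<exists>s\<in>S. \<forall>t\<in>{0..T}. \<gamma> t = extr (P s) t" if "\<gamma> \<in> optimal_geodesics F 0 q" for \<gamma>
      using opt(2)[OF that] exhaust by metis
  qed
  assume inj: "inj_on P S"
  show "injective_family F 0 q S (\<lambda>s. extr (P s))"
    unfolding injective_family_def opt(1)
  proof (intro ballI impI)
    fix s s' assume s: "s \<in> S" "s' \<in> S" and eq: "\<forall>t\<in>{0..T}. extr (P s) t = extr (P s') t"
    then have "\<forall>i. i \<noteq> 5 \<longrightarrow> P s $ i = P s' $ i"
      using extremal_unique[OF T, of \<alpha>1 \<alpha>2 "P s" "P s'"] by auto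
    then have "P s = P s'"
      using P5 unfolding vec5_eq_iff by auto
    then show "s = s'"
      using inj s by (auto dest: inj_onD)
  qed
qed

end

lemma norm_1_vec2: "norm (s :: real^2) = 1 \<longleftrightarrow> (s $ 1)\<^sup>2 + (s $ 2)\<^sup>2 = 1"
  by (simp add: norm_eq_1 inner_vec_def sum_2 power2_eq_square)

lemma norm_1_vec4: "norm (s :: real^4) = 1 \<longleftrightarrow> (s $ 1)\<^sup>2 + (s $ 2)\<^sup>2 + (s $ 3)\<^sup>2 + (s $ 4)\<^sup>2 = 1"
  by (simp add: norm_eq_1 inner_vec_def sum_4 power2_eq_square)

subsection \<open>Equal parameters\<close>

locale bi_heisenberg_equal = bi_heisenberg_params +
  assumes \<alpha>_eq: "\<alpha>2 = \<alpha>1"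
begin

lemma m_eq: "m = \<alpha>1" and \<alpha>1_pos: "0 < \<alpha>1"
  using m_pos \<alpha>_eq by auto

text \<open>Both planes close up at the same time, and the heights of the two circles add up to an
  expression that depends on the initial velocity only through its length.\<close>

lemma critical_extremal:
  assumes "m * \<bar>p $ 5\<bar> * T = 2 * pi"
  shows "extr p T = vector [0, 0, 0, 0, (hnorm p)\<^sup>2 * T / (2 * p $ 5)]"
proof -
  have "\<bar>\<alpha>1 * p $ 5 / 2\<bar> * T = pi"
    using assms \<alpha>1_pos by (simp add: m_eq abs_mult)
  note c = extremal_critical_plane[OF this]
  have "\<alpha>1 / 2 * X * (T / (2 * (\<alpha>1 * p $ 5 / 2))) = X * T / (2 * p $ 5)" for X
    using \<alpha>1_pos by simp
  then have "extr p T $ 5 = (hnorm p)\<^sup>2 * T / (2 * p $ 5)"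
    unfolding extremal_nth \<alpha>_eq c hnorm_squared by (simp add: distrib_right add_divide_distrib)
  then show ?thesis
    using c by (simp add: vec5_eq_iff extremal_nth(1-4) \<alpha>_eq)
qed

lemma cut_locus_equal: "cut_locus F 0 = {vector [0, 0, 0, 0, z] | z. z \<noteq> 0}"
proof (intro equalityI subsetI)
  fix q assume "q \<in> cut_locus F 0"
  then obtain p where q: "q = extr p 1" and p: "\<not> straight \<alpha>1 \<alpha>2 p" "m * \<bar>p $ 5\<bar> * 1 = 2 * pi"
    unfolding cut_locus_eq by auto
  have "hnorm p \<noteq> 0"
    using unit_covector[OF p(1)] by (metis less_irrefl)
  moreover have "p $ 5 \<noteq> 0"
    using p(2) by auto
  ultimately show "q \<in> {vector [0, 0, 0, 0, z] | z. z \<noteq> 0}"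
    unfolding q critical_extremal[OF p(2)] by auto
next
  fix q :: "real^5" assume "q \<in> {vector [0, 0, 0, 0, z] | z. z \<noteq> 0}"
  then obtain z where q: "q = vector [0, 0, 0, 0, z]" and z: "z \<noteq> 0"
    by blast
  define w where "w = 2 * pi / \<alpha>1 * sgn z"
  have w: "m * \<bar>w\<bar> = 2 * pi" "0 < w * z"
    using \<alpha>1_pos z by (auto simp: w_def m_eq abs_mult abs_sgn_eq mult.assoc sgn_mult_self_eq mult_pos_pos
        zero_less_mult_iff sgn_if)
  \<comment> \<open>By \<open>critical_extremal\<close> the height at time 1 is the squared length
    of the velocity divided by \<open>2 * w\<close>. The multiplier \<open>w\<close> has the sign of
    \<open>z\<close>, so the root is real.\<close>
  define p :: "real^5" where "p = vector [sqrt (2 * (w * z)), 0, 0, 0, w]"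
  have "w \<noteq> 0"
    using w(2) by auto
  then have "extr p 1 = q"
    using critical_extremal[of p 1] w by (simp add: p_def q hnorm_squared)
  moreover have "\<not> straight \<alpha>1 \<alpha>2 p"
    using w(2) \<open>w \<noteq> 0\<close> z \<alpha>1_pos by (simp add: straight_def p_def)
  moreover have "m * \<bar>p $ 5\<bar> = 2 * pi"
    using w(1) by (simp add: p_def)
  ultimately show "q \<in> cut_locus F 0"
    unfolding cut_locus_eq by blast
qed

text \<open>At the critical time every unit initial velocity with the same multiplier leads to the
  same point, so the unit sphere of velocities parametrizes the family.\<close>

lemma optimal_family_equal:
  assumes "q \<in> cut_locus F 0"
  shows "\<exists>\<Gamma>. optimal_family F 0 q (sphere (0 :: real^4) 1) \<Gamma> \<and> injective_family F 0 q (sphere 0 1) \<Gamma>"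
proof -
  obtain p T where p: "hnorm p = 1" "0 < T" "\<not> straight \<alpha>1 \<alpha>2 p" "m * \<bar>p $ 5\<bar> * T = 2 * pi" "q = extr p T"
    using cut_point[OF assms] by blast
  define P :: "real^4 \<Rightarrow> real^5" where "P s = vector [s $ 1, s $ 2, s $ 3, s $ 4, p $ 5]" for s
  have 1: "continuous_on (sphere 0 1) (\<lambda>s. P s $ i)" for i
    using exhaust_5[of i] by (elim disjE) (simp_all add: P_def continuous_on_component)
  have 2: "P s $ 5 = p $ 5" for s
    by (simp add: P_def)
  have 3: "hnorm (P s) = 1 \<and> extr (P s) T = q" if "s \<in> sphere 0 1" for s
  proof -
    have n: "hnorm (P s) = 1"
      using that by (simp add: norm_1_vec4 hnorm_def P_def)
    then show ?thesis
      using critical_extremal[OF p(4)] critical_extremal[of "P s" T] p(1,4,5) by (simp add: 2)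
  qed
  have 4: "\<exists>s\<in>sphere 0 1. p' = P s" if "hnorm p' = 1" "p' $ 5 = p $ 5" for p'
  proof
    define s :: "real^4" where "s = vector [p' $ 1, p' $ 2, p' $ 3, p' $ 4]"
    show "p' = P s"
      using that(2) by (simp add: P_def s_def vec5_eq_iff)
    have "(hnorm p')\<^sup>2 = 1"
      using that(1) by simp
    then show "s \<in> sphere 0 1"
      by (simp add: norm_1_vec4 s_def hnorm_squared)
  qed
  have "inj_on P (sphere 0 1)"
    by (rule inj_onI) (simp add: P_def vec5_eq_iff vec_eq_iff forall_4)
  then show ?thesis
    using optimal_family_extremal[OF p(2,1,4,5), of "sphere 0 1" P, OF 1 2 3 4] by blast
qed

end

subsection \<open>Distinct parameters\<close>

locale bi_heisenberg_distinct = bi_heisenberg_params +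
  assumes \<alpha>_less: "\<alpha>2 < \<alpha>1"
begin

lemma m_eq: "m = \<alpha>1" and \<alpha>1_pos: "0 < \<alpha>1"
  using \<alpha>_less \<alpha>2_nonneg by auto

text \<open>The second plane is still below its own critical angle when the first one closes up, so
  its initial velocity remains determined by the end point.\<close>

lemma second_angle:
  assumes "m * \<bar>w\<bar> * T = 2 * pi" "0 < T"
  shows "\<bar>\<alpha>2 * w / 2\<bar> * T = pi * \<alpha>2 / \<alpha>1" "sn (\<alpha>2 * w / 2) T \<noteq> 0"
proof -
  have "\<bar>w\<bar> * T = 2 * pi / \<alpha>1"
    using assms(1) \<alpha>1_pos by (simp add: m_eq field_simps)
  moreover have "\<bar>\<alpha>2 * w / 2\<bar> * T = \<alpha>2 / 2 * (\<bar>w\<bar> * T)"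
    using \<alpha>2_nonneg by (simp add: abs_mult)
  ultimately show *: "\<bar>\<alpha>2 * w / 2\<bar> * T = pi * \<alpha>2 / \<alpha>1"
    by simp
  show "sn (\<alpha>2 * w / 2) T \<noteq> 0"
  proof (cases "\<alpha>2 * w / 2 = 0")
    case True
    then show ?thesis
      using assms(2) by (simp add: sn_def)
  next
    case False
    have "\<bar>\<alpha>2 * w / 2 * T\<bar> = pi * \<alpha>2 / \<alpha>1"
      unfolding abs_mult[of _ T] using * assms(2) by simp
    moreover have "pi * \<alpha>2 / \<alpha>1 < pi"
      using \<alpha>_less \<alpha>1_pos by (simp add: divide_less_eq)
    moreover have "0 < \<bar>\<alpha>2 * w / 2 * T\<bar>"
      using False assms(2) by simp
    ultimately have "0 < \<bar>\<alpha>2 * w / 2 * T\<bar>" "\<bar>\<alpha>2 * w / 2 * T\<bar> < pi"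
      by simp_all
    then have "0 < sin \<bar>\<alpha>2 * w / 2 * T\<bar>"
      by (rule sin_gt_zero)
    then have "sin (\<alpha>2 * w / 2 * T) \<noteq> 0"
      by (auto simp: abs_if split: if_splits)
    then show ?thesis
      using False by (simp add: sn_def)
  qed
qed

lemma critical_extremal:
  assumes "m * \<bar>p $ 5\<bar> * T = 2 * pi"
  shows "extr p T $ 1 = 0" "extr p T $ 2 = 0"
    "extr p T $ 5 = ((p $ 1)\<^sup>2 + (p $ 2)\<^sup>2) * T / (2 * p $ 5)
      + \<alpha>2 / 2 * ((p $ 3)\<^sup>2 + (p $ 4)\<^sup>2) * sn_area (\<alpha>2 * p $ 5 / 2) T"
proof -
  have "\<bar>\<alpha>1 * p $ 5 / 2\<bar> * T = pi"
    using assms \<alpha>1_pos by (simp add: m_eq abs_mult)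
  from extremal_critical_plane[OF this]
  show "extr p T $ 1 = 0" "extr p T $ 2 = 0"
    "extr p T $ 5 = ((p $ 1)\<^sup>2 + (p $ 2)\<^sup>2) * T / (2 * p $ 5)
      + \<alpha>2 / 2 * ((p $ 3)\<^sup>2 + (p $ 4)\<^sup>2) * sn_area (\<alpha>2 * p $ 5 / 2) T"
    using \<alpha>1_pos by (simp_all add: extremal_nth)
qed

text \<open>Equal to \<open>bi_heisenberg_K\<close> for positive \<open>\<alpha>2\<close> and to 0
  for \<open>\<alpha>2 = 0\<close>, so that cases (ii) and (iii) share one argument.\<close>

definition slope :: real where
  "slope = \<alpha>2 / 2 * area_ratio (pi * \<alpha>2 / \<alpha>1)"

lemma slope_pos: "0 < \<alpha>2 \<Longrightarrow> 0 < slope"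
  unfolding slope_def using \<alpha>_less \<alpha>1_pos by (intro mult_pos_pos area_ratio_pos) (auto simp: divide_less_eq)

lemma slope_nonneg: "0 \<le> slope"
  unfolding slope_def using \<alpha>2_nonneg \<alpha>1_pos by (intro mult_nonneg_nonneg area_ratio_nonneg) auto

lemma second_area:
  assumes w: "m * \<bar>w\<bar> = 2 * pi"
  shows "\<alpha>2 / 2 * area_ratio (\<alpha>2 * w / 2) = sgn w * slope"
proof -
  have "\<alpha>2 * w / 2 = sgn w * (\<alpha>2 * \<bar>w\<bar> / 2)"
    by (simp add: sgn_if)
  also have "\<alpha>2 * \<bar>w\<bar> / 2 = pi * \<alpha>2 / \<alpha>1"
    using second_angle(1)[of w 1] w \<alpha>2_nonneg by (simp add: abs_mult)
  finally have "area_ratio (\<alpha>2 * w / 2) = sgn w * area_ratio (pi * \<alpha>2 / \<alpha>1)"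
    by (auto simp: sgn_if area_ratio_minus)
  then show ?thesis
    by (simp add: slope_def)
qed

text \<open>The first plane contributes a full circle of free size and the second
  \<open>slope\<close> times its squared distance. Both heights have the sign of the multiplier, so
  they cannot cancel.\<close>

lemma critical_area:
  assumes "m * \<bar>p $ 5\<bar> = 2 * pi"
  shows "extr p 1 $ 5 = sgn (p $ 5) * (((p $ 1)\<^sup>2 + (p $ 2)\<^sup>2) / (2 * \<bar>p $ 5\<bar>)
      + slope * ((extr p 1 $ 3)\<^sup>2 + (extr p 1 $ 4)\<^sup>2))"
proof -
  define k where "k = \<alpha>2 * p $ 5 / 2"
  have sn: "sn k 1 \<noteq> 0"
    using second_angle(2)[of "p $ 5" 1] assms by (simp add: k_def)
  have "(extr p 1 $ 3)\<^sup>2 + (extr p 1 $ 4)\<^sup>2 = (sn k 1)\<^sup>2 * ((p $ 3)\<^sup>2 + (p $ 4)\<^sup>2)"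
    unfolding extremal_nth power_mult_distrib k_def[symmetric]
    using rotation_squares[of "p $ 3" k "p $ 4"] by (simp flip: distrib_left)
  then have "((p $ 3)\<^sup>2 + (p $ 4)\<^sup>2) * sn_area k 1 = ((extr p 1 $ 3)\<^sup>2 + (extr p 1 $ 4)\<^sup>2) * area_ratio k"
    using sn by (simp add: area_ratio_def)
  then have "\<alpha>2 / 2 * ((p $ 3)\<^sup>2 + (p $ 4)\<^sup>2) * sn_area k 1
      = (\<alpha>2 / 2 * area_ratio k) * ((extr p 1 $ 3)\<^sup>2 + (extr p 1 $ 4)\<^sup>2)"
    by (simp add: mult_ac)
  also have "\<dots> = sgn (p $ 5) * (slope * ((extr p 1 $ 3)\<^sup>2 + (extr p 1 $ 4)\<^sup>2))"
    unfolding k_def second_area[OF assms] by simp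
  finally have 1: "\<alpha>2 / 2 * ((p $ 3)\<^sup>2 + (p $ 4)\<^sup>2) * sn_area k 1
      = sgn (p $ 5) * (slope * ((extr p 1 $ 3)\<^sup>2 + (extr p 1 $ 4)\<^sup>2))" .
  have 2: "X * 1 / (2 * w) = sgn w * (X / (2 * \<bar>w\<bar>))" for X w :: real
    by (simp add: sgn_if)
  have "extr p 1 $ 5 = ((p $ 1)\<^sup>2 + (p $ 2)\<^sup>2) * 1 / (2 * p $ 5)
      + \<alpha>2 / 2 * ((p $ 3)\<^sup>2 + (p $ 4)\<^sup>2) * sn_area k 1"
    unfolding k_def by (rule critical_extremal(3)) (simp only: mult_1_right assms)
  also have "\<dots> = sgn (p $ 5) * (((p $ 1)\<^sup>2 + (p $ 2)\<^sup>2) / (2 * \<bar>p $ 5\<bar>)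
      + slope * ((extr p 1 $ 3)\<^sup>2 + (extr p 1 $ 4)\<^sup>2))"
    unfolding 1 2 by (simp only: distrib_left)
  finally show ?thesis .
qed

lemma abs_critical_area:
  assumes "m * \<bar>p $ 5\<bar> = 2 * pi"
  shows "\<bar>extr p 1 $ 5\<bar> = ((p $ 1)\<^sup>2 + (p $ 2)\<^sup>2) / (2 * \<bar>p $ 5\<bar>)
      + slope * ((extr p 1 $ 3)\<^sup>2 + (extr p 1 $ 4)\<^sup>2)"
proof -
  have "\<bar>sgn (p $ 5)\<bar> = 1"
    using assms by (auto simp: sgn_if)
  moreover have "0 \<le> ((p $ 1)\<^sup>2 + (p $ 2)\<^sup>2) / (2 * \<bar>p $ 5\<bar>) + slope * ((extr p 1 $ 3)\<^sup>2 + (extr p 1 $ 4)\<^sup>2)"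
    using slope_nonneg by (intro add_nonneg_nonneg mult_nonneg_nonneg divide_nonneg_nonneg) auto
  ultimately show ?thesis
    by (subst critical_area[OF assms]) (simp only: abs_mult abs_of_nonneg mult_1_left)
qed

lemma critical_area_nonzero:
  assumes p5: "m * \<bar>p $ 5\<bar> = 2 * pi" and ns: "\<not> straight \<alpha>1 \<alpha>2 p"
  shows "extr p 1 $ 5 \<noteq> 0"
proof
  define k where "k = \<alpha>2 * p $ 5 / 2"
  have sn: "sn k 1 \<noteq> 0"
    using second_angle(2)[of "p $ 5" 1] p5 by (simp add: k_def)
  assume "extr p 1 $ 5 = 0"
  then have 0: "((p $ 1)\<^sup>2 + (p $ 2)\<^sup>2) / (2 * \<bar>p $ 5\<bar>) + slope * ((extr p 1 $ 3)\<^sup>2 + (extr p 1 $ 4)\<^sup>2) = 0"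
    using abs_critical_area[OF p5] by simp
  have nn: "0 \<le> ((p $ 1)\<^sup>2 + (p $ 2)\<^sup>2) / (2 * \<bar>p $ 5\<bar>)" "0 \<le> slope * ((extr p 1 $ 3)\<^sup>2 + (extr p 1 $ 4)\<^sup>2)"
    using slope_nonneg by auto
  have "((p $ 1)\<^sup>2 + (p $ 2)\<^sup>2) / (2 * \<bar>p $ 5\<bar>) = 0" and s: "slope * ((extr p 1 $ 3)\<^sup>2 + (extr p 1 $ 4)\<^sup>2) = 0"
    using 0 nn by linarith+
  moreover have "p $ 5 \<noteq> 0"
    using p5 by auto
  ultimately have 12: "(p $ 1)\<^sup>2 + (p $ 2)\<^sup>2 = 0"
    by simp
  have "\<alpha>2 * ((p $ 3)\<^sup>2 + (p $ 4)\<^sup>2) = 0"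
  proof (cases "\<alpha>2 = 0")
    case False
    then have "extr p 1 $ 3 = 0" "extr p 1 $ 4 = 0"
      using s slope_pos \<alpha>2_nonneg by (auto simp: sum_power2_eq_zero_iff)
    then have "p $ 3 = 0 \<and> p $ 4 = 0"
      using plane_unique[OF sn, of "p $ 3" k "p $ 4" 0 0] by (simp add: extremal_nth k_def)
    then show ?thesis
      by simp
  qed simp
  then show False
    using ns 12 by (simp add: straight_def)
qed

text \<open>The inequality says that the circle in the first plane has nonnegative area. The
  condition \<open>q $ 5 \<noteq> 0\<close> expresses that the extremal is not straight, and it is
  right also for \<open>\<alpha>2 = 0\<close>.\<close>

lemma cut_locus_distinct:
  "cut_locus F 0 = {q. q $ 1 = 0 \<and> q $ 2 = 0 \<and> q $ 5 \<noteq> 0 \<and> slope * ((q $ 3)\<^sup>2 + (q $ 4)\<^sup>2) \<le> \<bar>q $ 5\<bar>}"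
proof (intro equalityI subsetI)
  fix q assume "q \<in> cut_locus F 0"
  then obtain p where q: "q = extr p 1" and p: "\<not> straight \<alpha>1 \<alpha>2 p" "m * \<bar>p $ 5\<bar> = 2 * pi"
    unfolding cut_locus_eq by auto
  then show "q \<in> {q. q $ 1 = 0 \<and> q $ 2 = 0 \<and> q $ 5 \<noteq> 0 \<and> slope * ((q $ 3)\<^sup>2 + (q $ 4)\<^sup>2) \<le> \<bar>q $ 5\<bar>}"
    using critical_extremal(1,2)[of p 1] critical_area_nonzero abs_critical_area by simp
next
  fix q :: "real^5" assume "q \<in> {q. q $ 1 = 0 \<and> q $ 2 = 0 \<and> q $ 5 \<noteq> 0 \<and> slope * ((q $ 3)\<^sup>2 + (q $ 4)\<^sup>2) \<le> \<bar>q $ 5\<bar>}"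
  then have q: "q $ 1 = 0" "q $ 2 = 0" "q $ 5 \<noteq> 0" "slope * ((q $ 3)\<^sup>2 + (q $ 4)\<^sup>2) \<le> \<bar>q $ 5\<bar>"
    by auto
  define w where "w = 2 * pi / \<alpha>1 * sgn (q $ 5)"
  have w: "m * \<bar>w\<bar> = 2 * pi" "sgn w = sgn (q $ 5)"
    using \<alpha>1_pos q(3) by (simp_all add: w_def m_eq abs_mult abs_sgn_eq sgn_mult)
  define k where "k = \<alpha>2 * w / 2"
  have sn: "sn k 1 \<noteq> 0"
    using second_angle(2)[of w 1] w by (simp add: k_def)
  obtain u v where uv: "sn k 1 * (u * cos k - v * sin k) = q $ 3" "sn k 1 * (u * sin k + v * cos k) = q $ 4"
    using plane_solve[OF sn] by metis
  \<comment> \<open>The initial speed in the first plane is solved from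
    \<open>critical_area\<close>: the circle has to supply the height that the second plane leaves
    over.\<close>
  define c where "c = sqrt (2 * \<bar>w\<bar> * (\<bar>q $ 5\<bar> - slope * ((q $ 3)\<^sup>2 + (q $ 4)\<^sup>2)))"
  have c: "c\<^sup>2 = 2 * \<bar>w\<bar> * (\<bar>q $ 5\<bar> - slope * ((q $ 3)\<^sup>2 + (q $ 4)\<^sup>2))"
    using q(4) by (simp add: c_def)
  define p :: "real^5" where "p = vector [c, 0, u, v, w]"
  have p5: "m * \<bar>p $ 5\<bar> = 2 * pi"
    using w(1) by (simp add: p_def)
  have 34: "extr p 1 $ 3 = q $ 3" "extr p 1 $ 4 = q $ 4"
    using uv by (simp_all add: extremal_nth p_def k_def)
  have w0: "w \<noteq> 0"
    using w(1) by auto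
  have "extr p 1 $ 5 = sgn w * (c\<^sup>2 / (2 * \<bar>w\<bar>) + slope * ((q $ 3)\<^sup>2 + (q $ 4)\<^sup>2))"
    using critical_area[OF p5] unfolding 34 by (simp add: p_def)
  also have "\<dots> = sgn (q $ 5) * \<bar>q $ 5\<bar>"
    unfolding c w(2) using w0 by simp
  also have "\<dots> = q $ 5"
    by (simp add: sgn_mult_abs)
  finally have "extr p 1 = q"
    using 34 q critical_extremal(1,2)[of p 1] p5 by (simp add: vec5_eq_iff)
  moreover have "\<not> straight \<alpha>1 \<alpha>2 p"
    using straight_extremal_5[of \<alpha>1 \<alpha>2 p 1] q(3) calculation by auto
  ultimately show "q \<in> cut_locus F 0"
    unfolding cut_locus_eq using p5 by blast
qed

text \<open>The end point fixes the velocity in the second plane and hence the speed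
  \<open>\<rho>\<close> in the first, but not its direction there. Strict inequality for the height
  means that the circle is not reduced to a point.\<close>

lemma optimal_family_distinct:
  assumes q: "q \<in> cut_locus F 0"
  shows "\<exists>\<Gamma>. optimal_family F 0 q (sphere (0 :: real^2) 1) \<Gamma> \<and>
    (slope * ((q $ 3)\<^sup>2 + (q $ 4)\<^sup>2) < \<bar>q $ 5\<bar> \<longrightarrow> injective_family F 0 q (sphere 0 1) \<Gamma>)"
proof -
  obtain p T where p: "hnorm p = 1" "0 < T" "\<not> straight \<alpha>1 \<alpha>2 p" "m * \<bar>p $ 5\<bar> * T = 2 * pi" "q = extr p T"
    using cut_point[OF assms] by blast
  define \<rho> where "\<rho> = sqrt ((p $ 1)\<^sup>2 + (p $ 2)\<^sup>2)"
  have \<rho>: "\<rho>\<^sup>2 = (p $ 1)\<^sup>2 + (p $ 2)\<^sup>2" "0 \<le> \<rho>"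
    by (auto simp: \<rho>_def)
  have p1: "\<rho>\<^sup>2 + (p $ 3)\<^sup>2 + (p $ 4)\<^sup>2 = 1"
    using p(1) hnorm_squared[of p] by (simp add: \<rho>)
  define P :: "real^2 \<Rightarrow> real^5" where "P s = vector [\<rho> * s $ 1, \<rho> * s $ 2, p $ 3, p $ 4, p $ 5]" for s
  have Pc: "P s $ 1 = \<rho> * s $ 1" "P s $ 2 = \<rho> * s $ 2" "P s $ 3 = p $ 3" "P s $ 4 = p $ 4" "P s $ 5 = p $ 5" for s
    by (simp_all add: P_def)
  have 1: "continuous_on (sphere 0 1) (\<lambda>s. P s $ i)" for i
    using exhaust_5[of i] by (elim disjE) (simp_all add: Pc continuous_on_component continuous_on_mult_left)
  have 3: "hnorm (P s) = 1 \<and> extr (P s) T = q" if "s \<in> sphere 0 1" for s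
  proof -
    have s: "(\<rho> * s $ 1)\<^sup>2 + (\<rho> * s $ 2)\<^sup>2 = \<rho>\<^sup>2"
      using that by (simp add: norm_1_vec2 power_mult_distrib flip: distrib_left)
    then have n: "hnorm (P s) = 1"
      using p1 by (simp add: hnorm_def Pc)
    have "m * \<bar>P s $ 5\<bar> * T = 2 * pi"
      using p(4) by (simp add: Pc)
    from critical_extremal[OF this] critical_extremal[OF p(4)] s \<rho>(1)
    have "extr (P s) T $ 1 = q $ 1" "extr (P s) T $ 2 = q $ 2" "extr (P s) T $ 5 = q $ 5"
      by (simp_all add: Pc p(5))
    moreover have "extr (P s) T $ 3 = q $ 3" "extr (P s) T $ 4 = q $ 4"
      by (simp_all add: p(5) extremal_nth Pc)
    ultimately show ?thesis
      using n by (simp add: vec5_eq_iff)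
  qed
  have 4: "\<exists>s\<in>sphere 0 1. p' = P s" if p': "hnorm p' = 1" "p' $ 5 = p $ 5" "extr p' T = q" for p'
  proof -
    have "p' $ 3 = p $ 3 \<and> p' $ 4 = p $ 4"
    proof (rule plane_unique[OF second_angle(2)[OF p(4) p(2)]])
      show "sn (\<alpha>2 * p $ 5 / 2) T * (p' $ 3 * cos (\<alpha>2 * p $ 5 / 2 * T) - p' $ 4 * sin (\<alpha>2 * p $ 5 / 2 * T)) =
        sn (\<alpha>2 * p $ 5 / 2) T * (p $ 3 * cos (\<alpha>2 * p $ 5 / 2 * T) - p $ 4 * sin (\<alpha>2 * p $ 5 / 2 * T))"
        using arg_cong[OF p'(3), of "\<lambda>v. v $ 3"] unfolding p(5) extremal_nth p'(2) .
      show "sn (\<alpha>2 * p $ 5 / 2) T * (p' $ 3 * sin (\<alpha>2 * p $ 5 / 2 * T) + p' $ 4 * cos (\<alpha>2 * p $ 5 / 2 * T)) =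
        sn (\<alpha>2 * p $ 5 / 2) T * (p $ 3 * sin (\<alpha>2 * p $ 5 / 2 * T) + p $ 4 * cos (\<alpha>2 * p $ 5 / 2 * T))"
        using arg_cong[OF p'(3), of "\<lambda>v. v $ 4"] unfolding p(5) extremal_nth p'(2) .
    qed
    then have 34: "p' $ 3 = p $ 3" "p' $ 4 = p $ 4"
      by auto
    have sq: "(p' $ 1)\<^sup>2 + (p' $ 2)\<^sup>2 = \<rho>\<^sup>2"
      using hnorm_squared[of p'] p'(1) p1 34 by simp
    show ?thesis
    proof (cases "\<rho> = 0")
      \<comment> \<open>The circle is a point and every direction gives the same covector, so any
        element of the unit circle serves as witness.\<close>
      case True
      then have "p' = P (vector [1, 0])"
        using sq 34 p'(2) by (simp add: vec5_eq_iff Pc sum_power2_eq_zero_iff)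
      moreover have "(vector [1, 0] :: real^2) \<in> sphere 0 1"
        by (simp add: norm_1_vec2)
      ultimately show ?thesis
        by blast
    next
      case False
      define s :: "real^2" where "s = vector [p' $ 1 / \<rho>, p' $ 2 / \<rho>]"
      have "p' = P s"
        using False 34 p'(2) by (simp add: vec5_eq_iff Pc s_def)
      moreover have "s \<in> sphere 0 1"
        using sq False by (simp add: norm_1_vec2 s_def power_divide flip: add_divide_distrib)
      ultimately show ?thesis
        by blast
    qed
  qed
  have "inj_on P (sphere 0 1)" if lt: "slope * ((q $ 3)\<^sup>2 + (q $ 4)\<^sup>2) < \<bar>q $ 5\<bar>"
  proof -
    have q1: "q = extr (T *\<^sub>R p) 1"
      by (simp add: p(5) extremal_scale)
    have "m * \<bar>(T *\<^sub>R p) $ 5\<bar> = 2 * pi"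
      using p(2,4) by (simp add: abs_mult mult_ac)
    from abs_critical_area[OF this] lt
    have "((T *\<^sub>R p) $ 1)\<^sup>2 + ((T *\<^sub>R p) $ 2)\<^sup>2 \<noteq> 0"
      unfolding q1 by auto
    then have "\<rho> \<noteq> 0"
      using \<rho>(1) by (auto simp: power_mult_distrib simp flip: distrib_left)
    then show ?thesis
      by (intro inj_onI) (simp add: vec5_eq_iff Pc vec_eq_iff forall_2)
  qed
  then show ?thesis
    using optimal_family_extremal[OF p(2,1,4,5), of "sphere 0 1" P, OF 1 Pc(5) 3 4] by blast
qed

end

section \<open>The Hamiltonian flow\<close>

lemma deriv_half_squares:
  fixes a b c d a' b' c' d' :: real
  shows "deriv (\<lambda>s. 1 / 2 * ((a + s * a')\<^sup>2 + (b + s * b')\<^sup>2 + (c + s * c')\<^sup>2 + (d + s * d')\<^sup>2)) 0 =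
    a * a' + b * b' + c * c' + d * d'"
  by (rule DERIV_imp_deriv) (auto intro!: derivative_eq_intros)

lemma deriv_affine: "deriv (\<lambda>s. a + s * b) 0 = (b :: real)"
  by (rule DERIV_imp_deriv) (auto intro!: derivative_eq_intros)

lemma inner_bi_heisenberg:
  "p \<bullet> bi_heisenberg \<alpha>1 \<alpha>2 q $ 1 = p $ 1 - \<alpha>1 / 2 * q $ 2 * p $ 5"
  "p \<bullet> bi_heisenberg \<alpha>1 \<alpha>2 q $ 2 = p $ 2 + \<alpha>1 / 2 * q $ 1 * p $ 5"
  "p \<bullet> bi_heisenberg \<alpha>1 \<alpha>2 q $ 3 = p $ 3 - \<alpha>2 / 2 * q $ 4 * p $ 5"
  "p \<bullet> bi_heisenberg \<alpha>1 \<alpha>2 q $ 4 = p $ 4 + \<alpha>2 / 2 * q $ 3 * p $ 5"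
  by (simp_all add: bi_heisenberg_def inner_vec_def sum_5)

text \<open>The first four components are the pairings of \<open>p\<close> with the frame at \<open>q\<close>.\<close>

definition frame_momenta :: "real \<Rightarrow> real \<Rightarrow> real^5 \<Rightarrow> real^5 \<Rightarrow> real^5" where
  "frame_momenta \<alpha>1 \<alpha>2 q p = vector
     [p $ 1 - \<alpha>1 / 2 * q $ 2 * p $ 5, p $ 2 + \<alpha>1 / 2 * q $ 1 * p $ 5,
      p $ 3 - \<alpha>2 / 2 * q $ 4 * p $ 5, p $ 4 + \<alpha>2 / 2 * q $ 3 * p $ 5, p $ 5]"

lemma frame_momenta_nth [simp]:
  "frame_momenta \<alpha>1 \<alpha>2 q p $ 1 = p $ 1 - \<alpha>1 / 2 * q $ 2 * p $ 5"
  "frame_momenta \<alpha>1 \<alpha>2 q p $ 2 = p $ 2 + \<alpha>1 / 2 * q $ 1 * p $ 5"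
  "frame_momenta \<alpha>1 \<alpha>2 q p $ 3 = p $ 3 - \<alpha>2 / 2 * q $ 4 * p $ 5"
  "frame_momenta \<alpha>1 \<alpha>2 q p $ 4 = p $ 4 + \<alpha>2 / 2 * q $ 3 * p $ 5"
  "frame_momenta \<alpha>1 \<alpha>2 q p $ 5 = p $ 5"
  unfolding frame_momenta_def by (rule vector_5)+

definition costate_deriv :: "real \<Rightarrow> real \<Rightarrow> real \<Rightarrow> real^5 \<Rightarrow> real^5" where
  "costate_deriv \<alpha>1 \<alpha>2 w h = vector
     [- (\<alpha>1 / 2 * w * h $ 2), \<alpha>1 / 2 * w * h $ 1, - (\<alpha>2 / 2 * w * h $ 4), \<alpha>2 / 2 * w * h $ 3, 0]"

lemma sr_hamiltonian_bi_heisenberg: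
  "sr_hamiltonian (bi_heisenberg \<alpha>1 \<alpha>2) (q, p) = 1 / 2 *
     ((p $ 1 - \<alpha>1 / 2 * q $ 2 * p $ 5)\<^sup>2 + (p $ 2 + \<alpha>1 / 2 * q $ 1 * p $ 5)\<^sup>2 +
      (p $ 3 - \<alpha>2 / 2 * q $ 4 * p $ 5)\<^sup>2 + (p $ 4 + \<alpha>2 / 2 * q $ 3 * p $ 5)\<^sup>2)"
  by (simp add: sr_hamiltonian_def sum_4 inner_bi_heisenberg)

lemma hamiltonian_field_bi_heisenberg:
  "hamiltonian_field (sr_hamiltonian (bi_heisenberg \<alpha>1 \<alpha>2)) (q, p) =
    (horizontal_lift \<alpha>1 \<alpha>2 q (frame_momenta \<alpha>1 \<alpha>2 q p),
     costate_deriv \<alpha>1 \<alpha>2 (p $ 5) (frame_momenta \<alpha>1 \<alpha>2 q p))"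
proof -
  let ?H = "sr_hamiltonian (bi_heisenberg \<alpha>1 \<alpha>2)"
  let ?h = "frame_momenta \<alpha>1 \<alpha>2 q p"
  have p_part: "deriv (\<lambda>s. ?H (q, p + s *\<^sub>R v)) 0 =
      ?h $ 1 * (v $ 1 - \<alpha>1 / 2 * q $ 2 * v $ 5) + ?h $ 2 * (v $ 2 + \<alpha>1 / 2 * q $ 1 * v $ 5) +
      ?h $ 3 * (v $ 3 - \<alpha>2 / 2 * q $ 4 * v $ 5) + ?h $ 4 * (v $ 4 + \<alpha>2 / 2 * q $ 3 * v $ 5)" for v
    unfolding deriv_half_squares[symmetric] sr_hamiltonian_bi_heisenberg
    by (simp add: algebra_simps)
  have q_part: "deriv (\<lambda>s. ?H (q + s *\<^sub>R v, p)) 0 =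
      ?h $ 1 * (- (\<alpha>1 / 2 * v $ 2 * p $ 5)) + ?h $ 2 * (\<alpha>1 / 2 * v $ 1 * p $ 5) +
      ?h $ 3 * (- (\<alpha>2 / 2 * v $ 4 * p $ 5)) + ?h $ 4 * (\<alpha>2 / 2 * v $ 3 * p $ 5)" for v
    unfolding deriv_half_squares[symmetric] sr_hamiltonian_bi_heisenberg
    by (simp add: algebra_simps)
  show ?thesis
    unfolding hamiltonian_field_def split_conv p_part q_part
    by (simp add: vec5_eq_iff horizontal_lift_def costate_deriv_def area_form_def del: frame_momenta_nth)
      (simp add: field_simps)
qed

lemma has_vector_derivative_fst_snd:
  assumes "(c has_vector_derivative (a, b)) F"
  shows "((\<lambda>t. fst (c t)) has_vector_derivative a) F" "((\<lambda>t. snd (c t)) has_vector_derivative b) F"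
  using bounded_linear.has_vector_derivative[OF bounded_linear_fst assms]
    bounded_linear.has_vector_derivative[OF bounded_linear_snd assms] by simp_all

section \<open>Solving Hamilton's equations through the frame momenta\<close>

definition costate :: "real \<Rightarrow> real \<Rightarrow> real^5 \<Rightarrow> real^5 \<Rightarrow> real^5" where
  "costate \<alpha>1 \<alpha>2 q h = vector
     [h $ 1 + \<alpha>1 / 2 * q $ 2 * h $ 5, h $ 2 - \<alpha>1 / 2 * q $ 1 * h $ 5,
      h $ 3 + \<alpha>2 / 2 * q $ 4 * h $ 5, h $ 4 - \<alpha>2 / 2 * q $ 3 * h $ 5, h $ 5]"

lemma costate_nth:
  "costate \<alpha>1 \<alpha>2 q h $ 1 = h $ 1 + \<alpha>1 / 2 * q $ 2 * h $ 5"
  "costate \<alpha>1 \<alpha>2 q h $ 2 = h $ 2 - \<alpha>1 / 2 * q $ 1 * h $ 5"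
  "costate \<alpha>1 \<alpha>2 q h $ 3 = h $ 3 + \<alpha>2 / 2 * q $ 4 * h $ 5"
  "costate \<alpha>1 \<alpha>2 q h $ 4 = h $ 4 - \<alpha>2 / 2 * q $ 3 * h $ 5"
  "costate \<alpha>1 \<alpha>2 q h $ 5 = h $ 5"
  unfolding costate_def by (rule vector_5)+

lemma frame_momenta_costate [simp]: "frame_momenta \<alpha>1 \<alpha>2 q (costate \<alpha>1 \<alpha>2 q h) = h"
  by (simp add: vec5_eq_iff costate_nth)

lemma costate_frame_momenta [simp]: "costate \<alpha>1 \<alpha>2 q (frame_momenta \<alpha>1 \<alpha>2 q p) = p"
  by (simp add: vec5_eq_iff costate_nth)

lemma momentum_deriv:
  "((\<lambda>t. momentum \<alpha>1 \<alpha>2 p t $ 1) has_real_derivative - (\<alpha>1 * p $ 5 * momentum \<alpha>1 \<alpha>2 p t $ 2)) (at t)"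
  "((\<lambda>t. momentum \<alpha>1 \<alpha>2 p t $ 2) has_real_derivative \<alpha>1 * p $ 5 * momentum \<alpha>1 \<alpha>2 p t $ 1) (at t)"
  "((\<lambda>t. momentum \<alpha>1 \<alpha>2 p t $ 3) has_real_derivative - (\<alpha>2 * p $ 5 * momentum \<alpha>1 \<alpha>2 p t $ 4)) (at t)"
  "((\<lambda>t. momentum \<alpha>1 \<alpha>2 p t $ 4) has_real_derivative \<alpha>2 * p $ 5 * momentum \<alpha>1 \<alpha>2 p t $ 3) (at t)"
  unfolding momentum_nth by (auto intro!: derivative_eq_intros simp: algebra_simps)

lemma extremal_nth_deriv:
  "((\<lambda>t. extremal \<alpha>1 \<alpha>2 p t $ i) has_real_derivative
     horizontal_lift \<alpha>1 \<alpha>2 (extremal \<alpha>1 \<alpha>2 p t) (momentum \<alpha>1 \<alpha>2 p t) $ i) (at t)"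
  using extremal_deriv[of \<alpha>1 \<alpha>2 p t] unfolding has_vector_derivative_vec_iff by blast

lemma flow_solution:
  "((\<lambda>t. (extremal \<alpha>1 \<alpha>2 p t, costate \<alpha>1 \<alpha>2 (extremal \<alpha>1 \<alpha>2 p t) (momentum \<alpha>1 \<alpha>2 p t)))
    has_vector_derivative hamiltonian_field (sr_hamiltonian (bi_heisenberg \<alpha>1 \<alpha>2))
      (extremal \<alpha>1 \<alpha>2 p t, costate \<alpha>1 \<alpha>2 (extremal \<alpha>1 \<alpha>2 p t) (momentum \<alpha>1 \<alpha>2 p t))) (at t)"
  unfolding hamiltonian_field_bi_heisenberg frame_momenta_costate
proof (rule has_vector_derivative_Pair[OF extremal_deriv])
  let ?q = "extremal \<alpha>1 \<alpha>2 p" and ?h = "momentum \<alpha>1 \<alpha>2 p"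
  have q: "((\<lambda>t. ?q t $ 1) has_real_derivative ?h t $ 1) (at t)" "((\<lambda>t. ?q t $ 2) has_real_derivative ?h t $ 2) (at t)"
    "((\<lambda>t. ?q t $ 3) has_real_derivative ?h t $ 3) (at t)" "((\<lambda>t. ?q t $ 4) has_real_derivative ?h t $ 4) (at t)"
    using extremal_nth_deriv[of \<alpha>1 \<alpha>2 p 1 t] extremal_nth_deriv[of \<alpha>1 \<alpha>2 p 2 t]
      extremal_nth_deriv[of \<alpha>1 \<alpha>2 p 3 t] extremal_nth_deriv[of \<alpha>1 \<alpha>2 p 4 t] by simp_all
  note d = q momentum_deriv[of \<alpha>1 \<alpha>2 p t]
  show "((\<lambda>t. costate \<alpha>1 \<alpha>2 (?q t) (?h t)) has_vector_derivative
      costate_deriv \<alpha>1 \<alpha>2 (costate \<alpha>1 \<alpha>2 (?q t) (?h t) $ 5) (?h t)) (at t)"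
    unfolding has_vector_derivative_vec_iff forall_5 costate_nth costate_deriv_def vector_5 momentum_5
    by (intro conjI; (rule DERIV_cong, (rule derivative_intros d)+)?; simp add: field_simps)
qed

lemma linear_system_unique:
  fixes D E :: "real \<Rightarrow> real"
  assumes D: "\<And>t. (D has_real_derivative - (a * E t)) (at t)" and E: "\<And>t. (E has_real_derivative a * D t) (at t)"
    and 0: "D 0 = 0" "E 0 = 0"
  shows "D t = 0 \<and> E t = 0"
proof -
  have "((\<lambda>t. (D t)\<^sup>2 + (E t)\<^sup>2) has_real_derivative 0) (at t)" for t
    by (rule derivative_eq_intros D E refl)+ (simp add: algebra_simps)
  then have "(D t)\<^sup>2 + (E t)\<^sup>2 = (D 0)\<^sup>2 + (E 0)\<^sup>2"
    by (intro DERIV_isconst_all) auto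
  then show ?thesis
    by (simp add: 0 sum_power2_eq_zero_iff)
qed

text \<open>The multiplier is conserved, so the frame momenta solve a rotation with constant
  coefficients, for which \<open>D^2 + E^2\<close> of a difference is constant. The position then
  follows by integration, planar components first, and no general uniqueness theorem for
  differential equations is invoked.\<close>

lemma flow_unique:
  assumes c0: "c 0 = (0, p)"
    and c: "\<And>t. (c has_vector_derivative hamiltonian_field (sr_hamiltonian (bi_heisenberg \<alpha>1 \<alpha>2)) (c t)) (at t)"
  shows "c t = (extremal \<alpha>1 \<alpha>2 p t, costate \<alpha>1 \<alpha>2 (extremal \<alpha>1 \<alpha>2 p t) (momentum \<alpha>1 \<alpha>2 p t))"
proof -
  define q where "q t = fst (c t)" for t
  define r where "r t = snd (c t)" for t
  define h where "h t = frame_momenta \<alpha>1 \<alpha>2 (q t) (r t)" for t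
  have ct: "c t = (q t, r t)" for t
    by (simp add: q_def r_def)
  have q': "((\<lambda>t. q t $ i) has_real_derivative horizontal_lift \<alpha>1 \<alpha>2 (q t) (h t) $ i) (at t)"
    and r': "((\<lambda>t. r t $ i) has_real_derivative costate_deriv \<alpha>1 \<alpha>2 (r t $ 5) (h t) $ i) (at t)" for i t
    using has_vector_derivative_fst_snd[OF c[of t, unfolded ct[of t] hamiltonian_field_bi_heisenberg]]
    unfolding q_def[symmetric] r_def[symmetric] h_def[symmetric] has_vector_derivative_vec_iff by blast+
  have q0: "q 0 = 0" and r0: "r 0 = p"
    using c0 by (simp_all add: q_def r_def)
  have h0: "h 0 = p"
    by (simp add: h_def q0 r0 vec5_eq_iff)
  have "r t $ 5 = r 0 $ 5" for t
    using r'[of 5] by (intro DERIV_isconst_all) (simp add: costate_deriv_def)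
  then have r5: "r t $ 5 = p $ 5" for t
    by (simp add: r0)
  have qd: "((\<lambda>t. q t $ 1) has_real_derivative h t $ 1) (at t)" "((\<lambda>t. q t $ 2) has_real_derivative h t $ 2) (at t)"
    "((\<lambda>t. q t $ 3) has_real_derivative h t $ 3) (at t)" "((\<lambda>t. q t $ 4) has_real_derivative h t $ 4) (at t)" for t
    using q'[of 1 t] q'[of 2 t] q'[of 3 t] q'[of 4 t] by simp_all
  have rd: "((\<lambda>t. r t $ 1) has_real_derivative - (\<alpha>1 / 2 * p $ 5 * h t $ 2)) (at t)"
    "((\<lambda>t. r t $ 2) has_real_derivative \<alpha>1 / 2 * p $ 5 * h t $ 1) (at t)"
    "((\<lambda>t. r t $ 3) has_real_derivative - (\<alpha>2 / 2 * p $ 5 * h t $ 4)) (at t)"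
    "((\<lambda>t. r t $ 4) has_real_derivative \<alpha>2 / 2 * p $ 5 * h t $ 3) (at t)" for t
    using r'[of 1 t] r'[of 2 t] r'[of 3 t] r'[of 4 t] unfolding costate_deriv_def vector_5 r5 by simp_all
  have hn: "h t $ 1 = r t $ 1 - \<alpha>1 / 2 * p $ 5 * q t $ 2" "h t $ 2 = r t $ 2 + \<alpha>1 / 2 * p $ 5 * q t $ 1"
    "h t $ 3 = r t $ 3 - \<alpha>2 / 2 * p $ 5 * q t $ 4" "h t $ 4 = r t $ 4 + \<alpha>2 / 2 * p $ 5 * q t $ 3" for t
    by (simp_all add: h_def r5)
  have hd1: "((\<lambda>t. h t $ 1) has_real_derivative - (\<alpha>1 * p $ 5 * h t $ 2)) (at t)" for t
    using DERIV_diff[OF rd(1)[of t] DERIV_cmult[OF qd(2)[of t], of "\<alpha>1 / 2 * p $ 5"]]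
    by (simp add: hn(1)[abs_def] mult_ac)
  have hd2: "((\<lambda>t. h t $ 2) has_real_derivative \<alpha>1 * p $ 5 * h t $ 1) (at t)" for t
    using DERIV_add[OF rd(2)[of t] DERIV_cmult[OF qd(1)[of t], of "\<alpha>1 / 2 * p $ 5"]]
    by (simp add: hn(2)[abs_def] mult_ac)
  have hd3: "((\<lambda>t. h t $ 3) has_real_derivative - (\<alpha>2 * p $ 5 * h t $ 4)) (at t)" for t
    using DERIV_diff[OF rd(3)[of t] DERIV_cmult[OF qd(4)[of t], of "\<alpha>2 / 2 * p $ 5"]]
    by (simp add: hn(3)[abs_def] mult_ac)
  have hd4: "((\<lambda>t. h t $ 4) has_real_derivative \<alpha>2 * p $ 5 * h t $ 3) (at t)" for t
    using DERIV_add[OF rd(4)[of t] DERIV_cmult[OF qd(3)[of t], of "\<alpha>2 / 2 * p $ 5"]]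
    by (simp add: hn(4)[abs_def] mult_ac)
  let ?m = "momentum \<alpha>1 \<alpha>2 p" and ?e = "extremal \<alpha>1 \<alpha>2 p"
  note m' = momentum_deriv[of \<alpha>1 \<alpha>2 p]
  have "h t $ 1 - ?m t $ 1 = 0 \<and> h t $ 2 - ?m t $ 2 = 0" for t
    by (rule linear_system_unique[of _ "\<alpha>1 * p $ 5"])
      (use DERIV_diff[OF hd1 m'(1)] DERIV_diff[OF hd2 m'(2)] in \<open>auto simp: h0 algebra_simps\<close>)
  moreover have "h t $ 3 - ?m t $ 3 = 0 \<and> h t $ 4 - ?m t $ 4 = 0" for t
    by (rule linear_system_unique[of _ "\<alpha>2 * p $ 5"])
      (use DERIV_diff[OF hd3 m'(3)] DERIV_diff[OF hd4 m'(4)] in \<open>auto simp: h0 algebra_simps\<close>)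
  moreover have "h t $ 5 = ?m t $ 5" for t
    by (simp add: h_def r5)
  ultimately have hm: "h t = ?m t" for t
    by (simp add: vec5_eq_iff)
  have qe: "q t $ i = ?e t $ i" if "\<And>t. horizontal_lift \<alpha>1 \<alpha>2 (q t) (h t) $ i = horizontal_lift \<alpha>1 \<alpha>2 (?e t) (?m t) $ i" for i t
  proof -
    have "((\<lambda>t. q t $ i - ?e t $ i) has_real_derivative 0) (at t)" for t
      using DERIV_diff[OF q'[of i t] extremal_nth_deriv[of \<alpha>1 \<alpha>2 p i t]] by (simp add: that)
    then have "q t $ i - ?e t $ i = q 0 $ i - ?e 0 $ i"
      by (intro DERIV_isconst_all) auto
    then show ?thesis
      by (simp add: q0)
  qed
  have low: "q t $ 1 = ?e t $ 1" "q t $ 2 = ?e t $ 2" "q t $ 3 = ?e t $ 3" "q t $ 4 = ?e t $ 4" for t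
    by (rule qe; simp add: hm)+
  have "q t $ 5 = ?e t $ 5" for t
    by (rule qe) (simp add: hm area_form_def low)
  then have "q t = ?e t" for t
    using low by (simp add: vec5_eq_iff)
  moreover have "r t = costate \<alpha>1 \<alpha>2 (q t) (h t)" for t
    by (simp add: h_def)
  ultimately show ?thesis
    by (simp add: ct hm)
qed

theorem sr_exp_bi_heisenberg: "sr_exp (bi_heisenberg \<alpha>1 \<alpha>2) 0 p t = extremal \<alpha>1 \<alpha>2 p t"
proof -
  have "hamiltonian_flow (sr_hamiltonian (bi_heisenberg \<alpha>1 \<alpha>2)) (0, p) =
    (\<lambda>t. (extremal \<alpha>1 \<alpha>2 p t, costate \<alpha>1 \<alpha>2 (extremal \<alpha>1 \<alpha>2 p t) (momentum \<alpha>1 \<alpha>2 p t)))"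
    unfolding hamiltonian_flow_def
  proof (rule the_equality)
    show "(extremal \<alpha>1 \<alpha>2 p 0, costate \<alpha>1 \<alpha>2 (extremal \<alpha>1 \<alpha>2 p 0) (momentum \<alpha>1 \<alpha>2 p 0)) = (0, p) \<and>
      (\<forall>t. ((\<lambda>t. (extremal \<alpha>1 \<alpha>2 p t, costate \<alpha>1 \<alpha>2 (extremal \<alpha>1 \<alpha>2 p t) (momentum \<alpha>1 \<alpha>2 p t)))
        has_vector_derivative hamiltonian_field (sr_hamiltonian (bi_heisenberg \<alpha>1 \<alpha>2))
        (extremal \<alpha>1 \<alpha>2 p t, costate \<alpha>1 \<alpha>2 (extremal \<alpha>1 \<alpha>2 p t) (momentum \<alpha>1 \<alpha>2 p t))) (at t))"
      using flow_solution by (simp add: vec5_eq_iff costate_nth)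
  qed (use flow_unique in blast)
  then show ?thesis
    by (simp add: sr_exp_def)
qed

text \<open>A covector that annihilates the frame is determined by its last component and the
  position, so that component is nonzero. Differentiating the annihilation and comparing with the
  costate equation gives opposite signs, so the controls vanish in every plane with nonzero
  \<open>\<alpha>\<close>.\<close>

lemma (in bi_heisenberg_params) extremal_not_abnormal:
  assumes ns: "\<not> straight \<alpha>1 \<alpha>2 p0"
  shows "\<not> abnormal F (extr p0)"
proof
  assume "abnormal F (extr p0)"
  then obtain u :: "real \<Rightarrow> real^4" and p :: "real \<Rightarrow> real^5" where p0: "\<And>t. 0 \<le> t \<Longrightarrow> p t \<noteq> 0"
    and ae: "AE t in lebesgue_on {0..}. ((\<lambda>s. (extr p0 s, p s)) has_vector_derivative
           hamiltonian_field (\<lambda>(q, r). \<Sum>j\<in>UNIV. u t $ j * (r \<bullet> F q $ j)) (extr p0 t, p t)) (at t)"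
    and ann: "\<And>t j. 0 \<le> t \<Longrightarrow> p t \<bullet> F (extr p0 t) $ j = 0"
    unfolding abnormal_def by blast
  obtain N where N: "negligible N" and eq: "\<And>t. t \<in> {0..} - N \<Longrightarrow> ((\<lambda>s. (extr p0 s, p s)) has_vector_derivative
           hamiltonian_field (\<lambda>(q, r). \<Sum>j\<in>UNIV. u t $ j * (r \<bullet> F q $ j)) (extr p0 t, p t)) (at t)"
    using ae by (subst (asm) AE_lebesgue_on_iff) auto
  have "\<not> negligible {0<..<1::real}"
    using negligible_interval(2)[of 0 "1::real"] by auto
  then have "\<not> {0<..<1} \<subseteq> N"
    using negligible_subset[OF N] by blast
  then obtain t where "t \<in> {0<..<1}" and tN: "t \<notin> N"
    by blast
  then have t: "0 < t" "t \<notin> N"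
    by auto
  define q where "q = extr p0 t"
  define r where "r = p t"
  define U where "U = u t"
  let ?h = "\<lambda>(q, r). \<Sum>j\<in>UNIV. U $ j * (r \<bullet> F q $ j)"
  have sum: "(\<Sum>j\<in>UNIV. U $ j * (r \<bullet> F q $ j)) = U $ 1 * (r $ 1 - \<alpha>1 / 2 * q $ 2 * r $ 5)
      + U $ 2 * (r $ 2 + \<alpha>1 / 2 * q $ 1 * r $ 5) + U $ 3 * (r $ 3 - \<alpha>2 / 2 * q $ 4 * r $ 5)
      + U $ 4 * (r $ 4 + \<alpha>2 / 2 * q $ 3 * r $ 5)" for q r :: "real^5"
    by (simp add: sum_4 inner_bi_heisenberg)
  have p_part: "deriv (\<lambda>s. ?h (q, r + s *\<^sub>R v)) 0 = (\<Sum>j\<in>UNIV. U $ j * (v \<bullet> F q $ j))" for v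
    using deriv_affine[of "\<Sum>j\<in>UNIV. U $ j * (r \<bullet> F q $ j)" "\<Sum>j\<in>UNIV. U $ j * (v \<bullet> F q $ j)"]
    by (simp add: inner_add_left distrib_left sum.distrib sum_distrib_left mult_ac)
  have q_part: "deriv (\<lambda>s. ?h (q + s *\<^sub>R v, r)) 0 = U $ 1 * (- (\<alpha>1 / 2 * v $ 2 * r $ 5))
      + U $ 2 * (\<alpha>1 / 2 * v $ 1 * r $ 5) + U $ 3 * (- (\<alpha>2 / 2 * v $ 4 * r $ 5))
      + U $ 4 * (\<alpha>2 / 2 * v $ 3 * r $ 5)" for v
  proof -
    have "?h (q + s *\<^sub>R v, r) = (\<Sum>j\<in>UNIV. U $ j * (r \<bullet> F q $ j)) +
      s * (U $ 1 * (- (\<alpha>1 / 2 * v $ 2 * r $ 5)) + U $ 2 * (\<alpha>1 / 2 * v $ 1 * r $ 5) +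
        U $ 3 * (- (\<alpha>2 / 2 * v $ 4 * r $ 5)) + U $ 4 * (\<alpha>2 / 2 * v $ 3 * r $ 5))" for s
      unfolding split_conv sum by (simp add: algebra_simps)
    then show ?thesis
      by (simp only: deriv_affine)
  qed
  have field: "hamiltonian_field ?h (q, r) =
    (vector [U $ 1, U $ 2, U $ 3, U $ 4, \<alpha>1 / 2 * (q $ 1 * U $ 2 - q $ 2 * U $ 1) + \<alpha>2 / 2 * (q $ 3 * U $ 4 - q $ 4 * U $ 3)],
     vector [- (\<alpha>1 / 2 * r $ 5 * U $ 2), \<alpha>1 / 2 * r $ 5 * U $ 1, - (\<alpha>2 / 2 * r $ 5 * U $ 4), \<alpha>2 / 2 * r $ 5 * U $ 3, 0])"
    unfolding hamiltonian_field_def split_conv[of _ q r] p_part q_part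
    by (simp add: vec5_eq_iff sum) (simp add: field_simps)
  note der = has_vector_derivative_fst_snd[OF eq[of t, unfolded q_def[symmetric] r_def[symmetric] U_def[symmetric] field], simplified]
  have qU: "momentum \<alpha>1 \<alpha>2 p0 t $ 1 = U $ 1 \<and> momentum \<alpha>1 \<alpha>2 p0 t $ 2 = U $ 2 \<and>
      momentum \<alpha>1 \<alpha>2 p0 t $ 3 = U $ 3 \<and> momentum \<alpha>1 \<alpha>2 p0 t $ 4 = U $ 4"
    using vector_derivative_unique_at[OF extremal_deriv der(1)] t by (simp add: vec5_eq_iff)
  have e: "((\<lambda>t. extr p0 t $ 1) has_real_derivative U $ 1) (at t)" "((\<lambda>t. extr p0 t $ 2) has_real_derivative U $ 2) (at t)"
    "((\<lambda>t. extr p0 t $ 3) has_real_derivative U $ 3) (at t)" "((\<lambda>t. extr p0 t $ 4) has_real_derivative U $ 4) (at t)"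
    using extremal_nth_deriv[of \<alpha>1 \<alpha>2 p0 1 t] extremal_nth_deriv[of \<alpha>1 \<alpha>2 p0 2 t]
      extremal_nth_deriv[of \<alpha>1 \<alpha>2 p0 3 t] extremal_nth_deriv[of \<alpha>1 \<alpha>2 p0 4 t] qU by simp_all
  have pd: "((\<lambda>t. p t $ 1) has_real_derivative - (\<alpha>1 / 2 * r $ 5 * U $ 2)) (at t)"
    "((\<lambda>t. p t $ 2) has_real_derivative \<alpha>1 / 2 * r $ 5 * U $ 1) (at t)"
    "((\<lambda>t. p t $ 3) has_real_derivative - (\<alpha>2 / 2 * r $ 5 * U $ 4)) (at t)"
    "((\<lambda>t. p t $ 4) has_real_derivative \<alpha>2 / 2 * r $ 5 * U $ 3) (at t)"
    "((\<lambda>t. p t $ 5) has_real_derivative 0) (at t)"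
    using der(2) t unfolding has_vector_derivative_vec_iff forall_5 by simp_all
  have ann': "p s $ 1 = \<alpha>1 / 2 * (extr p0 s $ 2 * p s $ 5)" "p s $ 2 = - (\<alpha>1 / 2) * (extr p0 s $ 1 * p s $ 5)"
    "p s $ 3 = \<alpha>2 / 2 * (extr p0 s $ 4 * p s $ 5)" "p s $ 4 = - (\<alpha>2 / 2) * (extr p0 s $ 3 * p s $ 5)"
    if "s \<in> {0<..}" for s
    using ann[of s 1] ann[of s 2] ann[of s 3] ann[of s 4] that by (simp_all add: inner_bi_heisenberg)
  have r5: "r $ 5 \<noteq> 0"
    using ann'[of t] p0[of t] t by (auto simp: vec5_eq_iff r_def)
  have tr: "X = Y" if "(f has_real_derivative X) (at t)" "(g has_real_derivative Y) (at t)"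
    "\<And>s. s \<in> {0<..} \<Longrightarrow> f s = g s" for f g :: "real \<Rightarrow> real" and X Y
    using DERIV_unique[OF has_field_derivative_transform_within_open[OF that(1), of "{0<..}" g] that(2)] t that(3) by simp
  have prod: "((\<lambda>s. a * (extr p0 s $ i * p s $ 5)) has_real_derivative a * (X * r $ 5)) (at t)"
    if "((\<lambda>s. extr p0 s $ i) has_real_derivative X) (at t)" for a i X
    using DERIV_cmult[OF DERIV_mult[OF that pd(5)], of a] by (simp add: r_def)
  have "- (\<alpha>1 / 2 * r $ 5 * U $ 2) = \<alpha>1 / 2 * (U $ 2 * r $ 5)"
    by (rule tr[OF pd(1) prod[OF e(2)] ann'(1)])
  moreover have "\<alpha>1 / 2 * r $ 5 * U $ 1 = - (\<alpha>1 / 2) * (U $ 1 * r $ 5)"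
    by (rule tr[OF pd(2) prod[OF e(1)] ann'(2)])
  moreover have "- (\<alpha>2 / 2 * r $ 5 * U $ 4) = \<alpha>2 / 2 * (U $ 4 * r $ 5)"
    by (rule tr[OF pd(3) prod[OF e(4)] ann'(3)])
  moreover have "\<alpha>2 / 2 * r $ 5 * U $ 3 = - (\<alpha>2 / 2) * (U $ 3 * r $ 5)"
    by (rule tr[OF pd(4) prod[OF e(3)] ann'(4)])
  ultimately have "\<alpha>1 = 0 \<or> U $ 1 = 0 \<and> U $ 2 = 0" "\<alpha>2 = 0 \<or> U $ 3 = 0 \<and> U $ 4 = 0"
    using r5 by auto
  then have "straight \<alpha>1 \<alpha>2 (momentum \<alpha>1 \<alpha>2 p0 t)"
    using qU by (auto simp: straight_def)
  then show False
    using ns by simp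
qed

section \<open>Conjugate points\<close>

lemma sin_gt_k_cos:
  assumes "0 < k" "k < pi"
  shows "k * cos k < sin (k::real)"
proof -
  have "sin 0 - 0 * cos 0 < sin k - k * cos (k::real)"
  proof (rule DERIV_pos_imp_increasing_open[OF assms(1)])
    fix x assume x: "0 < x" "x < k"
    have "((\<lambda>x. sin x - x * cos x) has_real_derivative x * sin x) (at x)"
      by (auto intro!: derivative_eq_intros)
    then show "\<exists>y. ((\<lambda>x. sin x - x * cos x) has_real_derivative y) (at x) \<and> 0 < y"
      using x assms sin_gt_zero[of x] by (intro exI[of _ "x * sin x"]) auto
  qed (intro continuous_intros)
  then show ?thesis
    by simp
qed

section \<open>Dependence of \<open>sn\<close> and \<open>sn_area\<close> on the frequency\<close>

lemma sn_param_deriv_k: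
  assumes k: "k \<noteq> 0"
  shows "((\<lambda>k. sn k 1) has_real_derivative (k * cos k - sin k) / k\<^sup>2) (at k)"
    and "((\<lambda>k. sn_area k 1) has_real_derivative (sin k * cos k - k * (cos k)\<^sup>2) / k ^ 3) (at k)"
proof -
  have "((\<lambda>k. sin k / k) has_real_derivative (k * cos k - sin k) / k\<^sup>2) (at k)"
    using k by (auto intro!: derivative_eq_intros simp: power2_eq_square mult_ac)
  then show "((\<lambda>k. sn k 1) has_real_derivative (k * cos k - sin k) / k\<^sup>2) (at k)"
    by (rule has_field_derivative_transform_within_open[of _ _ _ "- {0}"]) (use k in \<open>auto simp: sn_def\<close>)
  have "((\<lambda>k. k - sin k * cos k) has_real_derivative 1 - (cos k * cos k - sin k * sin k)) (at k)"
    by (auto intro!: derivative_eq_intros)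
  moreover have "1 - (cos k * cos k - sin k * sin k) = 2 - 2 * (cos k)\<^sup>2"
    using sin_cos_squared_add[of k] by (simp add: power2_eq_square)
  ultimately have n: "((\<lambda>k. k - sin k * cos k) has_real_derivative 2 - 2 * (cos k)\<^sup>2) (at k)"
    by simp
  have d: "((\<lambda>k. 2 * k\<^sup>2) has_real_derivative 4 * k) (at k)"
    by (auto intro!: derivative_eq_intros)
  have "((\<lambda>k. (k - sin k * cos k) / (2 * k\<^sup>2)) has_real_derivative
      ((2 - 2 * (cos k)\<^sup>2) * (2 * k\<^sup>2) - (k - sin k * cos k) * (4 * k)) / (2 * k\<^sup>2 * (2 * k\<^sup>2))) (at k)"
    by (rule DERIV_divide[OF n d]) (use k in simp)
  moreover have "((2 - 2 * c\<^sup>2) * (2 * k\<^sup>2) - (k - s * c) * (4 * k)) / (2 * k\<^sup>2 * (2 * k\<^sup>2)) = (s * c - k * c\<^sup>2) / k ^ 3" for s c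
    using k by (simp add: divide_simps power2_eq_square power3_eq_cube) (simp add: algebra_simps)
  ultimately have "((\<lambda>k. (k - sin k * cos k) / (2 * k\<^sup>2)) has_real_derivative (sin k * cos k - k * (cos k)\<^sup>2) / k ^ 3) (at k)"
    by simp
  moreover have "sn_area x 1 = (x - sin x * cos x) / (2 * x\<^sup>2)" if "x \<noteq> 0" for x
    using that by (simp add: sn_area_def sn_def power2_eq_square divide_simps)
  ultimately show "((\<lambda>k. sn_area k 1) has_real_derivative (sin k * cos k - k * (cos k)\<^sup>2) / k ^ 3) (at k)"
    by (elim has_field_derivative_transform_within_open[of _ _ _ "- {0}"]) (use k in auto)
qed

text \<open>The positive quantity is the cube of \<open>sn\<close> times the derivative of the area
  ratio in \<open>w\<close>, so its sign states that the area ratio increases below the critical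
  angle. For \<open>\<alpha> = 0\<close> both functions are constant in \<open>w\<close>.\<close>

lemma sn_param_deriv:
  assumes w: "w \<noteq> 0"
  obtains s z where "((\<lambda>w. sn (\<alpha> * w / 2) 1) has_real_derivative s) (at w)"
    "((\<lambda>w. sn_area (\<alpha> * w / 2) 1) has_real_derivative z) (at w)"
    "0 < \<alpha> \<Longrightarrow> \<bar>\<alpha> * w / 2\<bar> < pi \<Longrightarrow> 0 < z * sn (\<alpha> * w / 2) 1 - 2 * s * sn_area (\<alpha> * w / 2) 1"
proof (cases "\<alpha> = 0")
  case True
  show thesis
    by (rule that[of 0 0]) (use True in auto)
next
  case False
  define k where "k = \<alpha> * w / 2"
  have k: "k \<noteq> 0"
    using False w by (simp add: k_def)
  let ?s = "(k * cos k - sin k) / k\<^sup>2" and ?z = "(sin k * cos k - k * (cos k)\<^sup>2) / k ^ 3"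
  have lin: "((\<lambda>w. \<alpha> * w / 2) has_real_derivative \<alpha> / 2) (at w)"
    by (auto intro!: derivative_eq_intros)
  show thesis
  proof (rule that)
    show "((\<lambda>w. sn (\<alpha> * w / 2) 1) has_real_derivative ?s * (\<alpha> / 2)) (at w)"
      by (rule DERIV_chain2[where f = "\<lambda>k. sn k 1" and g = "\<lambda>w. \<alpha> * w / 2", OF _ lin])
        (use sn_param_deriv_k(1)[OF k] in \<open>simp add: k_def\<close>)
    show "((\<lambda>w. sn_area (\<alpha> * w / 2) 1) has_real_derivative ?z * (\<alpha> / 2)) (at w)"
      by (rule DERIV_chain2[where f = "\<lambda>k. sn_area k 1" and g = "\<lambda>w. \<alpha> * w / 2", OF _ lin])
        (use sn_param_deriv_k(2)[OF k] in \<open>simp add: k_def\<close>)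
    assume a: "0 < \<alpha>" and "\<bar>\<alpha> * w / 2\<bar> < pi"
    then have kpi: "\<bar>k\<bar> < pi"
      by (simp add: k_def)
    have "(s * c - k * c\<^sup>2) / k ^ 3 * (s / k) - 2 * ((k * c - s) / k\<^sup>2) * ((1 - s / k * c) / (2 * k)) = (s - k * c) / k ^ 3" for s c
      using k by (simp add: divide_simps power2_eq_square power3_eq_cube) (simp add: algebra_simps)
    from this[of "sin k" "cos k"]
    have eq: "?z * sn k 1 - 2 * ?s * sn_area k 1 = (sin k - k * cos k) / k ^ 3"
      using k by (simp add: sn_area_def sn_def)
    have "0 < (sin k - k * cos k) / k ^ 3"
    proof (cases "0 < k")
      case True
      then show ?thesis
        using sin_gt_k_cos[of k] kpi by simp
    next
      case False
      then have "0 < - k"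
        using k by simp
      then have "sin k - k * cos k < 0" "k ^ 3 < 0"
        using sin_gt_k_cos[of "- k"] kpi by (auto simp: power_less_zero_eq)
      then show ?thesis
        by (rule divide_neg_neg)
    qed
    then have "0 < (\<alpha> / 2) * (?z * sn k 1 - 2 * ?s * sn_area k 1)"
      unfolding eq using a by (intro mult_pos_pos) auto
    also have "\<dots> = ?z * (\<alpha> / 2) * sn k 1 - 2 * (?s * (\<alpha> / 2)) * sn_area k 1"
      by (simp only: right_diff_distrib mult_ac)
    finally show "0 < ?z * (\<alpha> / 2) * sn (\<alpha> * w / 2) 1 - 2 * (?s * (\<alpha> / 2)) * sn_area (\<alpha> * w / 2) 1"
      unfolding k_def .
  qed
qed

section \<open>Differential of the exponential map at time one\<close>

lemma has_derivative_vecI: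
  fixes f :: "'a::real_normed_vector \<Rightarrow> real^'n"
  assumes "\<And>i. ((\<lambda>x. f x $ i) has_derivative (\<lambda>x. f' x $ i)) (at x within S)"
  shows "(f has_derivative f') (at x within S)"
  unfolding has_derivative_componentwise_within[of f]
  using assms by (auto simp: Basis_vec_def inner_axis)

lemma has_derivative_nth: "((\<lambda>P :: real^'n. P $ i) has_derivative (\<lambda>\<xi>. \<xi> $ i)) F"
  by (rule bounded_linear_imp_has_derivative[OF bounded_linear_vec_nth])

text \<open>The differential of \<open>P \<mapsto> extremal \<alpha>1 \<alpha>2 P 1\<close>, where \<open>s\<^sub>j\<close> and \<open>z\<^sub>j\<close> stand for the derivatives of
  \<open>sn\<close> and \<open>sn_area\<close> with respect to \<open>P\<^sub>5\<close>.  The planar components are written in the frame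
  rotated by the angle \<open>k\<^sub>j\<close>.\<close>

definition extremal_differential ::
  "real \<Rightarrow> real \<Rightarrow> real \<Rightarrow> real \<Rightarrow> real \<Rightarrow> real \<Rightarrow> real^5 \<Rightarrow> real^5 \<Rightarrow> real^5" where
  "extremal_differential \<alpha>1 \<alpha>2 s1 z1 s2 z2 P \<xi> = (let
     k1 = \<alpha>1 * P $ 5 / 2; k2 = \<alpha>2 * P $ 5 / 2;
     u1 = sn k1 1 * (\<xi> $ 1 - \<alpha>1 / 2 * \<xi> $ 5 * P $ 2) + \<xi> $ 5 * s1 * P $ 1;
     v1 = sn k1 1 * (\<xi> $ 2 + \<alpha>1 / 2 * \<xi> $ 5 * P $ 1) + \<xi> $ 5 * s1 * P $ 2;
     u2 = sn k2 1 * (\<xi> $ 3 - \<alpha>2 / 2 * \<xi> $ 5 * P $ 4) + \<xi> $ 5 * s2 * P $ 3;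
     v2 = sn k2 1 * (\<xi> $ 4 + \<alpha>2 / 2 * \<xi> $ 5 * P $ 3) + \<xi> $ 5 * s2 * P $ 4
   in vector
     [u1 * cos k1 - v1 * sin k1, u1 * sin k1 + v1 * cos k1,
      u2 * cos k2 - v2 * sin k2, u2 * sin k2 + v2 * cos k2,
      \<alpha>1 / 2 * (2 * (P $ 1 * \<xi> $ 1 + P $ 2 * \<xi> $ 2) * sn_area k1 1 + ((P $ 1)\<^sup>2 + (P $ 2)\<^sup>2) * (\<xi> $ 5 * z1)) +
      \<alpha>2 / 2 * (2 * (P $ 3 * \<xi> $ 3 + P $ 4 * \<xi> $ 4) * sn_area k2 1 + ((P $ 3)\<^sup>2 + (P $ 4)\<^sup>2) * (\<xi> $ 5 * z2))])"

lemma extremal_has_derivative: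
  assumes s1: "((\<lambda>w. sn (\<alpha>1 * w / 2) 1) has_real_derivative s1) (at (P $ 5))"
    and z1: "((\<lambda>w. sn_area (\<alpha>1 * w / 2) 1) has_real_derivative z1) (at (P $ 5))"
    and s2: "((\<lambda>w. sn (\<alpha>2 * w / 2) 1) has_real_derivative s2) (at (P $ 5))"
    and z2: "((\<lambda>w. sn_area (\<alpha>2 * w / 2) 1) has_real_derivative z2) (at (P $ 5))"
  shows "((\<lambda>P. extremal \<alpha>1 \<alpha>2 P 1) has_derivative extremal_differential \<alpha>1 \<alpha>2 s1 z1 s2 z2 P) (at P)"
proof (rule has_derivative_vecI)
  fix i :: 5
  let ?F = "at P :: (real^5) filter"
  note nth = has_derivative_nth[where 'n = 5]
  have cos: "((\<lambda>P :: real^5. cos (\<alpha> * P $ 5 / 2)) has_derivative (\<lambda>\<xi>. \<xi> $ 5 * (- sin (\<alpha> * P $ 5 / 2) * (\<alpha> / 2)))) ?F"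
    and sin: "((\<lambda>P :: real^5. sin (\<alpha> * P $ 5 / 2)) has_derivative (\<lambda>\<xi>. \<xi> $ 5 * (cos (\<alpha> * P $ 5 / 2) * (\<alpha> / 2)))) ?F" for \<alpha>
  proof -
    have "((\<lambda>w. cos (\<alpha> * w / 2)) has_real_derivative - sin (\<alpha> * P $ 5 / 2) * (\<alpha> / 2)) (at (P $ 5))"
      by (auto intro!: derivative_eq_intros)
    from DERIV_compose_FDERIV[OF this nth]
    show "((\<lambda>P :: real^5. cos (\<alpha> * P $ 5 / 2)) has_derivative (\<lambda>\<xi>. \<xi> $ 5 * (- sin (\<alpha> * P $ 5 / 2) * (\<alpha> / 2)))) ?F" .
    have "((\<lambda>w. sin (\<alpha> * w / 2)) has_real_derivative cos (\<alpha> * P $ 5 / 2) * (\<alpha> / 2)) (at (P $ 5))"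
      by (auto intro!: derivative_eq_intros)
    from DERIV_compose_FDERIV[OF this nth]
    show "((\<lambda>P :: real^5. sin (\<alpha> * P $ 5 / 2)) has_derivative (\<lambda>\<xi>. \<xi> $ 5 * (cos (\<alpha> * P $ 5 / 2) * (\<alpha> / 2)))) ?F" .
  qed
  note S1 = DERIV_compose_FDERIV[OF s1 nth] and Z1 = DERIV_compose_FDERIV[OF z1 nth]
    and S2 = DERIV_compose_FDERIV[OF s2 nth] and Z2 = DERIV_compose_FDERIV[OF z2 nth]
  have x: "((\<lambda>P. sn (\<alpha> * P $ 5 / 2) 1 * (P $ a * cos (\<alpha> * P $ 5 / 2) - P $ b * sin (\<alpha> * P $ 5 / 2))) has_derivative
      (\<lambda>\<xi>. (sn (\<alpha> * P $ 5 / 2) 1 * (\<xi> $ a - \<alpha> / 2 * \<xi> $ 5 * P $ b) + \<xi> $ 5 * s * P $ a) * cos (\<alpha> * P $ 5 / 2) -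
        (sn (\<alpha> * P $ 5 / 2) 1 * (\<xi> $ b + \<alpha> / 2 * \<xi> $ 5 * P $ a) + \<xi> $ 5 * s * P $ b) * sin (\<alpha> * P $ 5 / 2))) ?F"
    if S: "((\<lambda>P. sn (\<alpha> * P $ 5 / 2) 1) has_derivative (\<lambda>\<xi>. \<xi> $ 5 * s)) ?F" for \<alpha> s a b
    by (rule has_derivative_eq_rhs[OF has_derivative_mult[OF S has_derivative_diff[OF
            has_derivative_mult[OF nth cos] has_derivative_mult[OF nth sin]]]])
        (simp add: fun_eq_iff algebra_simps)
  have y: "((\<lambda>P. sn (\<alpha> * P $ 5 / 2) 1 * (P $ a * sin (\<alpha> * P $ 5 / 2) + P $ b * cos (\<alpha> * P $ 5 / 2))) has_derivative
      (\<lambda>\<xi>. (sn (\<alpha> * P $ 5 / 2) 1 * (\<xi> $ a - \<alpha> / 2 * \<xi> $ 5 * P $ b) + \<xi> $ 5 * s * P $ a) * sin (\<alpha> * P $ 5 / 2) +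
        (sn (\<alpha> * P $ 5 / 2) 1 * (\<xi> $ b + \<alpha> / 2 * \<xi> $ 5 * P $ a) + \<xi> $ 5 * s * P $ b) * cos (\<alpha> * P $ 5 / 2))) ?F"
    if S: "((\<lambda>P. sn (\<alpha> * P $ 5 / 2) 1) has_derivative (\<lambda>\<xi>. \<xi> $ 5 * s)) ?F" for \<alpha> s a b
    by (rule has_derivative_eq_rhs[OF has_derivative_mult[OF S has_derivative_add[OF
            has_derivative_mult[OF nth sin] has_derivative_mult[OF nth cos]]]])
        (simp add: fun_eq_iff algebra_simps)
  have z: "((\<lambda>P. \<alpha> / 2 * ((P $ a)\<^sup>2 + (P $ b)\<^sup>2) * sn_area (\<alpha> * P $ 5 / 2) 1) has_derivative
      (\<lambda>\<xi>. \<alpha> / 2 * (2 * (P $ a * \<xi> $ a + P $ b * \<xi> $ b) * sn_area (\<alpha> * P $ 5 / 2) 1 + ((P $ a)\<^sup>2 + (P $ b)\<^sup>2) * (\<xi> $ 5 * c)))) ?F"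
    if Z: "((\<lambda>P. sn_area (\<alpha> * P $ 5 / 2) 1) has_derivative (\<lambda>\<xi>. \<xi> $ 5 * c)) ?F" for \<alpha> c a b
    unfolding power2_eq_square
    by (rule has_derivative_eq_rhs[OF has_derivative_mult[OF has_derivative_mult[OF has_derivative_const
            has_derivative_add[OF has_derivative_mult[OF nth nth] has_derivative_mult[OF nth nth]]] Z]])
      (simp add: fun_eq_iff algebra_simps)
  consider "i = 1" | "i = 2" | "i = 3" | "i = 4" | "i = 5"
    using exhaust_5 by blast
  then show "((\<lambda>P. extremal \<alpha>1 \<alpha>2 P 1 $ i) has_derivative (\<lambda>\<xi>. extremal_differential \<alpha>1 \<alpha>2 s1 z1 s2 z2 P \<xi> $ i)) ?F"
  proof cases
    case 1 then show ?thesis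
      using x[OF S1, of 1 2] by (simp only: extremal_nth extremal_differential_def Let_def vector_5 mult_1_right)
  next
    case 2 then show ?thesis
      using y[OF S1, of 1 2] by (simp only: extremal_nth extremal_differential_def Let_def vector_5 mult_1_right)
  next
    case 3 then show ?thesis
      using x[OF S2, of 3 4] by (simp only: extremal_nth extremal_differential_def Let_def vector_5 mult_1_right)
  next
    case 4 then show ?thesis
      using y[OF S2, of 3 4] by (simp only: extremal_nth extremal_differential_def Let_def vector_5 mult_1_right)
  next
    case 5 then show ?thesis
      using has_derivative_add[OF z[OF Z1, of 1 2] z[OF Z2, of 3 4]]
      by (simp only: extremal_nth extremal_differential_def Let_def vector_5)
  qed
qed

lemma extremal_differential_nth:
  fixes \<alpha>1 \<alpha>2 s1 z1 s2 z2 :: real and P \<xi> :: "real^5"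
  defines "k1 \<equiv> \<alpha>1 * P $ 5 / 2" and "k2 \<equiv> \<alpha>2 * P $ 5 / 2"
  defines "u1 \<equiv> sn k1 1 * (\<xi> $ 1 - \<alpha>1 / 2 * \<xi> $ 5 * P $ 2) + \<xi> $ 5 * s1 * P $ 1"
    and "v1 \<equiv> sn k1 1 * (\<xi> $ 2 + \<alpha>1 / 2 * \<xi> $ 5 * P $ 1) + \<xi> $ 5 * s1 * P $ 2"
    and "u2 \<equiv> sn k2 1 * (\<xi> $ 3 - \<alpha>2 / 2 * \<xi> $ 5 * P $ 4) + \<xi> $ 5 * s2 * P $ 3"
    and "v2 \<equiv> sn k2 1 * (\<xi> $ 4 + \<alpha>2 / 2 * \<xi> $ 5 * P $ 3) + \<xi> $ 5 * s2 * P $ 4"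
  shows "extremal_differential \<alpha>1 \<alpha>2 s1 z1 s2 z2 P \<xi> $ 1 = u1 * cos k1 - v1 * sin k1"
    "extremal_differential \<alpha>1 \<alpha>2 s1 z1 s2 z2 P \<xi> $ 2 = u1 * sin k1 + v1 * cos k1"
    "extremal_differential \<alpha>1 \<alpha>2 s1 z1 s2 z2 P \<xi> $ 3 = u2 * cos k2 - v2 * sin k2"
    "extremal_differential \<alpha>1 \<alpha>2 s1 z1 s2 z2 P \<xi> $ 4 = u2 * sin k2 + v2 * cos k2"
    "extremal_differential \<alpha>1 \<alpha>2 s1 z1 s2 z2 P \<xi> $ 5 =
      \<alpha>1 / 2 * (2 * (P $ 1 * \<xi> $ 1 + P $ 2 * \<xi> $ 2) * sn_area k1 1 + ((P $ 1)\<^sup>2 + (P $ 2)\<^sup>2) * (\<xi> $ 5 * z1)) +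
      \<alpha>2 / 2 * (2 * (P $ 3 * \<xi> $ 3 + P $ 4 * \<xi> $ 4) * sn_area k2 1 + ((P $ 3)\<^sup>2 + (P $ 4)\<^sup>2) * (\<xi> $ 5 * z2))"
  unfolding extremal_differential_def Let_def assms by (rule vector_5)+

text \<open>Eliminating \<open>\<xi>\<^sub>1, \<dots>, \<xi>\<^sub>4\<close> from the kernel equations leaves \<open>\<xi>\<^sub>5\<close> times a sum of nonnegative
  terms, which are positive in the planes where the extremal is curved.\<close>

lemma kernel_plane:
  assumes u: "\<sigma> * (a - \<kappa> * w * q) + w * s * p = 0" and v: "\<sigma> * (b + \<kappa> * w * p) + w * s * q = (0::real)"
    and \<sigma>: "\<sigma> \<noteq> 0"
  shows "2 * (p * a + q * b) * A + (p\<^sup>2 + q\<^sup>2) * (w * z) = w * ((p\<^sup>2 + q\<^sup>2) * ((z * \<sigma> - 2 * s * A) / \<sigma>))"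
proof -
  have "\<sigma> * (p * a + q * b) = p * (\<sigma> * (a - \<kappa> * w * q) + w * s * p) + q * (\<sigma> * (b + \<kappa> * w * p) + w * s * q)
      - w * s * (p\<^sup>2 + q\<^sup>2)"
    by (simp add: algebra_simps power2_eq_square)
  then have "\<sigma> * (p * a + q * b) = - (w * s * (p\<^sup>2 + q\<^sup>2))"
    unfolding u v by simp
  moreover have "X = Y / \<sigma>" if "\<sigma> * X = Y" for X Y
    using that \<sigma> by auto
  ultimately have "p * a + q * b = - (w * s * (p\<^sup>2 + q\<^sup>2)) / \<sigma>"
    by blast
  then have "2 * (p * a + q * b) * A + (p\<^sup>2 + q\<^sup>2) * (w * z)
      = 2 * (- (w * s * (p\<^sup>2 + q\<^sup>2)) / \<sigma>) * A + (p\<^sup>2 + q\<^sup>2) * (w * z)"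
    by (simp only:)
  also have "\<dots> = w * (R * ((z * \<sigma> - 2 * s * A) / \<sigma>))" if "R = p\<^sup>2 + q\<^sup>2" for R
    unfolding that[symmetric] using \<sigma> by (simp add: diff_divide_distrib algebra_simps)
  finally show ?thesis
    by blast
qed

lemma rotation_eq_0:
  "u * cos k - v * sin k = 0 \<Longrightarrow> u * sin k + v * cos k = 0 \<Longrightarrow> u = 0 \<and> v = (0::real)"
  using rotation_squares[of u k v] by (simp add: sum_power2_eq_zero_iff)

context bi_heisenberg_params
begin

section \<open>Critical points of the exponential map\<close>

lemma unit_covectors_tangent_0:
  "unit_covectors_tangent F 0 p = {\<xi>. p $ 1 * \<xi> $ 1 + p $ 2 * \<xi> $ 2 + p $ 3 * \<xi> $ 3 + p $ 4 * \<xi> $ 4 = 0}"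
proof -
  have H: "(\<lambda>p. sr_hamiltonian F (0, p)) =
    (\<lambda>p. 1 / 2 * (p $ 1 * p $ 1 + p $ 2 * p $ 2 + p $ 3 * p $ 3 + p $ 4 * p $ 4))"
    by (simp add: sr_hamiltonian_bi_heisenberg power2_eq_square fun_eq_iff)
  note nth = has_derivative_nth[where 'n = 5]
  have "((\<lambda>p. sr_hamiltonian F (0, p)) has_derivative
    (\<lambda>\<xi>. p $ 1 * \<xi> $ 1 + p $ 2 * \<xi> $ 2 + p $ 3 * \<xi> $ 3 + p $ 4 * \<xi> $ 4)) (at p)"
    unfolding H
    by (rule has_derivative_eq_rhs[OF has_derivative_mult[OF has_derivative_const
          has_derivative_add[OF has_derivative_add[OF has_derivative_add[OF
            has_derivative_mult[OF nth nth] has_derivative_mult[OF nth nth]]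
            has_derivative_mult[OF nth nth]] has_derivative_mult[OF nth nth]]]])
      (simp add: fun_eq_iff algebra_simps)
  from frechet_derivative_at[OF this, symmetric] show ?thesis
    by (simp add: unit_covectors_tangent_def)
qed

text \<open>By homogeneity \<open>exp (p, s) = exp (s p, 1)\<close>, so the differential of the exponential map at
  \<open>(p, t)\<close> is that of \<open>extr \<sqdot> 1\<close> at \<open>t p\<close>.\<close>

lemma exp_critical_iff:
  assumes p: "hnorm p = 1" and t: "0 < t"
    and D: "((\<lambda>P. extr P 1) has_derivative D) (at (t *\<^sub>R p))"
  shows "exp_critical F 0 p t \<longleftrightarrow> range D \<noteq> UNIV"
proof -
  have "((\<lambda>x. snd x *\<^sub>R fst x) has_derivative (\<lambda>(\<xi>, \<tau>). t *\<^sub>R \<xi> + \<tau> *\<^sub>R p)) (at (p, t))"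
    by (auto intro!: derivative_eq_intros)
  from has_derivative_compose[OF this, of "\<lambda>P. extr P 1" D] D
  have hd: "((\<lambda>x. extr (snd x *\<^sub>R fst x) 1) has_derivative (\<lambda>x. D (t *\<^sub>R fst x + snd x *\<^sub>R p))) (at (p, t))"
    by (simp add: case_prod_unfold)
  have eq: "(\<lambda>(p, s). sr_exp F 0 p s) = (\<lambda>x. extr (snd x *\<^sub>R fst x) 1)"
    by (simp add: sr_exp_bi_heisenberg extremal_scale fun_eq_iff)
  have fd: "frechet_derivative (\<lambda>(p, s). sr_exp F 0 p s) (at (p, t)) = (\<lambda>x. D (t *\<^sub>R fst x + snd x *\<^sub>R p))"
    unfolding eq by (rule frechet_derivative_at[OF hd, symmetric])
  have "(\<lambda>x. D (t *\<^sub>R fst x + snd x *\<^sub>R p)) ` (unit_covectors_tangent F 0 p \<times> UNIV) = range D"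
  proof (intro equalityI subsetI)
    fix v assume "v \<in> range D"
    then obtain \<eta> where v: "v = D \<eta>"
      by blast
    \<comment> \<open>An arbitrary \<open>\<eta>\<close> is split as
      \<open>t \<xi> + \<tau> p\<close>, where \<open>\<tau>\<close> is its planar inner product
      with \<open>p\<close>. Since \<open>hnorm p = 1\<close>, the remainder \<open>\<xi>\<close> is
      tangent to the unit covectors.\<close>
    define \<tau> where "\<tau> = p $ 1 * \<eta> $ 1 + p $ 2 * \<eta> $ 2 + p $ 3 * \<eta> $ 3 + p $ 4 * \<eta> $ 4"
    define \<xi> where "\<xi> = (1 / t) *\<^sub>R (\<eta> - \<tau> *\<^sub>R p)"
    have "p $ 1 * \<xi> $ 1 + p $ 2 * \<xi> $ 2 + p $ 3 * \<xi> $ 3 + p $ 4 * \<xi> $ 4 = (1 / t) * (\<tau> - \<tau> * (hnorm p)\<^sup>2)"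
    proof -
      have "a * ((A - \<tau> * a) / t) + b * ((B - \<tau> * b) / t) + c * ((C - \<tau> * c) / t) + d * ((D - \<tau> * d) / t)
          = 1 / t * ((a * A + b * B + c * C + d * D) - \<tau> * (a\<^sup>2 + b\<^sup>2 + c\<^sup>2 + d\<^sup>2))" for a b c d A B C D
        by (simp add: power2_eq_square add_divide_distrib diff_divide_distrib algebra_simps)
      moreover have "\<xi> $ i = (\<eta> $ i - \<tau> * p $ i) / t" for i
        by (simp add: \<xi>_def)
      ultimately show ?thesis
        unfolding hnorm_squared by (simp only: \<tau>_def[symmetric])
    qed
    then have "\<xi> \<in> unit_covectors_tangent F 0 p"
      using p by (simp add: unit_covectors_tangent_0)
    moreover have "v = D (t *\<^sub>R \<xi> + \<tau> *\<^sub>R p)"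
      using t by (simp add: v \<xi>_def)
    ultimately show "v \<in> (\<lambda>x. D (t *\<^sub>R fst x + snd x *\<^sub>R p)) ` (unit_covectors_tangent F 0 p \<times> UNIV)"
      by (intro image_eqI[of _ _ "(\<xi>, \<tau>)"]) auto
  qed auto
  then show ?thesis
    unfolding exp_critical_def fd by simp
qed

text \<open>Source and target both have dimension five, so a trivial kernel suffices.
  \<open>kernel_plane\<close> reduces the kernel equations to \<open>\<xi> $ 5\<close> times a
  positive coefficient, positive because some plane with nonzero \<open>\<alpha>\<close> is in
  motion.\<close>

lemma extremal_noncritical:
  assumes p: "hnorm p = 1" and ns: "\<not> straight \<alpha>1 \<alpha>2 p" and t: "0 < t" and w: "p $ 5 \<noteq> 0"
    and lt: "m * \<bar>p $ 5\<bar> * t < 2 * pi"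
  shows "\<not> exp_critical F 0 p t"
proof -
  define P where "P = t *\<^sub>R p"
  have P5: "P $ 5 \<noteq> 0"
    using w t by (simp add: P_def)
  have ns': "\<not> straight \<alpha>1 \<alpha>2 P"
    using ns t by (simp add: P_def straight_scale)
  have k: "\<bar>\<alpha> * P $ 5 / 2\<bar> < pi" if "0 \<le> \<alpha>" "\<alpha> \<le> m" for \<alpha>
  proof -
    have "\<alpha> * (\<bar>p $ 5\<bar> * t) \<le> m * (\<bar>p $ 5\<bar> * t)"
      using that(2) t by (intro mult_right_mono) auto
    then have "\<alpha> * (\<bar>p $ 5\<bar> * t) < 2 * pi"
      using lt by (simp only: mult.assoc)
    moreover have "\<bar>\<alpha> * P $ 5 / 2\<bar> = \<alpha> * (\<bar>p $ 5\<bar> * t) / 2"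
      using that(1) t by (simp add: P_def abs_mult)
    ultimately show ?thesis
      by linarith
  qed
  have k1: "\<bar>\<alpha>1 * P $ 5 / 2\<bar> < pi" and k2: "\<bar>\<alpha>2 * P $ 5 / 2\<bar> < pi"
    using k \<alpha>1_nonneg \<alpha>2_nonneg by auto
  have sn: "0 < sn k 1" if "\<bar>k\<bar> < pi" for k
    using that sn_pos[of k] sn_pos[of "- k"] by (cases "0 \<le> k") (auto simp: sn_minus)
  obtain s1 z1 where 1: "((\<lambda>w. sn (\<alpha>1 * w / 2) 1) has_real_derivative s1) (at (P $ 5))"
    "((\<lambda>w. sn_area (\<alpha>1 * w / 2) 1) has_real_derivative z1) (at (P $ 5))"
    and pos1: "0 < \<alpha>1 \<Longrightarrow> \<bar>\<alpha>1 * P $ 5 / 2\<bar> < pi \<Longrightarrow> 0 < z1 * sn (\<alpha>1 * P $ 5 / 2) 1 - 2 * s1 * sn_area (\<alpha>1 * P $ 5 / 2) 1"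
    using sn_param_deriv[OF P5] by blast
  obtain s2 z2 where 2: "((\<lambda>w. sn (\<alpha>2 * w / 2) 1) has_real_derivative s2) (at (P $ 5))"
    "((\<lambda>w. sn_area (\<alpha>2 * w / 2) 1) has_real_derivative z2) (at (P $ 5))"
    and pos2: "0 < \<alpha>2 \<Longrightarrow> \<bar>\<alpha>2 * P $ 5 / 2\<bar> < pi \<Longrightarrow> 0 < z2 * sn (\<alpha>2 * P $ 5 / 2) 1 - 2 * s2 * sn_area (\<alpha>2 * P $ 5 / 2) 1"
    using sn_param_deriv[OF P5] by blast
  define D where "D = extremal_differential \<alpha>1 \<alpha>2 s1 z1 s2 z2 P"
  have D: "((\<lambda>P. extr P 1) has_derivative D) (at P)"
    unfolding D_def by (rule extremal_has_derivative[OF 1 2])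
  have lin: "linear D"
    using D has_derivative_bounded_linear bounded_linear.linear by blast
  define R1 where "R1 = \<alpha>1 * ((P $ 1)\<^sup>2 + (P $ 2)\<^sup>2)"
  define R2 where "R2 = \<alpha>2 * ((P $ 3)\<^sup>2 + (P $ 4)\<^sup>2)"
  define c1 where "c1 = (z1 * sn (\<alpha>1 * P $ 5 / 2) 1 - 2 * s1 * sn_area (\<alpha>1 * P $ 5 / 2) 1) / sn (\<alpha>1 * P $ 5 / 2) 1"
  define c2 where "c2 = (z2 * sn (\<alpha>2 * P $ 5 / 2) 1 - 2 * s2 * sn_area (\<alpha>2 * P $ 5 / 2) 1) / sn (\<alpha>2 * P $ 5 / 2) 1"
  have "R1 \<noteq> 0 \<or> R2 \<noteq> 0"
    using ns' by (auto simp: straight_def R1_def R2_def)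
  moreover have "0 \<le> R1" "0 \<le> R2"
    using \<alpha>1_nonneg \<alpha>2_nonneg by (auto simp: R1_def R2_def)
  moreover have "R1 \<noteq> 0 \<Longrightarrow> 0 < c1"
    unfolding c1_def using pos1[OF _ k1] sn[OF k1] \<alpha>1_nonneg by (intro divide_pos_pos) (auto simp: R1_def)
  moreover have "R2 \<noteq> 0 \<Longrightarrow> 0 < c2"
    unfolding c2_def using pos2[OF _ k2] sn[OF k2] \<alpha>2_nonneg by (intro divide_pos_pos) (auto simp: R2_def)
  ultimately have "0 < R1 * c1 + R2 * c2"
    by (cases "R1 = 0"; cases "R2 = 0") (auto intro: add_pos_pos mult_pos_pos)
  then have coeff: "R1 * c1 + R2 * c2 \<noteq> 0"
    by simp
  have "\<xi> = 0" if 0: "D \<xi> = 0" for \<xi>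
  proof -
    note n = extremal_differential_nth[of \<alpha>1 \<alpha>2 s1 z1 s2 z2 P \<xi>, folded D_def, unfolded 0 zero_index]
    let ?k1 = "\<alpha>1 * P $ 5 / 2" and ?k2 = "\<alpha>2 * P $ 5 / 2"
    have u1: "sn ?k1 1 * (\<xi> $ 1 - \<alpha>1 / 2 * \<xi> $ 5 * P $ 2) + \<xi> $ 5 * s1 * P $ 1 = 0"
      and v1: "sn ?k1 1 * (\<xi> $ 2 + \<alpha>1 / 2 * \<xi> $ 5 * P $ 1) + \<xi> $ 5 * s1 * P $ 2 = 0"
      using rotation_eq_0[OF n(1)[symmetric] n(2)[symmetric]] by blast+
    have u2: "sn ?k2 1 * (\<xi> $ 3 - \<alpha>2 / 2 * \<xi> $ 5 * P $ 4) + \<xi> $ 5 * s2 * P $ 3 = 0"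
      and v2: "sn ?k2 1 * (\<xi> $ 4 + \<alpha>2 / 2 * \<xi> $ 5 * P $ 3) + \<xi> $ 5 * s2 * P $ 4 = 0"
      using rotation_eq_0[OF n(3)[symmetric] n(4)[symmetric]] by blast+
    have s0: "sn ?k1 1 \<noteq> 0" "sn ?k2 1 \<noteq> 0"
      using sn[OF k1] sn[OF k2] by auto
    have "0 = \<xi> $ 5 / 2 * (R1 * c1 + R2 * c2)"
      using n(5)[unfolded kernel_plane[OF u1 v1 s0(1)] kernel_plane[OF u2 v2 s0(2)], folded c1_def c2_def]
      by (simp add: R1_def R2_def algebra_simps add_divide_distrib)
    then have "\<xi> $ 5 = 0"
      using coeff by simp
    then show ?thesis
      using u1 v1 u2 v2 s0 by (simp add: vec5_eq_iff)
  qed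
  then have "inj D"
    using lin by (auto simp: linear_injective_0)
  then have "range D = UNIV"
    using lin linear_injective_imp_surjective by blast
  then show ?thesis
    using exp_critical_iff[OF p t D[unfolded P_def]] by simp
qed

text \<open>In a plane of maximal \<open>\<alpha>\<close> both \<open>sn\<close> and
  \<open>sin\<close> vanish at the critical time, so the differential maps into multiples of the
  velocity there. Its projection to that plane has rank at most one.\<close>

lemma extremal_critical:
  assumes p: "hnorm p = 1" and t: "0 < t" and mt: "m * \<bar>p $ 5\<bar> * t = 2 * pi"
  shows "exp_critical F 0 p t"
proof -
  define P where "P = t *\<^sub>R p"
  have w: "P $ 5 \<noteq> 0"
    using mt t by (auto simp: P_def)
  obtain s1 z1 where 1: "((\<lambda>w. sn (\<alpha>1 * w / 2) 1) has_real_derivative s1) (at (P $ 5))"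
    "((\<lambda>w. sn_area (\<alpha>1 * w / 2) 1) has_real_derivative z1) (at (P $ 5))"
    using sn_param_deriv[OF w] by blast
  obtain s2 z2 where 2: "((\<lambda>w. sn (\<alpha>2 * w / 2) 1) has_real_derivative s2) (at (P $ 5))"
    "((\<lambda>w. sn_area (\<alpha>2 * w / 2) 1) has_real_derivative z2) (at (P $ 5))"
    using sn_param_deriv[OF w] by blast
  define D where "D = extremal_differential \<alpha>1 \<alpha>2 s1 z1 s2 z2 P"
  have D: "((\<lambda>P. extr P 1) has_derivative D) (at P)"
    unfolding D_def by (rule extremal_has_derivative[OF 1 2])
  note n = extremal_differential_nth[of \<alpha>1 \<alpha>2 s1 z1 s2 z2 P, folded D_def]
  have crit: "sin (\<alpha> * P $ 5 / 2) = 0 \<and> sn (\<alpha> * P $ 5 / 2) 1 = 0" if "m = \<alpha>" for \<alpha>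
  proof -
    have "\<bar>\<alpha> * P $ 5 / 2\<bar> = pi"
      using mt t m_pos that by (simp add: P_def abs_mult mult_ac)
    then show ?thesis
      using extremal_critical_plane(1)[of "\<alpha> * P $ 5 / 2" 1] sin_pi_abs by simp
  qed
  have "range D \<noteq> UNIV"
  proof
    assume UNIV: "range D = UNIV"
    have surj: "\<exists>\<xi>. D \<xi> = v" for v
      using UNIV by (metis UNIV_I imageE)
    show False
    proof (cases "m = \<alpha>1")
      case True
      note c = crit[OF True]
      have *: "P $ 2 * D \<xi> $ 1 = P $ 1 * D \<xi> $ 2" "P $ 1 = 0 \<Longrightarrow> D \<xi> $ 1 = 0" for \<xi>
        using n(1,2)[of \<xi>] c by simp_all
      obtain \<xi>1 \<xi>2 where "D \<xi>1 = vector [1, 0, 0, 0, 0]" "D \<xi>2 = vector [0, 1, 0, 0, 0]"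
        using surj by metis
      then show False
        using *[of \<xi>1] *[of \<xi>2] by simp
    next
      case False
      then have "m = \<alpha>2"
        by (simp add: max_def split: if_splits)
      note c = crit[OF this]
      have *: "P $ 4 * D \<xi> $ 3 = P $ 3 * D \<xi> $ 4" "P $ 3 = 0 \<Longrightarrow> D \<xi> $ 3 = 0" for \<xi>
        using n(3,4)[of \<xi>] c by simp_all
      obtain \<xi>1 \<xi>2 where "D \<xi>1 = vector [0, 0, 1, 0, 0]" "D \<xi>2 = vector [0, 0, 0, 1, 0]"
        using surj by metis
      then show False
        using *[of \<xi>1] *[of \<xi>2] by simp
    qed
  qed
  then show ?thesis
    using exp_critical_iff[OF p t D[unfolded P_def]] by simp
qed

lemma cut_locus_subset_conjugate_locus: "cut_locus F 0 \<subseteq> conjugate_locus F 0"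
proof
  fix q assume "q \<in> cut_locus F 0"
  then obtain p T where p: "hnorm p = 1" "0 < T" "\<not> straight \<alpha>1 \<alpha>2 p" "m * \<bar>p $ 5\<bar> * T = 2 * pi" "q = extr p T"
    using cut_point by blast
  have w: "p $ 5 \<noteq> 0"
    using p(4) by auto
  have "p \<in> unit_covectors F 0"
    using p(1) hnorm_squared[of p] by (simp add: unit_covectors_def sr_hamiltonian_bi_heisenberg)
  moreover have "m * \<bar>p $ 5\<bar> * s < 2 * pi" if "s < T" for s
    using that w m_pos unfolding p(4)[symmetric] by (intro mult_strict_left_mono) auto
  then have "first_conjugate_time F 0 p T"
    unfolding first_conjugate_time_def
    using p(2) extremal_critical[OF p(1,2,4)] extremal_noncritical[OF p(1,3) _ w] by blast
  ultimately show "q \<in> conjugate_locus F 0"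
    unfolding conjugate_locus_def
    using extremal_arclength_geodesic[OF p(1)] extremal_not_abnormal[OF p(3)] p(5)
    by (intro CollectI exI[of _ "extr p"] exI[of _ p] exI[of _ T]) (simp add: sr_exp_bi_heisenberg)
qed

end

section \<open>The three parameter regimes and the conjugate locus\<close>

theorem theorem1:
  fixes \<alpha>1 \<alpha>2 :: real
  assumes "0 \<le> \<alpha>1" and "0 \<le> \<alpha>2" and "(\<alpha>1, \<alpha>2) \<noteq> (0, 0)"
  defines "F \<equiv> bi_heisenberg \<alpha>1 \<alpha>2"
  shows
    "(0 < \<alpha>2 \<and> \<alpha>2 = \<alpha>1 \<longrightarrow>
        cut_locus F 0 = {vector [0, 0, 0, 0, z] | z. z \<noteq> 0} \<and>
        (\<forall>q\<in>cut_locus F 0. \<exists>\<Gamma>.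
           optimal_family F 0 q (sphere (0 :: real^4) 1) \<Gamma> \<and>
           injective_family F 0 q (sphere 0 1) \<Gamma>)) \<and>
     (0 < \<alpha>2 \<and> \<alpha>2 < \<alpha>1 \<longrightarrow>
        cut_locus F 0 =
          {vector [0, 0, x2, y2, z] | x2 y2 z.
             \<bar>z\<bar> \<ge> (x2\<^sup>2 + y2\<^sup>2) * bi_heisenberg_K \<alpha>1 \<alpha>2 \<and> (x2, y2, z) \<noteq> (0, 0, 0)} \<and>
        (\<forall>q\<in>cut_locus F 0. \<exists>\<Gamma>.
           optimal_family F 0 q (sphere (0 :: real^2) 1) \<Gamma> \<and>
           (\<bar>q $ 5\<bar> > ((q $ 3)\<^sup>2 + (q $ 4)\<^sup>2) * bi_heisenberg_K \<alpha>1 \<alpha>2 \<longrightarrow>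
              injective_family F 0 q (sphere 0 1) \<Gamma>))) \<and>
     (0 = \<alpha>2 \<and> \<alpha>2 < \<alpha>1 \<longrightarrow>
        cut_locus F 0 = {vector [0, 0, x2, y2, z] | x2 y2 z. z \<noteq> 0} \<and>
        (\<forall>q\<in>cut_locus F 0. \<exists>\<Gamma>.
           optimal_family F 0 q (sphere (0 :: real^2) 1) \<Gamma> \<and>
           injective_family F 0 q (sphere 0 1) \<Gamma>)) \<and>
     cut_locus F 0 \<subseteq> conjugate_locus F 0"
proof -
  interpret bi_heisenberg_params \<alpha>1 \<alpha>2
    using assms(1-3) by unfold_locales auto
  have 1: "cut_locus F 0 = {vector [0, 0, 0, 0, z] | z. z \<noteq> 0} \<and>
        (\<forall>q\<in>cut_locus F 0. \<exists>\<Gamma>.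
           optimal_family F 0 q (sphere (0 :: real^4) 1) \<Gamma> \<and>
           injective_family F 0 q (sphere 0 1) \<Gamma>)"
    if "0 < \<alpha>2 \<and> \<alpha>2 = \<alpha>1"
  proof -
    interpret bi_heisenberg_equal \<alpha>1 \<alpha>2
      using that by unfold_locales auto
    show ?thesis
      unfolding F_def using cut_locus_equal optimal_family_equal by blast
  qed
  have 2: "cut_locus F 0 =
          {vector [0, 0, x2, y2, z] | x2 y2 z.
             \<bar>z\<bar> \<ge> (x2\<^sup>2 + y2\<^sup>2) * bi_heisenberg_K \<alpha>1 \<alpha>2 \<and> (x2, y2, z) \<noteq> (0, 0, 0)} \<and>
        (\<forall>q\<in>cut_locus F 0. \<exists>\<Gamma>.
           optimal_family F 0 q (sphere (0 :: real^2) 1) \<Gamma> \<and>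
           (\<bar>q $ 5\<bar> > ((q $ 3)\<^sup>2 + (q $ 4)\<^sup>2) * bi_heisenberg_K \<alpha>1 \<alpha>2 \<longrightarrow>
              injective_family F 0 q (sphere 0 1) \<Gamma>))"
    if \<alpha>: "0 < \<alpha>2 \<and> \<alpha>2 < \<alpha>1"
  proof -
    interpret bi_heisenberg_distinct \<alpha>1 \<alpha>2
      using that by unfold_locales auto
    have K: "slope = bi_heisenberg_K \<alpha>1 \<alpha>2"
      using \<alpha> by (simp add: slope_def bi_heisenberg_K_eq)
    \<comment> \<open>As \<open>slope\<close> is positive, the inequality with \<open>z = 0\<close>
      forces \<open>x = y = 0\<close>. Removing the origin therefore amounts to
      \<open>z \<noteq> 0\<close>.\<close>
    have nz: "z \<noteq> 0 \<longleftrightarrow> (x, y, z) \<noteq> (0, 0, 0)" if "(x\<^sup>2 + y\<^sup>2) * slope \<le> \<bar>z\<bar>" for x y z :: real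
    proof -
      have "x\<^sup>2 + y\<^sup>2 = 0" if "z = 0"
        using \<open>(x\<^sup>2 + y\<^sup>2) * slope \<le> \<bar>z\<bar>\<close> that slope_pos \<alpha> sum_power2_ge_zero[of x y]
        by (simp add: mult_le_0_iff)
      then show ?thesis
        by (auto simp: sum_power2_eq_zero_iff)
    qed
    have "{q :: real^5. q $ 1 = 0 \<and> q $ 2 = 0 \<and> q $ 5 \<noteq> 0 \<and> slope * ((q $ 3)\<^sup>2 + (q $ 4)\<^sup>2) \<le> \<bar>q $ 5\<bar>} =
      {vector [0, 0, x2, y2, z] | x2 y2 z. (x2\<^sup>2 + y2\<^sup>2) * slope \<le> \<bar>z\<bar> \<and> (x2, y2, z) \<noteq> (0, 0, 0)}"
      (is "?A = ?B")
    proof (intro equalityI subsetI)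
      fix q :: "real^5" assume "q \<in> ?A"
      then show "q \<in> ?B"
        by (intro CollectI, rule_tac x = "q $ 3" in exI, rule_tac x = "q $ 4" in exI, rule_tac x = "q $ 5" in exI)
          (auto simp: vec5_eq_iff mult.commute)
    next
      fix q :: "real^5" assume "q \<in> ?B"
      then obtain x y z where q: "q = vector [0, 0, x, y, z]" "(x\<^sup>2 + y\<^sup>2) * slope \<le> \<bar>z\<bar>" "(x, y, z) \<noteq> (0, 0, 0)"
        by blast
      then have "z \<noteq> 0"
        using nz by blast
      then show "q \<in> ?A"
        using q(1,2) by (simp add: mult.commute)
    qed
    then show ?thesis
      using cut_locus_distinct optimal_family_distinct unfolding F_def K by (simp add: mult.commute)
  qed
  have 3: "cut_locus F 0 = {vector [0, 0, x2, y2, z] | x2 y2 z. z \<noteq> 0} \<and>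
        (\<forall>q\<in>cut_locus F 0. \<exists>\<Gamma>.
           optimal_family F 0 q (sphere (0 :: real^2) 1) \<Gamma> \<and>
           injective_family F 0 q (sphere 0 1) \<Gamma>)"
    if \<alpha>: "0 = \<alpha>2 \<and> \<alpha>2 < \<alpha>1"
  proof -
    interpret bi_heisenberg_distinct \<alpha>1 \<alpha>2
      using that by unfold_locales auto
    have "area_ratio (pi * \<alpha>2 / \<alpha>1) = 0" "\<alpha>2 = 0"
      using \<alpha> by auto
    then have s: "slope = 0"
      unfolding slope_def by simp
    have cut: "cut_locus (bi_heisenberg \<alpha>1 \<alpha>2) 0 = {q. q $ 1 = 0 \<and> q $ 2 = 0 \<and> q $ 5 \<noteq> 0}"
      using cut_locus_distinct unfolding s by simp
    also have "\<dots> = {vector [0, 0, x2, y2, z] | x2 y2 z. z \<noteq> 0}" (is "?A = ?B")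
    proof (intro equalityI subsetI)
      fix q :: "real^5" assume "q \<in> ?A"
      then show "q \<in> ?B"
        by (intro CollectI, rule_tac x = "q $ 3" in exI, rule_tac x = "q $ 4" in exI, rule_tac x = "q $ 5" in exI)
          (auto simp: vec5_eq_iff)
    qed auto
    finally have "cut_locus (bi_heisenberg \<alpha>1 \<alpha>2) 0 = ?B" .
    moreover have "\<exists>\<Gamma>. optimal_family (bi_heisenberg \<alpha>1 \<alpha>2) 0 q (sphere (0 :: real^2) 1) \<Gamma> \<and>
           injective_family (bi_heisenberg \<alpha>1 \<alpha>2) 0 q (sphere 0 1) \<Gamma>"
      if q: "q \<in> cut_locus (bi_heisenberg \<alpha>1 \<alpha>2) 0" for q
    proof -
      \<comment> \<open>With \<open>slope = 0\<close> the strict inequality is just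
        \<open>q $ 5 \<noteq> 0\<close>, so injectivity holds at all cut points without a boundary
        exception.\<close>
      have "slope * ((q $ 3)\<^sup>2 + (q $ 4)\<^sup>2) < \<bar>q $ 5\<bar>"
        using q unfolding cut s by simp
      then show ?thesis
        using optimal_family_distinct[OF q] by blast
    qed
    ultimately show ?thesis
      unfolding F_def by blast
  qed
  show ?thesis
    using 1 2 3 cut_locus_subset_conjugate_locus unfolding F_def by blast
qed

end
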